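(* Let $D$ be a countable digraph rooted at $r$, and let $F$ be a vertex-flame in $D$ (i.e. a subdigraph of $D$ containing $r$, rooted at $r$, which is a vertex-flame). Then there is a $D$-large vertex-flame $F^*$ in $D$ with $F \subseteq F^*$.
   Context: Digraphs have no loops or parallel edges. For a vertex $v$ of a digraph $H$, $\mathrm{in}_H(v)$ denotes the set of edges of $H$ with head $v$. An $(x,y)$-path is a directed path from $x$ to $y$; an $(x,y)$-path-system is a set of $(x,y)$-paths that are pairwise internally disjoint. For a set $\mathcal{P}$ of paths, $E^+(\mathcal{P})$ is the set of terminal edges of the paths in $\mathcal{P}$. For a rooted digraph $H$ with root $r$ and $v \neq r$, $\mathcal{G}_H(v)$ is the set of all $I \subseteq \mathrm{in}_H(v)$ such that there is an $(r,v)$-path-system $\mathcal{P}$ in $H$ with $E^+(\mathcal{P}) = I$. A rooted digraph $H$ is a vertex-flame if $\mathrm{in}_H(v) \in \mathcal{G}_H(v)$ for every vertex $v \neq r$. For distinct $x,y$ with $xy$ not an edge, an $(x,y)$-separation is a set $S \subseteq V \setminus \{x,y\}$ meeting every $(x,y)$-path. A set of paths $\mathcal{P}$ and a vertex set $S$ are orthogonal if every path in $\mathcal{P}$ meets $S$ in exactly one vertex and $S \subseteq \bigcup_{P\in\mathcal{P}} V(P)$. An $(x,y)$-path-system $\mathcal{P}$ is Erdős–Menger if some $(x,y)$-separation is orthogonal to it. For $v \neq r$, $\mathfrak{P}_D(v)$ denotes the set of Erdős–Menger $(r,v)$-path-systems in $D - rv$ (the digraph with the edge $rv$ deleted, if present).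 A spanning subdigraph $L \subseteq D$ is $v$-large (for $v \neq r$) if some $\mathcal{P} \in \mathfrak{P}_D(v)$ has all its paths contained in $L$, and $rv \in E(L)$ whenever $rv \in E(D)$. $L$ is $D$-large if it is $v$-large for every $v \in V(D) \setminus \{r\}$. *)

theory Defs
  imports Main "HOL-Library.Countable_Set"
begin

text \<open>A digraph is a vertex set V with an edge relation E of ordered pairs (tail, head).
  Using pairs excludes parallel edges; loops are excluded explicitly.\<close>
definition digraph :: "'a set \<Rightarrow> ('a \<times> 'a) set \<Rightarrow> bool" where
  "digraph V E \<longleftrightarrow> E \<subseteq> V \<times> V \<and> (\<forall>v. (v, v) \<notin> E)"

definition is_path :: "'a set \<Rightarrow> ('a \<times> 'a) set \<Rightarrow> 'a list \<Rightarrow> bool" where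
  "is_path V E p \<longleftrightarrow> p \<noteq> [] \<and> distinct p \<and> set p \<subseteq> V \<and>
     (\<forall>i. Suc i < length p \<longrightarrow> (p ! i, p ! Suc i) \<in> E)"

definition xy_path :: "'a set \<Rightarrow> ('a \<times> 'a) set \<Rightarrow> 'a \<Rightarrow> 'a \<Rightarrow> 'a list \<Rightarrow> bool" where
  "xy_path V E x y p \<longleftrightarrow> is_path V E p \<and> hd p = x \<and> last p = y"

definition path_system :: "'a set \<Rightarrow> ('a \<times> 'a) set \<Rightarrow> 'a \<Rightarrow> 'a \<Rightarrow> 'a list set \<Rightarrow> bool" where
  "path_system V E x y P \<longleftrightarrow> (\<forall>p\<in>P. xy_path V E x y p) \<and>
     (\<forall>p\<in>P. \<forall>q\<in>P. p \<noteq> q \<longrightarrow> set p \<inter> set q \<subseteq> {x, y})"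

definition last_edge :: "'a list \<Rightarrow> 'a \<times> 'a" where
  "last_edge p = (last (butlast p), last p)"

definition terminal_edges :: "'a list set \<Rightarrow> ('a \<times> 'a) set" where
  "terminal_edges P = last_edge ` P"

definition in_edges :: "('a \<times> 'a) set \<Rightarrow> 'a \<Rightarrow> ('a \<times> 'a) set" where
  "in_edges E v = {e \<in> E. snd e = v}"

definition G_set :: "'a set \<Rightarrow> ('a \<times> 'a) set \<Rightarrow> 'a \<Rightarrow> 'a \<Rightarrow> ('a \<times> 'a) set set" where
  "G_set V E r v = {I. I \<subseteq> in_edges E v \<and> (\<exists>P. path_system V E r v P \<and> terminal_edges P = I)}"

definition vertex_flame :: "'a set \<Rightarrow> ('a \<times> 'a) set \<Rightarrow> 'a \<Rightarrow> bool" where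
  "vertex_flame V E r \<longleftrightarrow> (\<forall>v \<in> V - {r}. in_edges E v \<in> G_set V E r v)"

definition separation :: "'a set \<Rightarrow> ('a \<times> 'a) set \<Rightarrow> 'a \<Rightarrow> 'a \<Rightarrow> 'a set \<Rightarrow> bool" where
  "separation V E x y S \<longleftrightarrow> x \<noteq> y \<and> (x, y) \<notin> E \<and> S \<subseteq> V - {x, y} \<and>
     (\<forall>p. xy_path V E x y p \<longrightarrow> set p \<inter> S \<noteq> {})"

definition orthogonal :: "'a list set \<Rightarrow> 'a set \<Rightarrow> bool" where
  "orthogonal P S \<longleftrightarrow> (\<forall>p\<in>P. \<exists>!s. s \<in> set p \<and> s \<in> S) \<and> S \<subseteq> (\<Union>p\<in>P. set p)"

definition erdos_menger :: "'a set \<Rightarrow> ('a \<times> 'a) set \<Rightarrow> 'a \<Rightarrow> 'a \<Rightarrow> 'a list set \<Rightarrow> bool" where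
  "erdos_menger V E x y P \<longleftrightarrow> path_system V E x y P \<and>
     (\<exists>S. separation V E x y S \<and> orthogonal P S)"

definition EM_systems :: "'a set \<Rightarrow> ('a \<times> 'a) set \<Rightarrow> 'a \<Rightarrow> 'a \<Rightarrow> 'a list set set" where
  "EM_systems V E r v = {P. erdos_menger V (E - {(r, v)}) r v P}"

definition v_large :: "'a set \<Rightarrow> ('a \<times> 'a) set \<Rightarrow> 'a \<Rightarrow> ('a \<times> 'a) set \<Rightarrow> 'a \<Rightarrow> bool" where
  "v_large V E r L v \<longleftrightarrow> L \<subseteq> E \<and>
     (\<exists>P \<in> EM_systems V E r v. \<forall>p\<in>P. is_path V L p) \<and>
     ((r, v) \<in> E \<longrightarrow> (r, v) \<in> L)"

definition D_large :: "'a set \<Rightarrow> ('a \<times> 'a) set \<Rightarrow> 'a \<Rightarrow> ('a \<times> 'a) set \<Rightarrow> bool" where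
  "D_large V E r L \<longleftrightarrow> L \<subseteq> E \<and> (\<forall>v \<in> V - {r}. v_large V E r L v)"

end

theory Submission
  imports Defs "HOL-Library.Nat_Bijection"
begin

text \<open>
  Enlarge the flame to a maximal subdigraph \<open>Q\<close> of \<open>E\<close> in which, for every vertex \<open>u\<close>, the in-neighbours
  of the flame together with any finite set of further in-neighbours are still linked from the
  out-neighbours of the root, by a linkage that differs from a fixed one in finitely many paths only. Then
  treat the vertices one at a time: at \<open>v\<close> delete from \<open>Q\<close> all edges into \<open>v\<close> except those from a
  suitable set \<open>I\<close>. The greatest wave of the reversed web of \<open>v\<close> has a boundary that separates \<open>v\<close> from the
  root not only in \<open>Q\<close> but in \<open>E\<close>, by maximality of \<open>Q\<close> and since earlier vertices carry orthogonal
  separators; a Menger-type theorem for countable webs and Pym's linkage theorem give an orthogonal linkage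
  whose last vertices form \<open>I\<close>. To keep the finite linkage condition at the remaining vertices, \<open>I\<close> must meet,
  for each of countably many requirements, the set of in-neighbours of \<open>v\<close> that can satisfy it. Infinite such
  sets are hit greedily, since finitely many fixed vertices cannot block them; finite ones are hit by combining
  waves. The intersection of the decreasing sequence of digraphs is the required flame.
\<close>

section \<open>Paths and augmentation\<close>

text \<open>The obstacle is that deleting edges into \<open>v\<close> can spoil the linkage
  condition at infinitely many other vertices at once. Two facts tame this. Requirements are
  countable because each adds only finitely many in-neighbours to those of the flame. And the paths
  of a linkage are disjoint, so together they use at most one edge into \<open>v\<close>: a
  requirement that fails after the deletion is repaired by a single in-neighbour. Hence preserving
  all requirements means that \<open>I\<close> meets a countable family of sets. Linkages may be
  infinite, so "one path more" cannot be read off from cardinalities; bounding the deviation reduces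
  the comparison of two linkages to a finite count. The bound is given up only at \<open>v\<close>
  itself, when its linkage becomes final. A final linkage must survive later deletions; it uses at
  most one edge into each later vertex, so the finitely many linkages fixed so far force only
  finitely many in-neighbours into \<open>I\<close>.\<close>

definition dipath :: "('a \<times> 'a) set \<Rightarrow> 'a list \<Rightarrow> bool" where
  "dipath E p \<longleftrightarrow> p \<noteq> [] \<and> distinct p \<and> successively (\<lambda>x y. (x, y) \<in> E) p"

definition disjoint_paths :: "('a \<times> 'a) set \<Rightarrow> 'i set \<Rightarrow> ('i \<Rightarrow> 'a list) \<Rightarrow> bool" where
  "disjoint_paths E I f \<longleftrightarrow> (\<forall>i\<in>I. dipath E (f i)) \<and>
     (\<forall>i\<in>I. \<forall>j\<in>I. i \<noteq> j \<longrightarrow> set (f i) \<inter> set (f j) = {})"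

text \<open>Edges at \<open>U\<close> are removed, not vertices, so a one-vertex path inside
  \<open>U\<close> survives. This is why avoidance of \<open>U\<close> is concluded only for paths
  whose head lies outside \<open>U\<close>.\<close>

definition del :: "('a \<times> 'a) set \<Rightarrow> 'a set \<Rightarrow> ('a \<times> 'a) set" where
  "del E U = {e \<in> E. fst e \<notin> U \<and> snd e \<notin> U}"

text \<open>Every path from \<open>A\<close> that ends outside \<open>X\<close> meets this set.
  Sources outside \<open>X\<close> belong to it because a path starting there need not visit
  \<open>X\<close> at all.\<close>

definition boundary :: "('a \<times> 'a) set \<Rightarrow> 'a set \<Rightarrow> 'a set \<Rightarrow> 'a set" where
  "boundary E A X = (A \<union> E `` X) - X"

text \<open>Indexing by last vertices makes the targets explicit. Targets may lie inside
  \<open>X\<close>; later fans carry such extra targets besides a boundary.\<close>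

definition fan :: "('a \<times> 'a) set \<Rightarrow> 'a set \<Rightarrow> 'a set \<Rightarrow> 'a set \<Rightarrow> ('a \<Rightarrow> 'a list) \<Rightarrow> bool" where
  "fan E A X T f \<longleftrightarrow> disjoint_paths E T f \<and>
     (\<forall>t\<in>T. hd (f t) \<in> A \<and> last (f t) = t \<and> set (butlast (f t)) \<subseteq> X)"

lemma dipath_ne: "dipath E p \<Longrightarrow> p \<noteq> []"
  by (simp add: dipath_def)

lemma dipath_single [simp]: "dipath E [x]"
  by (simp add: dipath_def)

lemma dipath_append:
  "p \<noteq> [] \<Longrightarrow> q \<noteq> [] \<Longrightarrow>
   dipath E (p @ q) \<longleftrightarrow> dipath E p \<and> dipath E q \<and> (last p, hd q) \<in> E \<and> set p \<inter> set q = {}"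
  by (auto simp: dipath_def successively_append_iff)

lemma dipath_appendD1: "dipath E (p @ q) \<Longrightarrow> p \<noteq> [] \<Longrightarrow> dipath E p"
  by (auto simp: dipath_def successively_append_iff)

lemma dipath_appendD2: "dipath E (p @ q) \<Longrightarrow> q \<noteq> [] \<Longrightarrow> dipath E q"
  by (auto simp: dipath_def successively_append_iff)

lemma dipath_prefix: "dipath E (p @ y # q) \<Longrightarrow> dipath E (p @ [y])"
  using dipath_appendD1[of E "p @ [y]" q] by simp

lemma dipath_mono: "dipath E p \<Longrightarrow> E \<subseteq> E' \<Longrightarrow> dipath E' p"
  unfolding dipath_def by (auto elim!: successively_mono)

lemma dipath_edge: "dipath E (p @ x # y # q) \<Longrightarrow> (x, y) \<in> E"
  by (auto simp: dipath_def successively_append_iff)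

lemma dipath_concat:
  assumes "dipath E p" "dipath E q" "last p = hd q" "set p \<inter> set (tl q) = {}"
  shows "dipath E (p @ tl q)" "hd (p @ tl q) = hd p" "last (p @ tl q) = last q"
proof -
  obtain y q' where q: "q = y # q'" using assms(2) by (cases q) (auto simp: dipath_def)
  show "dipath E (p @ tl q)"
  proof (cases "q' = []")
    case True then show ?thesis using assms q by simp
  next
    case False
    then have "dipath E q'" "(y, hd q') \<in> E"
      using assms(2) q dipath_append[of "[y]" q' E] by auto
    then show ?thesis using assms q False dipath_append[of p q' E] dipath_ne[OF assms(1)] by simp
  qed
  show "hd (p @ tl q) = hd p" using dipath_ne[OF assms(1)] by simp
  show "last (p @ tl q) = last q" using assms q by (cases "q' = []") auto
qed

lemma dipath_cong:
  assumes "dipath E p" "\<And>x y. x \<in> set p \<Longrightarrow> y \<in> set p \<Longrightarrow> (x, y) \<in> E \<Longrightarrow> (x, y) \<in> E'"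
  shows "dipath E' p"
  using assms unfolding dipath_def by (auto elim!: successively_mono)

lemma dipath_closed:
  assumes "dipath E p" "hd p \<in> X" "\<And>x y. x \<in> X \<Longrightarrow> (x, y) \<in> E \<Longrightarrow> y \<in> set p \<Longrightarrow> y \<in> X"
  shows "set p \<subseteq> X"
  using assms
proof (induction p)
  case (Cons a p)
  show ?case
  proof (cases "p = []")
    case False
    have p: "dipath E p" "(a, hd p) \<in> E" using Cons.prems(1) False dipath_append[of "[a]" p E] by auto
    then have "hd p \<in> X" using Cons.prems False by (metis hd_in_set list.sel(1) list.set_intros(2))
    then show ?thesis using Cons p by auto
  next
    case True then show ?thesis using Cons.prems(2) by simp
  qed
qed auto

lemma del_subset: "del E U \<subseteq> E"
  by (auto simp: del_def)

lemma del_mem [simp]: "(x, y) \<in> del E U \<longleftrightarrow> (x, y) \<in> E \<and> x \<notin> U \<and> y \<notin> U"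
  by (auto simp: del_def)

lemma del_del [simp]: "del (del E U) W = del E (U \<union> W)"
  by (auto simp: del_def)

lemma del_mono: "E \<subseteq> E' \<Longrightarrow> U' \<subseteq> U \<Longrightarrow> del E U \<subseteq> del E' U'"
  by (auto simp: del_def)

lemma dipath_del_avoid:
  assumes "dipath (del E U) p" "hd p \<notin> U" shows "set p \<inter> U = {}"
  using dipath_closed[OF assms(1), of "- U"] assms by auto

lemma dipath_delD: "dipath (del E U) p \<Longrightarrow> dipath E p"
  using dipath_mono del_subset by blast

lemma dipath_delI: "dipath E p \<Longrightarrow> set p \<inter> U = {} \<Longrightarrow> dipath (del E U) p"
  by (rule dipath_cong) auto

lemma dipath_rev [simp]: "dipath (E\<inverse>) (rev p) = dipath E p"
  by (simp add: dipath_def)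

lemma dipath_revI: "dipath (E\<inverse>) p \<Longrightarrow> dipath E (rev p)"
  using dipath_rev[of E "rev p"] by simp

lemma disjoint_pathsD: "disjoint_paths E I f \<Longrightarrow> i \<in> I \<Longrightarrow> dipath E (f i)"
  by (simp add: disjoint_paths_def)

lemma disjoint_paths_eq: "disjoint_paths E I f \<Longrightarrow> i \<in> I \<Longrightarrow> j \<in> I \<Longrightarrow> x \<in> set (f i) \<Longrightarrow> x \<in> set (f j) \<Longrightarrow> i = j"
  by (auto simp: disjoint_paths_def)

lemma disjoint_paths_subset: "disjoint_paths E I f \<Longrightarrow> J \<subseteq> I \<Longrightarrow> disjoint_paths E J f"
  unfolding disjoint_paths_def by blast

lemma disjoint_paths_mono: "disjoint_paths E I f \<Longrightarrow> E \<subseteq> E' \<Longrightarrow> disjoint_paths E' I f"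
  by (auto simp: disjoint_paths_def intro: dipath_mono)

lemma disjoint_pathsI:
  assumes "\<And>i. i \<in> I \<Longrightarrow> dipath E (f i)"
    and "\<And>i j x. i \<in> I \<Longrightarrow> j \<in> I \<Longrightarrow> x \<in> set (f i) \<Longrightarrow> x \<in> set (f j) \<Longrightarrow> i = j"
  shows "disjoint_paths E I f"
  using assms unfolding disjoint_paths_def by (metis disjoint_iff)

lemma fanD:
  assumes "fan E A X T f" "t \<in> T"
  shows "dipath E (f t)" "hd (f t) \<in> A" "last (f t) = t" "set (butlast (f t)) \<subseteq> X"
    "f t \<noteq> []" "t \<in> set (f t)" "set (f t) \<subseteq> insert t X"
proof -
  show *: "dipath E (f t)" "hd (f t) \<in> A" "last (f t) = t" "set (butlast (f t)) \<subseteq> X"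
    using assms by (auto simp: fan_def disjoint_paths_def)
  show **: "f t \<noteq> []" using *(1) by (rule dipath_ne)
  show "t \<in> set (f t)" using ** *(3) last_in_set by metis
  have "f t = butlast (f t) @ [t]" using ** *(3) by (metis append_butlast_last_id)
  then have "set (f t) = insert t (set (butlast (f t)))"
    by (metis Un_insert_right list.set(1) list.simps(15) set_append sup_bot.right_neutral)
  then show "set (f t) \<subseteq> insert t X" using *(4) by auto
qed

lemma fan_dpf: "fan E A X T f \<Longrightarrow> disjoint_paths E T f"
  by (simp add: fan_def)

lemma fan_subset: "fan E A X T f \<Longrightarrow> S \<subseteq> T \<Longrightarrow> fan E A X S f"
  unfolding fan_def using disjoint_paths_subset by blast

text \<open>In a configuration \<open>(f, h)\<close>, the path \<open>h\<close> grows from \<open>s\<close> off the family \<open>f\<close>. When it runs into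
  a path of \<open>f\<close>, it takes over the rest of that path, whose cut-off initial piece becomes the new \<open>h\<close>.\<close>

inductive config :: "('a \<times> 'a) set \<Rightarrow> 'a set \<Rightarrow> ('a \<Rightarrow> 'a list) \<Rightarrow> 'a \<Rightarrow> ('a \<Rightarrow> 'a list) \<Rightarrow> 'a list \<Rightarrow> bool"
  for E B f0 s where
  init: "config E B f0 s f0 [s]"
| extend: "config E B f0 s f h \<Longrightarrow> (last h, y) \<in> E \<Longrightarrow> y \<notin> set h \<Longrightarrow> \<forall>b\<in>B. y \<notin> set (f b)
    \<Longrightarrow> config E B f0 s f (h @ [y])"
| swap: "config E B f0 s f h \<Longrightarrow> (last h, y) \<in> E \<Longrightarrow> b \<in> B \<Longrightarrow> f b = p @ y # q \<Longrightarrow> p \<noteq> []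
    \<Longrightarrow> config E B f0 s (f(b := h @ y # q)) p"
| truncate: "config E B f0 s f (h @ h') \<Longrightarrow> h \<noteq> [] \<Longrightarrow> config E B f0 s f h"

text \<open>The search region of the augmentation: the places that the growing end can reach.
  Truncation lets the walk retreat, so every vertex of a configuration path is counted.\<close>

definition exposed :: "('a \<times> 'a) set \<Rightarrow> 'a set \<Rightarrow> ('a \<Rightarrow> 'a list) \<Rightarrow> 'a \<Rightarrow> 'a set" where
  "exposed E B f0 s = {last h |f h. config E B f0 s f h}"

lemma config_ne: "config E B f0 s f h \<Longrightarrow> h \<noteq> []"
  by (induction rule: config.induct) auto

lemma config_exposed: "config E B f0 s f h \<Longrightarrow> set h \<subseteq> exposed E B f0 s"
proof
  fix x assume "config E B f0 s f h" "x \<in> set h"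
  then obtain p q where h: "h = (p @ [x]) @ q" by (metis append.assoc append_Cons append_Nil split_list)
  have "config E B f0 s f (p @ [x])"
    by (rule config.truncate[of E B f0 s f _ q]) (use \<open>config E B f0 s f h\<close> h in auto)
  then have "last (p @ [x]) \<in> exposed E B f0 s" unfolding exposed_def by blast
  then show "x \<in> exposed E B f0 s" by simp
qed

lemma exposed_mono:
  assumes "E \<subseteq> E'" shows "exposed E B f0 s \<subseteq> exposed E' B f0 s"
proof -
  have "config E' B f0 s f h" if "config E B f0 s f h" for f h
    using that
  proof (induction rule: config.induct)
    case (swap f h y b p q) show ?case
      by (rule config.swap[OF swap.IH]) (use swap assms in auto)
  next
    case (truncate f h h') show ?case by (rule config.truncate[OF truncate.IH truncate.hyps(2)])
  qed (use assms in \<open>auto intro: config.init config.extend\<close>)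
  then show ?thesis unfolding exposed_def by blast
qed

text \<open>The last invariant is the decisive one: a current path shares a nonempty tail with the
  original path, and whatever was cut off or put in front is exposed. Heads are only permuted, with
  \<open>s\<close> as the one additional starting point.\<close>

lemma config_inv:
  assumes "config E B f0 s f h" and "disjoint_paths E B f0" "\<forall>b\<in>B. last (f0 b) = b" "\<forall>b\<in>B. s \<notin> set (f0 b)"
  shows "dipath E h \<and> disjoint_paths E B f \<and> (\<forall>b\<in>B. last (f b) = b) \<and> (\<forall>b\<in>B. set h \<inter> set (f b) = {}) \<and>
    insert (hd h) (hd ` f ` B) = insert s (hd ` f0 ` B) \<and> finite {b\<in>B. f b \<noteq> f0 b} \<and>
    (\<forall>b\<in>B. \<exists>p q g. f b = p @ q \<and> f0 b = g @ q \<and> set p \<subseteq> exposed E B f0 s \<and>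
       set g \<subseteq> exposed E B f0 s \<and> q \<noteq> [] \<and> (p = [] \<longrightarrow> g = []))"
  using assms(1)
proof (induction rule: config.induct)
  case init
  have "\<exists>p q g. f0 b = p @ q \<and> f0 b = g @ q \<and> set p \<subseteq> exposed E B f0 s \<and>
       set g \<subseteq> exposed E B f0 s \<and> q \<noteq> [] \<and> (p = [] \<longrightarrow> g = [])" if "b \<in> B" for b
    by (rule exI[of _ "[]"], rule exI[of _ "f0 b"], rule exI[of _ "[]"])
      (use that dipath_ne[OF disjoint_pathsD[OF assms(2)]] in auto)
  then show ?case using assms(2-4) by simp
next
  case (extend f h y)
  have h: "h \<noteq> []" using extend.hyps(1) by (rule config_ne)
  have "dipath E (h @ [y])" using extend dipath_append[OF h, of "[y]" E] by auto
  then show ?case using extend h by simp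
next
  case (truncate f h h')
  have "hd (h @ h') = hd h" using truncate by simp
  moreover have "dipath E h" using truncate dipath_appendD1[of E h h'] by blast
  ultimately show ?case using truncate.IH by (auto simp: Int_Un_distrib2)
next
  case (swap f h y b p q)
  let ?f = "f(b := h @ y # q)"
  have h: "h \<noteq> []" using swap.hyps(1) by (rule config_ne)
  have IH: "dipath E h" "disjoint_paths E B f" "\<forall>b\<in>B. last (f b) = b" "\<forall>b\<in>B. set h \<inter> set (f b) = {}"
    "insert (hd h) (hd ` f ` B) = insert s (hd ` f0 ` B)" "finite {b\<in>B. f b \<noteq> f0 b}"
    using swap.IH by blast+
  have fb: "dipath E (p @ y # q)" using IH(2) swap(3,4) by (auto simp: disjoint_paths_def)
  have p: "dipath E p" "dipath E (y # q)" "set p \<inter> set (y # q) = {}"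
    using fb dipath_append[OF swap(5), of "y # q" E] by auto
  have dis: "set h \<inter> set (p @ y # q) = {}" using IH(4) swap(3,4) by metis
  have new: "dipath E (h @ y # q)" using dipath_append[OF h, of "y # q" E] p IH(1) dis swap by auto
  have c: "config E B f0 s ?f p" using swap.hyps by (auto intro: config.swap)
  have pX: "set p \<subseteq> exposed E B f0 s" using config_exposed[OF c] .
  have hX: "set h \<subseteq> exposed E B f0 s" using config_exposed[OF swap.hyps(1)] .
  have n1: "disjoint_paths E B ?f"
  proof (rule disjoint_pathsI)
    show "dipath E (?f i)" if "i \<in> B" for i using that IH(2) new by (auto simp: disjoint_paths_def)
    have 1: "j = b" if "j \<in> B" "x \<in> set (h @ y # q)" "x \<in> set (f j)" for j x
    proof -
      have "x \<notin> set h" using that IH(4) by blast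
      then have "x \<in> set (f b)" using that swap(4) by auto
      then show ?thesis using disjoint_paths_eq[OF IH(2)] that swap(3) by metis
    qed
    show "i = j" if "i \<in> B" "j \<in> B" "x \<in> set (?f i)" "x \<in> set (?f j)" for i j x
    proof (cases "i = b"; cases "j = b")
      assume "i \<noteq> b" "j \<noteq> b" then show ?thesis using that(3,4) disjoint_paths_eq[OF IH(2) that(1,2)] by simp
    next
      assume "i = b" "j \<noteq> b" then show ?thesis using that(3,4) 1[OF that(2)] by simp
    next
      assume "i \<noteq> b" "j = b" then show ?thesis using that(3,4) 1[OF that(1)] by simp
    qed simp
  qed
  have n2: "last (?f c) = c" if "c \<in> B" for c
  proof (cases "c = b")
    case True
    have "last (p @ y # q) = b" using IH(3) swap(3,4) by metis
    then show ?thesis using True by simp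
  qed (use IH(3) that in simp)
  have n3: "set p \<inter> set (?f c) = {}" if "c \<in> B" for c
  proof (cases "c = b")
    case True then show ?thesis using p(3) dis by auto
  next
    case False
    then have "set (f b) \<inter> set (f c) = {}" using IH(2) swap(3) that unfolding disjoint_paths_def by metis
    then show ?thesis using swap(4) False by auto
  qed
  have n4: "insert (hd p) (hd ` ?f ` B) = insert s (hd ` f0 ` B)"
  proof -
    have "hd (f b) = hd p" using swap by simp
    have "?f ` B = insert (h @ y # q) (f ` (B - {b}))" using swap(3) by auto
    then have "hd ` ?f ` B = insert (hd h) (hd ` f ` (B - {b}))" using h by auto
    moreover have "hd ` f ` B = insert (hd p) (hd ` f ` (B - {b}))"
      using swap(3) \<open>hd (f b) = hd p\<close> by (metis image_insert insert_Diff)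
    ultimately show ?thesis using IH(5) by (simp add: insert_commute)
  qed
  have n5: "finite {c\<in>B. ?f c \<noteq> f0 c}"
    by (rule finite_subset[of _ "insert b {c\<in>B. f c \<noteq> f0 c}"]) (use IH(6) in auto)
  have n6: "\<exists>p q g. ?f c = p @ q \<and> f0 c = g @ q \<and> set p \<subseteq> exposed E B f0 s \<and>
       set g \<subseteq> exposed E B f0 s \<and> q \<noteq> [] \<and> (p = [] \<longrightarrow> g = [])" if c: "c \<in> B" for c
  proof (cases "c = b")
    case False then show ?thesis using c swap.IH by simp
  next
    case True
    obtain \<alpha> \<beta> \<gamma> where a: "f b = \<alpha> @ \<beta>" "f0 b = \<gamma> @ \<beta>" "set \<alpha> \<subseteq> exposed E B f0 s"
       "set \<gamma> \<subseteq> exposed E B f0 s" "\<beta> \<noteq> []"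
      using swap.IH swap(3) by blast
    have eq: "\<alpha> @ \<beta> = p @ y # q" using a(1) swap(4) by simp
    show ?thesis
    proof (cases "\<exists>us. \<alpha> @ us = p \<and> \<beta> = us @ y # q")
      case True
      then obtain us where us: "\<alpha> @ us = p" "\<beta> = us @ y # q" by blast
      show ?thesis
        by (rule exI[of _ h], rule exI[of _ "y # q"], rule exI[of _ "\<gamma> @ us"])
          (use us a pX hX h \<open>c = b\<close> in auto)
    next
      case False
      then obtain us where us: "\<alpha> = p @ us" "us @ \<beta> = y # q" "us \<noteq> []"
        using eq unfolding append_eq_append_conv2 by (metis append.right_neutral append_Nil)
      then obtain us' where us': "us = y # us'" by (cases us) auto
      show ?thesis
        by (rule exI[of _ "h @ us"], rule exI[of _ \<beta>], rule exI[of _ \<gamma>])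
          (use us us' a pX hX h \<open>c = b\<close> in auto)
    qed
  qed
  show ?case by (intro conjI ballI p(1) n1 n2 n3 n4 n5 n6)
qed

text \<open>Augmentation dichotomy: an exposed vertex can be linked in addition to \<open>B\<close>,
  while an edge leaving the exposed region ends at the first exit of an original path. There is at
  most one such exit per path, so this boundary takes the place of a minimum cut.\<close>

lemma
  assumes "disjoint_paths E B f0" "\<forall>b\<in>B. last (f0 b) = b" "\<forall>b\<in>B. s \<notin> set (f0 b)"
  shows exposed_source: "s \<in> exposed E B f0 s"
    and exposed_targets: "exposed E B f0 s \<inter> B = {}"
    and exposed_boundary: "\<And>x y. x \<in> exposed E B f0 s \<Longrightarrow> (x, y) \<in> E \<Longrightarrow> y \<notin> exposed E B f0 s \<Longrightarrow>
        \<exists>b\<in>B. \<exists>p q. f0 b = p @ y # q \<and> set p \<subseteq> exposed E B f0 s"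
    and exposed_augment: "\<And>z. z \<in> exposed E B f0 s \<Longrightarrow> \<exists>f h. disjoint_paths E B f \<and> (\<forall>b\<in>B. last (f b) = b) \<and>
        dipath E h \<and> last h = z \<and> (\<forall>b\<in>B. set h \<inter> set (f b) = {}) \<and>
        insert (hd h) (hd ` f ` B) = insert s (hd ` f0 ` B) \<and> finite {b\<in>B. f b \<noteq> f0 b} \<and>
        set h \<subseteq> exposed E B f0 s \<and> (\<forall>b\<in>B. set (f b) \<subseteq> set (f0 b) \<union> exposed E B f0 s)"
proof -
  let ?X = "exposed E B f0 s"
  note inv = config_inv[OF _ assms]
  note inv_tail = inv[THEN conjunct2, THEN conjunct2, THEN conjunct2, THEN conjunct2, THEN conjunct2,
      THEN conjunct2, rule_format]
  note inv_disj = inv[THEN conjunct2, THEN conjunct2, THEN conjunct2, THEN conjunct1, rule_format]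
  show "s \<in> ?X" unfolding exposed_def using config.init[of E B f0 s] by force
  show "?X \<inter> B = {}"
  proof -
    have "last h \<notin> B" if "config E B f0 s f h" for f h
    proof
      assume b: "last h \<in> B"
      have "last h \<in> set (f (last h))" using inv[OF that] b by (metis disjoint_pathsD last_in_set dipath_ne)
      moreover have "last h \<in> set h" using config_ne[OF that] by simp
      ultimately show False using inv_disj[OF that b] by blast
    qed
    then show ?thesis unfolding exposed_def by blast
  qed
  show "\<exists>b\<in>B. \<exists>p q. f0 b = p @ y # q \<and> set p \<subseteq> ?X" if xy: "x \<in> ?X" "(x, y) \<in> E" "y \<notin> ?X" for x y
  proof -
    obtain f h where fh: "config E B f0 s f h" "x = last h" using xy(1) unfolding exposed_def by blast
    have "y \<notin> set h" using config_exposed[OF fh(1)] xy by blast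
    have "\<exists>b\<in>B. y \<in> set (f b)"
    proof (rule ccontr)
      assume "\<not> ?thesis"
      then have "config E B f0 s f (h @ [y])" using config.extend[OF fh(1)] xy fh \<open>y \<notin> set h\<close> by simp
      then have "set (h @ [y]) \<subseteq> ?X" by (rule config_exposed)
      then show False using xy(3) by simp
    qed
    then obtain b where b: "b \<in> B" "y \<in> set (f b)" by blast
    obtain \<alpha> \<beta> \<gamma> where a: "f b = \<alpha> @ \<beta>" "f0 b = \<gamma> @ \<beta>" "set \<alpha> \<subseteq> ?X"
       "set \<gamma> \<subseteq> ?X" "\<alpha> = [] \<longrightarrow> \<gamma> = []"
      using inv_tail[OF fh(1) b(1)] by blast
    have "y \<in> set \<beta>" using a b xy by auto
    then obtain \<beta>1 q where q: "\<beta> = \<beta>1 @ y # q" by (metis split_list)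
    \<comment> \<open>Unless \<open>y\<close> is the head of its current path, swapping at
      \<open>y\<close> turns the piece before \<open>y\<close> into the growing path, which exposes
      that piece.\<close>
    have "set (\<alpha> @ \<beta>1) \<subseteq> ?X"
    proof (cases "\<alpha> @ \<beta>1 = []")
      case False
      have "config E B f0 s (f(b := h @ y # q)) (\<alpha> @ \<beta>1)"
      proof (rule config.swap[OF fh(1)])
        show "(last h, y) \<in> E" "b \<in> B" using xy fh b by simp_all
        show "f b = (\<alpha> @ \<beta>1) @ y # q" using a(1) q by simp
      qed (rule False)
      then show ?thesis by (rule config_exposed)
    qed auto
    moreover have "f0 b = (\<gamma> @ \<beta>1) @ y # q" using a(2) q by simp
    ultimately show ?thesis using b(1) a(4) by (metis Un_subset_iff set_append)
  qed
  show "\<exists>f h. disjoint_paths E B f \<and> (\<forall>b\<in>B. last (f b) = b) \<and>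
        dipath E h \<and> last h = z \<and> (\<forall>b\<in>B. set h \<inter> set (f b) = {}) \<and>
        insert (hd h) (hd ` f ` B) = insert s (hd ` f0 ` B) \<and> finite {b\<in>B. f b \<noteq> f0 b} \<and>
        set h \<subseteq> ?X \<and> (\<forall>b\<in>B. set (f b) \<subseteq> set (f0 b) \<union> ?X)" if z: "z \<in> ?X" for z
  proof -
    obtain f h where fh: "config E B f0 s f h" "z = last h" using z unfolding exposed_def by blast
    have "set (f b) \<subseteq> set (f0 b) \<union> ?X" if "b \<in> B" for b
    proof -
      obtain p q g where "f b = p @ q" "f0 b = g @ q" "set p \<subseteq> ?X" using inv_tail[OF fh(1) \<open>b \<in> B\<close>] by blast
      then show ?thesis by auto
    qed
    then have *: "\<forall>b\<in>B. set (f b) \<subseteq> set (f0 b) \<union> ?X" by blast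
    show ?thesis unfolding fh(2)
      by (rule exI[of _ f], rule exI[of _ h])
        (intro conjI refl config_exposed[OF fh(1)] * inv[OF fh(1), THEN conjunct1] inv[OF fh(1), THEN conjunct2, THEN conjunct1] inv[OF fh(1), THEN conjunct2, THEN conjunct2, THEN conjunct1] inv[OF fh(1), THEN conjunct2, THEN conjunct2, THEN conjunct2, THEN conjunct1] inv[OF fh(1), THEN conjunct2, THEN conjunct2, THEN conjunct2, THEN conjunct2, THEN conjunct1] inv[OF fh(1), THEN conjunct2, THEN conjunct2, THEN conjunct2, THEN conjunct2, THEN conjunct2, THEN conjunct1])
  qed
qed

section \<open>Waves\<close>

lemma split_last_in:
  assumes "set p \<inter> Z \<noteq> {}"
  shows "\<exists>u x w. p = u @ x # w \<and> x \<in> Z \<and> set w \<inter> Z = {}"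
proof -
  have "\<exists>x\<in>set p. x \<in> Z" using assms by auto
  from split_list_last_prop[OF this] show ?thesis by blast
qed

lemma split_exit_unique:
  assumes "p @ x # q = p' @ x' # q'" "set p \<subseteq> X" "set p' \<subseteq> X" "x \<notin> X" "x' \<notin> X"
  shows "p = p' \<and> x = x' \<and> q = q'"
  using assms by (induction p arbitrary: p') (case_tac p'; auto)+

lemma set_butlast_last: "p \<noteq> [] \<Longrightarrow> set p = insert (last p) (set (butlast p))"
  by (metis append_butlast_last_id list.set(1,2) set_append Un_insert_right sup_bot_right)

lemma last_in_tl: "p \<noteq> [] \<Longrightarrow> last p \<noteq> hd p \<Longrightarrow> tl p \<noteq> [] \<and> last p \<in> set (tl p) \<and> hd p \<in> set (butlast p)"
  by (cases p) auto

section \<open>Composition of fans and of waves\<close>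

lemma fan_join:
  assumes f1: "fan E A X1 T1 f1" and K: "K \<subseteq> T1" and g: "disjoint_paths E S g"
    and gS: "\<And>t. t \<in> S \<Longrightarrow> last (g t) = t \<and> hd (g t) \<in> T1 - K \<and> set (butlast (g t)) \<subseteq> X2 \<and>
      set (tl (g t)) \<inter> (X1 \<union> T1) = {}"
  shows "fan E A (X1 \<union> X2) (K \<union> S) (\<lambda>t. if t \<in> K then f1 t else f1 (hd (g t)) @ tl (g t))"
    (is "fan _ _ _ _ ?f")
proof -
  have SK: "t \<notin> K" if "t \<in> S" for t
    using gS[OF that] last_in_tl[OF dipath_ne[OF disjoint_pathsD[OF g that]]] K by (cases "t = hd (g t)") auto
  have f1set: "set (f1 t) \<subseteq> X1 \<union> T1" if "t \<in> T1" for t using fanD(7)[OF f1 that] that by auto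
  have cc: "dipath E (?f t)" "hd (?f t) = hd (f1 (hd (g t)))" "last (?f t) = t" if "t \<in> S" for t
  proof -
    have "set (f1 (hd (g t))) \<inter> set (tl (g t)) = {}"
      using gS[OF that] f1set by blast
    then show "dipath E (?f t)" "hd (?f t) = hd (f1 (hd (g t)))" "last (?f t) = t"
      using dipath_concat[of E "f1 (hd (g t))" "g t"] gS[OF that] SK[OF that] fanD[OF f1, of "hd (g t)"]
        disjoint_pathsD[OF g that] by auto
  qed
  have pt: "dipath E (?f t)" if "t \<in> K \<union> S" for t
  proof (cases "t \<in> K")
    case True then show ?thesis using fanD(1)[OF f1] K by auto
  next
    case False then show ?thesis using that cc(1) by blast
  qed
  define src where "src t = (if t \<in> K then t else hd (g t))" for t
  have src: "src t \<in> T1" if "t \<in> K \<union> S" for t using that gS K by (auto simp: src_def)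
  have fset: "set (?f t) \<subseteq> set (f1 (src t)) \<union> (if t \<in> K then {} else set (tl (g t)))" for t
    by (auto simp: src_def)
  have gdisj: "s = t" if "s \<in> S" "t \<in> S" "x \<in> set (g s)" "x \<in> set (g t)" for s t x
    using disjoint_paths_eq[OF g] that by metis
  have tlin: "set (tl p) \<subseteq> set p" for p :: "'a list" by (cases p) auto
  have srcinj: "s = t" if "s \<in> K \<union> S" "t \<in> K \<union> S" "src s = src t" for s t
  proof -
    have "hd (g t) \<in> set (g t)" if "t \<in> S" for t using dipath_ne[OF disjoint_pathsD[OF g that]] by simp
    then show ?thesis using that gS gdisj SK unfolding src_def
      by (smt (verit, best) DiffD2 UnE)
  qed
  have disj: "s = t" if "s \<in> K \<union> S" "t \<in> K \<union> S" "x \<in> set (?f s)" "x \<in> set (?f t)" for s t x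
  proof -
    have 1: "x \<in> set (f1 (src s)) \<or> s \<in> S \<and> x \<in> set (tl (g s))" using fset[of s] that SK by (auto split: if_splits)
    have 2: "x \<in> set (f1 (src t)) \<or> t \<in> S \<and> x \<in> set (tl (g t))" using fset[of t] that SK by (auto split: if_splits)
    have 3: "x \<notin> set (tl (g u))" if "x \<in> set (f1 (src v))" "v \<in> K \<union> S" "u \<in> S" for u v
      using that src[OF that(2)] f1set gS[OF that(3)] by blast
    show ?thesis
    proof (cases "x \<in> set (f1 (src s))")
      case True
      then have "x \<in> set (f1 (src t))" using 2 3[OF True that(1)] by blast
      then have "src s = src t" using True disjoint_paths_eq[OF fan_dpf[OF f1] src[OF that(1)] src[OF that(2)]] by blast
      then show ?thesis using srcinj that by blast
    next
      case False
      then have s: "s \<in> S" "x \<in> set (tl (g s))" using 1 by auto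
      then have "t \<in> S" "x \<in> set (tl (g t))" using 2 3[of t s] that by auto
      then show ?thesis using gdisj s tlin by blast
    qed
  qed
  have bl: "set (butlast (?f t)) \<subseteq> X1 \<union> X2" if t: "t \<in> S" for t
  proof (cases "tl (g t) = []")
    case True
    then show ?thesis using SK[OF t] fanD(4)[OF f1, of "hd (g t)"] gS[OF t] by auto
  next
    case False
    then have "butlast (?f t) = f1 (hd (g t)) @ butlast (tl (g t))"
      using SK[OF t] by (simp add: butlast_append)
    moreover have "butlast (g t) = hd (g t) # butlast (tl (g t))" using False by (cases "g t") auto
    ultimately show ?thesis using gS[OF t] fanD(7)[OF f1, of "hd (g t)"] by auto
  qed
  have "disjoint_paths E (K \<union> S) ?f" by (rule disjoint_pathsI[OF pt disj])
  moreover have "hd (?f t) \<in> A \<and> last (?f t) = t \<and> set (butlast (?f t)) \<subseteq> X1 \<union> X2" if "t \<in> K \<union> S" for t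
  proof (cases "t \<in> K")
    case True then show ?thesis using fanD[OF f1, of t] K by auto
  next
    case False
    then have t: "t \<in> S" using that by blast
    have "hd (?f t) \<in> A" using cc(2)[OF t] fanD(2)[OF f1] gS[OF t] by simp
    then show ?thesis using cc(3)[OF t] bl[OF t] by blast
  qed
  ultimately show ?thesis unfolding fan_def by blast
qed

text \<open>Paths of the first fan are continued by the parts of the second paths after their last
  visit to the first boundary. The equations for retained targets are what lets infinite iterations
  converge.\<close>

lemma fan_compose:
  assumes f1: "fan E A X1 (boundary E A X1 \<union> H1) f1" and H1: "H1 \<subseteq> X1" and f2: "disjoint_paths E2 S2 f2"
    and inS: "\<And>t. t \<in> S2 \<Longrightarrow> t \<in> set (f2 t)"
    and dec: "\<And>t. t \<in> S2 \<Longrightarrow> t \<notin> X1 \<Longrightarrow> t \<notin> boundary E A X1 \<Longrightarrow> \<exists>u x w. f2 t = u @ x # w \<and> x \<in> boundary E A X1 \<and>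
       set w \<inter> (X1 \<union> boundary E A X1) = {} \<and> dipath E (x # w) \<and> last (x # w) = t \<and> set (butlast (x # w)) \<subseteq> X2"
  shows "\<exists>f. fan E A (X1 \<union> X2) ((boundary E A X1 - X2) \<union> H1 \<union> (boundary E A X1 \<inter> S2) \<union> (S2 - X1 - boundary E A X1)) f \<and>
     (\<forall>t\<in>(boundary E A X1 - X2) \<union> H1 \<union> (boundary E A X1 \<inter> S2). f t = f1 t) \<and>
     (\<forall>t\<in>S2 - X1 - boundary E A X1. \<exists>u x w. f2 t = u @ x # w \<and> x \<in> boundary E A X1 \<and> f t = f1 x @ w)"
proof -
  let ?T = "boundary E A X1"
  let ?S = "S2 - X1 - ?T" and ?K = "(?T - X2) \<union> H1 \<union> (?T \<inter> S2)"
  have TX: "?T \<inter> X1 = {}" by (auto simp: boundary_def)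
  have "\<exists>g. \<forall>t\<in>?S. \<exists>u x w. f2 t = u @ x # w \<and> x \<in> ?T \<and> set w \<inter> (X1 \<union> ?T) = {} \<and> dipath E (x # w) \<and>
      last (x # w) = t \<and> set (butlast (x # w)) \<subseteq> X2 \<and> g t = x # w"
    by (intro bchoice ballI) (use dec in blast)
  then obtain g where g: "\<And>t. t \<in> ?S \<Longrightarrow> \<exists>u x w. f2 t = u @ x # w \<and> x \<in> ?T \<and> set w \<inter> (X1 \<union> ?T) = {} \<and>
      dipath E (x # w) \<and> last (x # w) = t \<and> set (butlast (x # w)) \<subseteq> X2 \<and> g t = x # w" by meson
  have gset: "set (g t) \<subseteq> set (f2 t)" if "t \<in> ?S" for t using g[OF that] by auto
  have "disjoint_paths E ?S g"
  proof (rule disjoint_pathsI)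
    show "dipath E (g t)" if "t \<in> ?S" for t using g[OF that] by auto
    show "s = t" if "s \<in> ?S" "t \<in> ?S" "x \<in> set (g s)" "x \<in> set (g t)" for s t x
      using disjoint_paths_eq[OF f2, of s t x] gset that by blast
  qed
  moreover have "last (g t) = t \<and> hd (g t) \<in> (?T \<union> H1) - ?K \<and> set (butlast (g t)) \<subseteq> X2 \<and>
      set (tl (g t)) \<inter> (X1 \<union> (?T \<union> H1)) = {}" if t: "t \<in> ?S" for t
  proof -
    obtain u x w where w: "f2 t = u @ x # w" "x \<in> ?T" "set w \<inter> (X1 \<union> ?T) = {}" "dipath E (x # w)"
      "last (x # w) = t" "set (butlast (x # w)) \<subseteq> X2" "g t = x # w" using g[OF t] by blast
    have "w \<noteq> []" using w t by auto
    then have "x \<in> X2" using w(6) by auto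
    \<comment> \<open>The path indexed by \<open>x\<close> would also contain \<open>x\<close>, so
      disjointness would make it the path of \<open>t\<close>; but \<open>t\<close> is off the first
      boundary.\<close>
    moreover have "x \<notin> S2"
    proof
      assume x: "x \<in> S2"
      then have "x = t" using disjoint_paths_eq[OF f2 x, of t x] inS[OF x] w(1) t by auto
      then show False using w(2) t by auto
    qed
    moreover have "x \<notin> H1" using w(2) TX H1 by auto
    ultimately show ?thesis using w H1 by auto
  qed
  moreover have "?K \<subseteq> ?T \<union> H1" by auto
  ultimately have F: "fan E A (X1 \<union> X2) (?K \<union> ?S) (\<lambda>t. if t \<in> ?K then f1 t else f1 (hd (g t)) @ tl (g t))"
    by (intro fan_join[OF f1])
  have "t \<notin> ?K" if "t \<in> ?S" for t using that H1 by auto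
  then have "\<forall>t\<in>?S. \<exists>u x w. f2 t = u @ x # w \<and> x \<in> ?T \<and>
      (if t \<in> ?K then f1 t else f1 (hd (g t)) @ tl (g t)) = f1 x @ w"
    using g by (metis list.sel(1) list.sel(3))
  then show ?thesis by (intro exI[of _ "\<lambda>t. if t \<in> ?K then f1 t else f1 (hd (g t)) @ tl (g t)"])
      (use F in auto)
qed

text \<open>A vertex of \<open>X\<close> cannot be the last visit: its successor would again lie in
  \<open>X\<close> or in the boundary.\<close>

lemma last_exit:
  assumes p: "dipath E p" "set p \<inter> (X \<union> boundary E A X) \<noteq> {}" "last p \<notin> X"
  shows "\<exists>u x w. p = u @ x # w \<and> x \<in> boundary E A X \<and> set w \<inter> (X \<union> boundary E A X) = {} \<and> dipath E (x # w)"
proof -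
  obtain u x w where w: "p = u @ x # w" "x \<in> X \<union> boundary E A X" "set w \<inter> (X \<union> boundary E A X) = {}"
    using split_last_in[OF p(2)] by blast
  have xw: "dipath E (x # w)" using p(1) w(1) dipath_appendD2 by blast
  have "x \<notin> X"
  proof
    assume x: "x \<in> X"
    then obtain y w' where y: "w = y # w'" using p(3) w(1) by (cases w) auto
    then have "(x, y) \<in> E" using xw dipath_edge[of E "[]" x y w'] by simp
    then show False using w(3) y x by (auto simp: boundary_def)
  qed
  then show ?thesis using w xw by blast
qed

text \<open>No relation between the two regions is needed: a second path to a target outside
  \<open>X1\<close> visits the first boundary or region, and behind its last visit it is disjoint
  from the whole first fan.\<close>

lemma wave_fan_join:
  assumes f1: "fan E A X1 (boundary E A X1) f1" and f2: "fan E A X2 (boundary E A X2) f2"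
  shows "\<exists>f. fan E A (X1 \<union> X2) (boundary E A (X1 \<union> X2)) f \<and> (\<forall>t\<in>boundary E A X1 - X2. f t = f1 t)"
proof -
  let ?T = "boundary E A X1"
  have "\<exists>u x w. f2 t = u @ x # w \<and> x \<in> ?T \<and>
       set w \<inter> (X1 \<union> ?T) = {} \<and> dipath E (x # w) \<and> last (x # w) = t \<and> set (butlast (x # w)) \<subseteq> X2"
    if t: "t \<in> boundary E A X2" "t \<notin> X1" for t
  proof -
    note F = fanD[OF f2 t(1)]
    have "hd (f2 t) \<in> set (f2 t)" using F(5) by simp
    then have "set (f2 t) \<inter> (X1 \<union> ?T) \<noteq> {}" using F(2) by (auto simp: boundary_def)
    then obtain u x w where w: "f2 t = u @ x # w" "x \<in> ?T" "set w \<inter> (X1 \<union> ?T) = {}" "dipath E (x # w)"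
      using last_exit[OF F(1)] F(3) t(2) by metis
    then have "last (x # w) = t" "set (butlast (x # w)) \<subseteq> X2"
      using F(3,4) by (auto simp: butlast_append)
    then show ?thesis using w by blast
  qed
  then obtain f where f: "fan E A (X1 \<union> X2) ((?T - X2) \<union> {} \<union> (?T \<inter> boundary E A X2) \<union> (boundary E A X2 - X1 - ?T)) f"
    "\<forall>t\<in>(?T - X2) \<union> {} \<union> (?T \<inter> boundary E A X2). f t = f1 t"
    using fan_compose[of E A X1 "{}" f1 E "boundary E A X2" f2 X2] f1 fan_dpf[OF f2] fanD(6)[OF f2] by auto
  have "boundary E A (X1 \<union> X2) \<subseteq> (?T - X2) \<union> {} \<union> (?T \<inter> boundary E A X2) \<union> (boundary E A X2 - X1 - ?T)"
    by (auto simp: boundary_def)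
  then show ?thesis using fan_subset[OF f(1)] f(2) by blast
qed

text \<open>Quotient of a web by a wave: the region is deleted and its boundary becomes the new
  source set.\<close>

lemma boundary_quotient:
  assumes "X1 \<inter> X2 = {}"
  shows "boundary (del E X1) (boundary E A X1) X2 = boundary E A (X1 \<union> X2)"
  using assms unfolding boundary_def Image_def by (auto simp: disjoint_iff)

text \<open>The decomposition of the new paths is part of the conclusion because the tree
  construction has to trace from which original source each of them starts.\<close>

lemma quotient_join:
  assumes f1: "fan E A X1 (boundary E A X1) f1" and dj: "X1 \<inter> X2 = {}"
    and f2: "fan (del E X1) (boundary E A X1) X2 (boundary E A (X1 \<union> X2)) f2"
  shows "\<exists>f. fan E A (X1 \<union> X2) (boundary E A (X1 \<union> X2)) f \<and> (\<forall>t\<in>boundary E A X1 - X2. f t = f1 t) \<and>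
    (\<forall>t\<in>boundary E A (X1 \<union> X2) - boundary E A X1. \<exists>u x w. f2 t = u @ x # w \<and> x \<in> boundary E A X1 \<and> f t = f1 x @ w)"
proof -
  let ?T = "boundary E A X1" and ?S = "boundary E A (X1 \<union> X2)"
  have "\<exists>u x w. f2 t = u @ x # w \<and> x \<in> ?T \<and>
       set w \<inter> (X1 \<union> ?T) = {} \<and> dipath E (x # w) \<and> last (x # w) = t \<and> set (butlast (x # w)) \<subseteq> X2"
    if t: "t \<in> ?S" "t \<notin> X1" for t
  proof -
    note F = fanD[OF f2 t(1)]
    have "hd (f2 t) \<in> set (f2 t)" using F(5) by simp
    then have "set (f2 t) \<inter> (X1 \<union> ?T) \<noteq> {}" using F(2) by auto
    then obtain u x w where w: "f2 t = u @ x # w" "x \<in> ?T" "set w \<inter> (X1 \<union> ?T) = {}" "dipath E (x # w)"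
      using last_exit[OF dipath_delD[OF F(1)]] F(3) t(2) by metis
    then have "last (x # w) = t" "set (butlast (x # w)) \<subseteq> X2"
      using F(3,4) by (auto simp: butlast_append)
    then show ?thesis using w by blast
  qed
  then obtain f where f: "fan E A (X1 \<union> X2) ((?T - X2) \<union> {} \<union> (?T \<inter> ?S) \<union> (?S - X1 - ?T)) f"
    "\<forall>t\<in>(?T - X2) \<union> {} \<union> (?T \<inter> ?S). f t = f1 t"
    "\<forall>t\<in>?S - X1 - ?T. \<exists>u x w. f2 t = u @ x # w \<and> x \<in> ?T \<and> f t = f1 x @ w"
    using fan_compose[of E A X1 "{}" f1 "del E X1" ?S f2 X2] f1 fan_dpf[OF f2] fanD(6)[OF f2] by auto
  have "?S \<subseteq> (?T - X2) \<union> {} \<union> (?T \<inter> ?S) \<union> (?S - X1 - ?T)"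
    by (auto simp: boundary_def)
  moreover have "?S - ?T = ?S - X1 - ?T" by (auto simp: boundary_def)
  ultimately show ?thesis using fan_subset[OF f(1)] f(2,3) by (intro exI[of _ f]) auto
qed

text \<open>Regions only grow, but a target disappears when a later region swallows it. A target
  that is present from some stage on keeps its path from that stage, so the limit is taken
  pointwise.\<close>

lemma fan_limit:
  assumes f: "\<And>n. fan E A (X n) (S n) (f n)" and X: "\<And>n. X n \<subseteq> X (Suc n)"
    and ag: "\<And>n t. t \<in> S n \<Longrightarrow> t \<in> S (Suc n) \<Longrightarrow> f (Suc n) t = f n t"
  shows "\<exists>g. fan E A (\<Union>n. X n) {t. \<exists>n. \<forall>m\<ge>n. t \<in> S m} g \<and>
     (\<forall>n t. (\<forall>m\<ge>n. t \<in> S m) \<longrightarrow> g t = f n t)"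
proof -
  have st: "f m t = f n t" if "\<forall>m\<ge>n. t \<in> S m" "m \<ge> n" for m n t
    using that(2)
  proof (induction m rule: dec_induct)
    case (step k)
    then have "t \<in> S k" "t \<in> S (Suc k)" using that(1) by simp_all
    then show ?case using ag step.IH by simp
  qed simp
  define g where "g t = f (LEAST n. \<forall>m\<ge>n. t \<in> S m) t" for t
  have g: "g t = f n t" if "\<forall>m\<ge>n. t \<in> S m" for n t
  proof -
    have L: "\<forall>m\<ge>(LEAST n. \<forall>m\<ge>n. t \<in> S m). t \<in> S m" using LeastI[of "\<lambda>n. \<forall>m\<ge>n. t \<in> S m", OF that] .
    have "(LEAST n. \<forall>m\<ge>n. t \<in> S m) \<le> n" using Least_le[of "\<lambda>n. \<forall>m\<ge>n. t \<in> S m", OF that] .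
    then show ?thesis unfolding g_def by (rule st[OF L, symmetric])
  qed
  let ?S = "{t. \<exists>n. \<forall>m\<ge>n. t \<in> S m}"
  have P: "dipath E (g t) \<and> hd (g t) \<in> A \<and> last (g t) = t \<and> set (butlast (g t)) \<subseteq> (\<Union>n. X n)" if tS: "t \<in> ?S" for t
  proof -
    obtain n where n: "\<forall>m\<ge>n. t \<in> S m" using tS by blast
    then have "t \<in> S n" by auto
    from fanD[OF f this] g[OF n] show ?thesis by auto
  qed
  have "disjoint_paths E ?S g"
  proof (rule disjoint_pathsI)
    show "dipath E (g i)" if "i \<in> ?S" for i using P that by blast
    show "i = j" if ij: "i \<in> ?S" "j \<in> ?S" "x \<in> set (g i)" "x \<in> set (g j)" for i j x
    proof -
      obtain n m where n: "\<forall>k\<ge>n. i \<in> S k" "\<forall>k\<ge>m. j \<in> S k" using ij by blast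
      let ?k = "max n m"
      have k: "\<forall>k\<ge>?k. i \<in> S k" "\<forall>k\<ge>?k. j \<in> S k" using n by simp_all
      have k': "i \<in> S ?k" "j \<in> S ?k" using k by (simp_all only: order_refl)
      have "x \<in> set (f ?k i)" "x \<in> set (f ?k j)" using ij(3,4) unfolding g[OF k(1)] g[OF k(2)] .
      then show ?thesis by (rule disjoint_paths_eq[OF fan_dpf[OF f[of ?k]] k'])
    qed
  qed
  then show ?thesis using P g unfolding fan_def by (intro exI[of _ g]) blast
qed

text \<open>A wave is recorded by the region that it cuts off instead of by its set of paths. The
  boundary of the region is the set of end vertices, which separates \<open>A\<close> from
  \<open>B\<close>.\<close>

definition wave where
  "wave E A B X f \<longleftrightarrow> X \<inter> B = {} \<and> fan E A X (boundary E A X) f"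

text \<open>Not \<open>X = {}\<close>: a wave may contain junk vertices that are unreachable from \<open>A\<close>.\<close>

definition loose where
  "loose E A B \<longleftrightarrow> (\<forall>X f. wave E A B X f \<longrightarrow> A \<inter> X = {})"

text \<open>Excludes hindrances: waves that enclose a source at which none of their paths
  starts.\<close>

definition unhindered where
  "unhindered E A B \<longleftrightarrow> (\<forall>X f. wave E A B X f \<longrightarrow> A \<inter> X \<subseteq> hd ` f ` boundary E A X)"

section \<open>Trimmed waves, greatest waves and quotients\<close>

lemma trivial_wave: "wave E A B {} (\<lambda>t. [t])"
  by (auto simp: wave_def fan_def disjoint_paths_def boundary_def)

lemma path_sources:
  assumes "dipath E p" "hd p \<in> A" shows "set p \<subseteq> A \<union> Range E"
  using dipath_closed[OF assms(1), of "A \<union> Range E"] assms(2) by auto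

lemma set_butlast_sub: "set (butlast p) \<subseteq> set p"
  by (meson in_set_butlastD subsetI)

text \<open>Paths of a fan use only sources and heads of edges. The rest of the region can be
  discarded without creating boundary vertices, since no edge enters it.\<close>

lemma wave_restrict:
  assumes "wave E A B X f" and C: "A \<union> Range E \<subseteq> C"
  shows "wave E A B (X \<inter> C) f"
proof -
  have f: "fan E A X (boundary E A X) f" using assms by (simp add: wave_def)
  have 1: "boundary E A (X \<inter> C) \<subseteq> boundary E A X" using C by (auto simp: boundary_def)
  have "fan E A (X \<inter> C) (boundary E A X) f"
    unfolding fan_def
  proof (intro conjI ballI)
    show "disjoint_paths E (boundary E A X) f" by (rule fan_dpf[OF f])
    fix t assume t: "t \<in> boundary E A X"
    note F = fanD[OF f t]
    show "hd (f t) \<in> A" "last (f t) = t" by fact+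
    show "set (butlast (f t)) \<subseteq> X \<inter> C" using F(4) path_sources[OF F(1,2)] set_butlast_sub[of "f t"] C by blast
  qed
  then show ?thesis using fan_subset 1 assms unfolding wave_def by blast
qed

lemmas wave_trim = wave_restrict[OF _ order_refl]

text \<open>A limit of fans needs a sequence, so the vertices of \<open>C\<close> are absorbed one
  at a time, each by any wave that contains it. Countability of \<open>C\<close> is what makes this
  exhaustive.\<close>

lemma greatest_wave:
  assumes "countable C"
  shows "\<exists>X f. wave E A B X f \<and> (\<forall>z\<in>C. (\<exists>X' f'. wave E A B X' f' \<and> z \<in> X') \<longrightarrow> z \<in> X)"
proof (cases "C = {}")
  case True
  then show ?thesis using trivial_wave by blast
next
  case False
  define c where "c = from_nat_into C"
  let ?P = "\<lambda>(n::nat) s. wave E A B (fst s) (snd s)"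
  let ?Q = "\<lambda>n s s'. fst s \<subseteq> fst s' \<and> (\<forall>t\<in>boundary E A (fst s) - fst s'. snd s' t = snd s t) \<and>
     ((\<exists>X' f'. wave E A B X' f' \<and> c n \<in> X') \<longrightarrow> c n \<in> fst s')"
  have "\<exists>F. \<forall>n. ?P n (F n) \<and> ?Q n (F n) (F (Suc n))"
  proof (rule dependent_nat_choice)
    show "\<exists>s. ?P 0 s" using trivial_wave[of E A B] by auto
    show "\<exists>s'. ?P (Suc n) s' \<and> ?Q n s s'" if s: "?P n s" for s n
    proof (cases "\<exists>X' f'. wave E A B X' f' \<and> c n \<in> X'")
      case True
      then obtain X' f' where w: "wave E A B X' f'" "c n \<in> X'" by blast
      obtain f where "fan E A (fst s \<union> X') (boundary E A (fst s \<union> X')) f" "\<forall>t\<in>boundary E A (fst s) - X'. f t = snd s t"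
        using wave_fan_join[of E A "fst s" "snd s" X' f'] s w by (auto simp: wave_def)
      then show ?thesis using s w by (intro exI[of _ "(fst s \<union> X', f)"]) (auto simp: wave_def)
    next
      case False then show ?thesis using s by (intro exI[of _ s]) auto
    qed
  qed
  then obtain F where F: "\<And>n. ?P n (F n)" "\<And>n. ?Q n (F n) (F (Suc n))" by blast
  define X f where "X n = fst (F n)" and "f n = snd (F n)" for n
  have w: "wave E A B (X n) (f n)" for n using F(1) by (simp add: X_def f_def)
  have mono: "X n \<subseteq> X m" if "n \<le> m" for n m
    by (rule lift_Suc_mono_le[OF _ that]) (use F(2) in \<open>simp add: X_def\<close>)
  have "\<exists>g. fan E A (\<Union>n. X n) {t. \<exists>n. \<forall>m\<ge>n. t \<in> boundary E A (X m)} g \<and>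
     (\<forall>n t. (\<forall>m\<ge>n. t \<in> boundary E A (X m)) \<longrightarrow> g t = f n t)"
  proof (rule fan_limit)
    show "fan E A (X n) (boundary E A (X n)) (f n)" for n using w by (simp add: wave_def)
    show "X n \<subseteq> X (Suc n)" for n using mono by simp
    show "f (Suc n) t = f n t" if "t \<in> boundary E A (X n)" "t \<in> boundary E A (X (Suc n))" for n t
      using F(2)[of n] that by (auto simp: X_def f_def boundary_def)
  qed
  then obtain g where g: "fan E A (\<Union>n. X n) {t. \<exists>n. \<forall>m\<ge>n. t \<in> boundary E A (X m)} g" by blast
  have "boundary E A (\<Union>n. X n) \<subseteq> {t. \<exists>n. \<forall>m\<ge>n. t \<in> boundary E A (X m)}"
  proof
    fix t assume t: "t \<in> boundary E A (\<Union>n. X n)"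
    then have nX: "t \<notin> X n" for n by (auto simp: boundary_def)
    obtain n where "t \<in> A \<union> E `` X n" using t by (auto simp: boundary_def)
    then have "t \<in> A \<union> E `` X m" if "m \<ge> n" for m using mono[OF that] by auto
    then show "t \<in> {t. \<exists>n. \<forall>m\<ge>n. t \<in> boundary E A (X m)}" using nX by (auto simp: boundary_def)
  qed
  then have "wave E A B (\<Union>n. X n) g" using g fan_subset w unfolding wave_def by blast
  moreover have "z \<in> (\<Union>n. X n)" if zC: "z \<in> C" "\<exists>X' f'. wave E A B X' f' \<and> z \<in> X'" for z
  proof -
    obtain n where "c n = z" using from_nat_into_surj[OF assms zC(1)] unfolding c_def by blast
    then show ?thesis using F(2)[of n] zC(2) by (auto simp: X_def)
  qed
  ultimately show ?thesis by blast
qed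

text \<open>A wave of the quotient composes with the greatest wave to a wave of the original web, so
  whatever it encloses had been absorbed already. Trimming makes the two regions disjoint
  first.\<close>

lemma quotient_loose:
  assumes w: "wave E A B X f" and mx: "\<forall>z\<in>A \<union> Range E. (\<exists>X' f'. wave E A B X' f' \<and> z \<in> X') \<longrightarrow> z \<in> X"
  shows "loose (del E X) (boundary E A X) B"
  unfolding loose_def
proof (intro allI impI)
  fix Y0 g assume w0: "wave (del E X) (boundary E A X) B Y0 g"
  let ?Y = "Y0 \<inter> (boundary E A X \<union> Range (del E X))"
  have w2: "wave (del E X) (boundary E A X) B ?Y g" using wave_trim[OF w0] .
  have dj: "X \<inter> ?Y = {}" by (auto simp: boundary_def)
  have "fan (del E X) (boundary E A X) ?Y (boundary E A (X \<union> ?Y)) g"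
    using w2 boundary_quotient[OF dj, of E A] unfolding wave_def by metis
  then obtain f' where "fan E A (X \<union> ?Y) (boundary E A (X \<union> ?Y)) f'"
    using quotient_join[of E A X f ?Y g] w dj by (auto simp: wave_def)
  then have "wave E A B (X \<union> ?Y) f'" using w w2 by (auto simp: wave_def)
  then have "t \<in> X" if "t \<in> boundary E A X \<inter> Y0" for t
    using mx that by (auto simp: boundary_def)
  then show "boundary E A X \<inter> Y0 = {}" by (auto simp: boundary_def)
qed

text \<open>Cutting each path at its first vertex outside \<open>X\<close> turns the boundary
  description of an exposed region into a wave. First exits are unique, so the pieces for different
  targets come from different paths.\<close>

lemma exit_fan:
  assumes f: "disjoint_paths E B f"
    and S: "\<And>t. t \<in> S \<Longrightarrow> t \<notin> X \<and> (t \<in> A \<or> (\<exists>b\<in>B. hd (f b) \<in> A \<and> (\<exists>p q. f b = p @ t # q \<and> set p \<subseteq> X)))"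
  shows "\<exists>g. fan E A X S g \<and> (\<forall>t\<in>S. set (g t) \<subseteq> insert t (\<Union>b\<in>B. set (f b)))"
proof -
  have "\<exists>g. \<forall>t\<in>S. g t = [t] \<and> t \<in> A \<or> (\<exists>b\<in>B. hd (f b) \<in> A \<and> (\<exists>p q. f b = p @ t # q \<and> set p \<subseteq> X \<and> g t = p @ [t]))"
  proof (intro bchoice ballI)
    fix t assume "t \<in> S"
    from S[OF this] consider "t \<in> A" | b p q where "b \<in> B" "hd (f b) \<in> A" "f b = p @ t # q" "set p \<subseteq> X" by blast
    then show "\<exists>y. y = [t] \<and> t \<in> A \<or> (\<exists>b\<in>B. hd (f b) \<in> A \<and> (\<exists>p q. f b = p @ t # q \<and> set p \<subseteq> X \<and> y = p @ [t]))"
      by cases blast+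
  qed
  then obtain g where g: "\<And>t. t \<in> S \<Longrightarrow> g t = [t] \<and> t \<in> A \<or> (\<exists>b\<in>B. hd (f b) \<in> A \<and> (\<exists>p q. f b = p @ t # q \<and> set p \<subseteq> X \<and> g t = p @ [t]))"
    by blast
  have 1: "dipath E (g t) \<and> hd (g t) \<in> A \<and> last (g t) = t \<and> set (butlast (g t)) \<subseteq> X \<and> set (g t) \<subseteq> insert t X" if "t \<in> S" for t
    using g[OF that]
  proof (elim disjE bexE exE conjE)
    fix b p q assume b: "b \<in> B" "hd (f b) \<in> A" "f b = p @ t # q" "set p \<subseteq> X" "g t = p @ [t]"
    have "dipath E (p @ [t])" using disjoint_pathsD[OF f b(1)] b(3) dipath_prefix by metis
    moreover have "hd (p @ [t]) = hd (f b)" using b(3) by (cases p) auto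
    ultimately show ?thesis using b by auto
  qed auto
  have "disjoint_paths E S g"
  proof (rule disjoint_pathsI)
    show "dipath E (g i)" if "i \<in> S" for i using 1 that by blast
    show "i = j" if ij: "i \<in> S" "j \<in> S" "x \<in> set (g i)" "x \<in> set (g j)" for i j x
    proof (rule ccontr)
      assume ne: "i \<noteq> j"
      have x: "x \<in> insert i X" "x \<in> insert j X" using 1 ij by blast+
      then have xX: "x \<in> X" "x \<noteq> i" "x \<noteq> j" using S ij(1,2) ne by blast+
      obtain b p q where b: "b \<in> B" "f b = p @ i # q" "set p \<subseteq> X" "g i = p @ [i]"
        using g[OF ij(1)] ij(3) xX by auto
      obtain b' p' q' where b': "b' \<in> B" "f b' = p' @ j # q'" "set p' \<subseteq> X" "g j = p' @ [j]"
        using g[OF ij(2)] ij(4) xX by auto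
      have "x \<in> set (f b)" "x \<in> set (f b')" using ij b b' by auto
      then have "b = b'" using disjoint_paths_eq[OF f] b b' by blast
      then have "i = j" using split_exit_unique[of p i q p' j q' X] b b' S ij by auto
      then show False using ne by blast
    qed
  qed
  then have "fan E A X S g" using 1 unfolding fan_def by blast
  moreover have "set (g t) \<subseteq> insert t (\<Union>b\<in>B. set (f b))" if "t \<in> S" for t
    using g[OF that]
  proof (elim disjE bexE exE conjE)
    fix b p q assume b: "b \<in> B" "f b = p @ t # q" "g t = p @ [t]"
    then have "set (g t) \<subseteq> set (f b)" by auto
    then show ?thesis using b(1) by blast
  qed auto
  ultimately show ?thesis by blast
qed

text \<open>Encodes confinement to \<open>X\<close> in the edge relation, so that an augmentation
  inside a wave respects the region automatically.\<close>

lemma tail_paths: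
  "dipath {e \<in> E. fst e \<in> X} p \<longleftrightarrow> dipath E p \<and> set (butlast p) \<subseteq> X"
proof (induction p)
  case Nil then show ?case by (simp add: dipath_def)
next
  case (Cons a p)
  show ?case
  proof (cases "p = []")
    case False
    then show ?thesis using Cons dipath_append[of "[a]" p E] dipath_append[of "[a]" p "{e \<in> E. fst e \<in> X}"] by auto
  qed auto
qed

text \<open>Given a hindrance after the deletion, augment from its free source \<open>s\<close> in
  the full web. If the walk reaches \<open>y\<close>, then \<open>y\<close> becomes one more linked
  boundary vertex; otherwise the exposed region is itself a wave. Either way a wave encloses
  \<open>s\<close>, against looseness.\<close>

lemma loose_del_nonsource:
  assumes L: "loose E A B" and y: "y \<notin> A"
  shows "unhindered (del E {y}) A B"
  unfolding unhindered_def
proof (intro allI impI subsetI, rule ccontr)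
  fix X' f' a
  assume w': "wave (del E {y}) A B X' f'" and a: "a \<in> A \<inter> X'" and na: "a \<notin> hd ` f' ` boundary (del E {y}) A X'"
  let ?D = "del E {y}"
  define X where "X = X' \<inter> (A \<union> Range ?D)"
  have w: "wave ?D A B X f'" using wave_trim[OF w'] by (simp add: X_def)
  have yX: "y \<notin> X" using y by (auto simp: X_def)
  let ?T = "boundary ?D A X"
  have TT: "?T \<subseteq> boundary ?D A X'" by (auto simp: boundary_def X_def)
  have yT: "y \<notin> ?T" using y by (auto simp: boundary_def)
  have f': "fan ?D A X ?T f'" using w by (simp add: wave_def)
  \<comment> \<open>The source \<open>a\<close> starts no path but may lie on one. In that case the
    path is shortened to start at \<open>a\<close>, which frees its former head.\<close>
  obtain f s where f: "fan ?D A X ?T f" and s: "s \<in> A" "s \<in> X" "\<forall>t\<in>?T. s \<notin> set (f t)"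
  proof (cases "\<exists>t\<in>?T. a \<in> set (f' t)")
    case False
    then show ?thesis using that[OF f', of a] a by (auto simp: X_def)
  next
    case True
    then obtain t p q where t: "t \<in> ?T" "f' t = p @ a # q" by (metis split_list)
    have ph: "p \<noteq> []" using na t TT by force
    note F = fanD[OF f' t(1)]
    let ?f = "f'(t := a # q)"
    have sub: "set (?f i) \<subseteq> set (f' i)" for i using t by auto
    have aq: "dipath ?D (a # q)" using F(1) t(2) dipath_appendD2[of ?D p "a # q"] by simp
    have "disjoint_paths ?D ?T ?f"
    proof (rule disjoint_pathsI)
      show "dipath ?D (?f i)" if "i \<in> ?T" for i using that aq fanD(1)[OF f'] by auto
      show "i = j" if "i \<in> ?T" "j \<in> ?T" "x \<in> set (?f i)" "x \<in> set (?f j)" for i j x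
        using disjoint_paths_eq[OF fan_dpf[OF f'] that(1,2), of x] that sub by blast
    qed
    moreover have "hd (?f i) \<in> A \<and> last (?f i) = i \<and> set (butlast (?f i)) \<subseteq> X" if "i \<in> ?T" for i
      using fanD(2-4)[OF f' that] F a t by (auto simp: butlast_append split: if_splits)
    ultimately have 1: "fan ?D A X ?T ?f" by (simp add: fan_def)
    have hp: "hd (f' t) = hd p" "hd p \<in> set p" using t(2) ph by auto
    have "hd p \<in> X" using F(4) t(2) hp(2) by (auto simp: butlast_append)
    moreover have "hd p \<notin> set (?f i)" if "i \<in> ?T" for i
    proof
      assume h: "hd p \<in> set (?f i)"
      have "hd p \<in> set (f' t)" using hp t(2) by simp
      then have "i = t" using disjoint_paths_eq[OF fan_dpf[OF f'] that t(1), of "hd p"] h sub by blast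
      then have "hd p \<in> set (a # q)" using h by simp
      then show False using F(1) t(2) hp(2) by (auto simp: dipath_def)
    qed
    ultimately show ?thesis using that[OF 1, of "hd p"] F(2) hp by auto
  qed
  let ?E = "{e \<in> E. fst e \<in> X}"
  have bdE: "boundary E A X \<subseteq> insert y ?T" using yX by (auto simp: boundary_def)
  have dE: "disjoint_paths ?E ?T f"
  proof (rule disjoint_pathsI)
    show "dipath ?E (f i)" if "i \<in> ?T" for i
      using fanD[OF f that] dipath_delD unfolding tail_paths by blast
    show "i = j" if "i \<in> ?T" "j \<in> ?T" "x \<in> set (f i)" "x \<in> set (f j)" for i j x
      using disjoint_paths_eq[OF fan_dpf[OF f]] that by blast
  qed
  have lE: "\<forall>t\<in>?T. last (f t) = t" using fanD(3)[OF f] by blast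
  let ?X = "exposed ?E ?T f s"
  note ex = exposed_source[OF dE lE s(3)] exposed_targets[OF dE lE s(3)]
    exposed_boundary[OF dE lE s(3)] exposed_augment[OF dE lE s(3)]
  show False
  proof (cases "y \<in> ?X")
    case True
    then obtain f2 h where h: "disjoint_paths ?E ?T f2" "\<forall>t\<in>?T. last (f2 t) = t" "dipath ?E h" "last h = y"
      "\<forall>t\<in>?T. set h \<inter> set (f2 t) = {}" "insert (hd h) (hd ` f2 ` ?T) = insert s (hd ` f ` ?T)"
      using ex(4)[OF True] by (elim exE conjE) (rule that)
    let ?f = "f2(y := h)"
    have "\<forall>t\<in>?T. hd (f t) \<in> A" using fanD(2)[OF f] by blast
    then have "hd ` f ` ?T \<subseteq> A" by (simp only: image_subset_iff ball_simps)
    then have "insert (hd h) (hd ` f2 ` ?T) \<subseteq> A" unfolding h(6) using s(1) by simp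
    then have hA: "hd h \<in> A" "\<forall>t\<in>?T. hd (f2 t) \<in> A"
      unfolding insert_subset image_subset_iff ball_simps by blast+
    have pE: "dipath E p" "set (butlast p) \<subseteq> X" if "dipath ?E p" for p
      using that unfolding tail_paths by auto
    have "fan E A X (insert y ?T) ?f"
      unfolding fan_def
    proof (intro conjI disjoint_pathsI ballI)
      show "dipath E (?f i)" if "i \<in> insert y ?T" for i using that pE(1) h(3) disjoint_pathsD[OF h(1)] by auto
      show "i = j" if "i \<in> insert y ?T" "j \<in> insert y ?T" "x \<in> set (?f i)" "x \<in> set (?f j)" for i j x
        using that yT h(5) disjoint_paths_eq[OF h(1), of i j x] by (auto split: if_splits)
      show "hd (?f i) \<in> A" if "i \<in> insert y ?T" for i using that hA by auto
      show "last (?f i) = i" if "i \<in> insert y ?T" for i using that h(2,4) by auto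
      show "set (butlast (?f i)) \<subseteq> X" if "i \<in> insert y ?T" for i
        using that pE(2) h(3) disjoint_pathsD[OF h(1)] by (cases "i = y") auto
    qed
    then have "wave E A B X ?f" using w fan_subset[OF _ bdE] unfolding wave_def by blast
    then show False using L s unfolding loose_def by blast
  next
    case False
    \<comment> \<open>A step out of \<open>X\<close> ends in the boundary, whose vertices are
      targets and never exposed; the only further possibility is \<open>y\<close>, which is
      unexposed in this case.\<close>
    have XX: "?X \<subseteq> X"
    proof
      fix z assume z: "z \<in> ?X"
      then obtain f2 h where h: "dipath ?E h" "last h = z" "insert (hd h) (hd ` f2 ` ?T) = insert s (hd ` f ` ?T)"
        using ex(4)[OF z] by blast
      have zT: "z \<notin> ?T" using ex(2) z by blast
      show "z \<in> X"
      proof (cases "tl h = []")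
        case True
        then have "z = hd h" using h(2) dipath_ne[OF h(1)] by (cases h) auto
        then have "z = s \<or> (\<exists>t\<in>?T. z = hd (f t))" using h(3) by blast
        then show ?thesis
        proof
          assume "\<exists>t\<in>?T. z = hd (f t)"
          then obtain t where t: "t \<in> ?T" "z = hd (f t)" by blast
          note F = fanD[OF f t(1)]
          have "z \<noteq> t" using zT t by blast
          then have "z \<in> set (butlast (f t))" using last_in_tl[OF F(5)] F(3) t(2) by simp
          then show ?thesis using F(4) by blast
        qed (use s in blast)
      next
        case False
        then obtain p x where p: "h = p @ [x, z]"
          using h(2) dipath_ne[OF h(1)]
          by (metis append.assoc append_Cons append_Nil append_butlast_last_id butlast.simps(2) list.collapse)
        have "(x, z) \<in> ?E" using h(1) p dipath_edge[of ?E p x z "[]"] by simp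
        then have "z \<in> X \<union> boundary E A X" by (auto simp: boundary_def)
        then show ?thesis using bdE zT \<open>y \<notin> ?X\<close> z by blast
      qed
    qed
    have "\<exists>g. fan E A ?X (boundary E A ?X) g \<and> (\<forall>t\<in>boundary E A ?X. set (g t) \<subseteq> insert t (\<Union>b\<in>?T. set (f b)))"
    proof (rule exit_fan)
      show "disjoint_paths E ?T f" using disjoint_paths_mono[OF fan_dpf[OF f] del_subset] .
      show "t \<notin> ?X \<and> (t \<in> A \<or> (\<exists>b\<in>?T. hd (f b) \<in> A \<and> (\<exists>p q. f b = p @ t # q \<and> set p \<subseteq> ?X)))"
        if t: "t \<in> boundary E A ?X" for t
      proof (cases "t \<in> A")
        case False
        then obtain x where x: "x \<in> ?X" "(x, t) \<in> ?E" using t XX by (auto simp: boundary_def)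
        have tX: "t \<notin> ?X" using t by (auto simp: boundary_def)
        from ex(3)[OF x tX] show ?thesis using tX fanD(2)[OF f] by blast
      qed (use t in \<open>auto simp: boundary_def\<close>)
    qed
    then obtain g where "fan E A ?X (boundary E A ?X) g" by blast
    then have "wave E A B ?X g" using XX w unfolding wave_def by blast
    then show False using L ex(1) s unfolding loose_def by blast
  qed
qed

text \<open>The deleted source comes back as a one-vertex path on the boundary, which extends any
  wave to the larger web.\<close>

lemma loose_del_source:
  assumes "loose E A B" "a \<in> A"
  shows "loose (del E {a}) (A - {a}) B"
  unfolding loose_def
proof (intro allI impI)
  fix X f assume w: "wave (del E {a}) (A - {a}) B X f"
  let ?T = "boundary (del E {a}) (A - {a}) X"
  have f: "fan (del E {a}) (A - {a}) X ?T f" using w by (simp add: wave_def)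
  have na: "a \<notin> set (f t)" if "t \<in> ?T" for t
    using dipath_del_avoid[OF fanD(1)[OF f that]] fanD(2)[OF f that] by auto
  show "(A - {a}) \<inter> X = {}"
  proof -
    have "fan E A (X - {a}) (insert a ?T) (f(a := [a]))"
      unfolding fan_def
    proof (intro conjI disjoint_pathsI ballI)
      show "dipath E ((f(a := [a])) i)" if "i \<in> insert a ?T" for i
        using that dipath_delD[OF fanD(1)[OF f]] by auto
      show "i = j" if "i \<in> insert a ?T" "j \<in> insert a ?T" "x \<in> set ((f(a := [a])) i)" "x \<in> set ((f(a := [a])) j)" for i j x
        using that na disjoint_paths_eq[OF fan_dpf[OF f], of i j x] by (auto split: if_splits)
      show "hd ((f(a := [a])) i) \<in> A" if "i \<in> insert a ?T" for i using that assms(2) fanD(2)[OF f] by auto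
      show "last ((f(a := [a])) i) = i" if "i \<in> insert a ?T" for i using that fanD(3)[OF f] by auto
      show "set (butlast ((f(a := [a])) i)) \<subseteq> X - {a}" if "i \<in> insert a ?T" for i
      proof (cases "i = a")
        case False
        then have i: "i \<in> ?T" using that by blast
        then show ?thesis using fanD(4)[OF f i] na[OF i] set_butlast_sub[of "f i"] False by auto
      qed auto
    qed
    moreover have "boundary E A (X - {a}) \<subseteq> insert a ?T" by (auto simp: boundary_def)
    ultimately have "wave E A B (X - {a}) (f(a := [a]))"
      using w fan_subset unfolding wave_def by blast
    then show ?thesis using assms(1) unfolding loose_def by blast
  qed
qed

section \<open>Linkages in countable webs\<close>

lemma disjoint_paths_extend:
  assumes F: "disjoint_paths E A F" and J: "J \<subseteq> A" and G: "disjoint_paths E J G"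
    and hl: "\<And>a. a \<in> J \<Longrightarrow> hd (G a) = last (F a)"
    and dj: "\<And>a b. a \<in> J \<Longrightarrow> b \<in> A \<Longrightarrow> set (tl (G a)) \<inter> set (F b) = {}"
  shows "disjoint_paths E A (\<lambda>a. if a \<in> J then F a @ tl (G a) else F a)" (is "disjoint_paths E A ?F")
    and "a \<in> A \<Longrightarrow> hd (if a \<in> J then F a @ tl (G a) else F a) = hd (F a)"
    and "a \<in> J \<Longrightarrow> last (if a \<in> J then F a @ tl (G a) else F a) = last (G a)"
proof -
  have cc: "dipath E (?F a)" "last (?F a) = last (G a)" if "a \<in> J" for a
    using dipath_concat[of E "F a" "G a"] disjoint_pathsD[OF F, of a] disjoint_pathsD[OF G that] hl[OF that] dj[OF that, of a] J that by auto
  show "hd (?F a) = hd (F a)" if "a \<in> A" using dipath_ne[OF disjoint_pathsD[OF F that]] by simp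
  show "last (?F a) = last (G a)" if "a \<in> J" using cc(2)[OF that] .
  show "disjoint_paths E A ?F"
  proof (rule disjoint_pathsI)
    show "dipath E (?F i)" if "i \<in> A" for i using cc(1)[of i] disjoint_pathsD[OF F that] by (cases "i \<in> J") simp_all
    show "i = j" if ij: "i \<in> A" "j \<in> A" "x \<in> set (?F i)" "x \<in> set (?F j)" for i j x
    proof -
      have 1: "x \<in> set (F i) \<or> i \<in> J \<and> x \<in> set (tl (G i))" using ij(3) by (auto split: if_splits)
      have 2: "x \<in> set (F j) \<or> j \<in> J \<and> x \<in> set (tl (G j))" using ij(4) by (auto split: if_splits)
      show ?thesis
      proof (cases "x \<in> set (F i)")
        case True
        then have "x \<in> set (F j)" using 2 dj[of j i] ij by blast
        then show ?thesis using disjoint_paths_eq[OF F ij(1,2) True] by blast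
      next
        case False
        then have i: "i \<in> J" "x \<in> set (tl (G i))" using 1 by auto
        then have j: "j \<in> J" "x \<in> set (tl (G j))" using 2 dj[of i j] ij by blast+
        have "x \<in> set (G i)" "x \<in> set (G j)" using i(2) j(2) by (metis list.set_sel(2) empty_iff list.sel(2) list.set(1))+
        then show ?thesis using disjoint_paths_eq[OF G i(1) j(1)] by blast
      qed
    qed
  qed
qed

lemma greatest_wave_loose:
  assumes "countable C" and C: "A \<union> Range E \<subseteq> C"
  shows "\<exists>X f. wave E A B X f \<and> X \<subseteq> C \<and> loose (del E X) (boundary E A X) B \<and>
    (\<forall>z\<in>C. (\<exists>X' f'. wave E A B X' f' \<and> z \<in> X') \<longrightarrow> z \<in> X)"
proof -
  from greatest_wave[OF assms(1), of E A B] obtain X f where w: "wave E A B X f"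
    "\<forall>z\<in>C. (\<exists>X' f'. wave E A B X' f' \<and> z \<in> X') \<longrightarrow> z \<in> X" by blast
  let ?X = "X \<inter> C"
  have w': "wave E A B ?X f" using wave_restrict[OF w(1) C] .
  have m': "\<forall>z\<in>C. (\<exists>X' f'. wave E A B X' f' \<and> z \<in> X') \<longrightarrow> z \<in> ?X" using w(2) by blast
  then have "\<forall>z\<in>A \<union> Range E. (\<exists>X' f'. wave E A B X' f' \<and> z \<in> X') \<longrightarrow> z \<in> ?X" using C by blast
  from quotient_loose[OF w' this] show ?thesis using w' m' by (intro exI[of _ ?X] exI[of _ f]) blast
qed

section \<open>Linking one source while pushing the others forward\<close>

lemma wave_normalise:
  assumes "wave E A B X f"
  shows "wave E A B X (\<lambda>t. if t \<in> A then [t] else f t)" (is "wave E A B X ?f")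
proof -
  have f: "fan E A X (boundary E A X) f" using assms by (simp add: wave_def)
  have sub: "set (?f i) \<subseteq> set (f i)" if "i \<in> boundary E A X" for i using fanD(6)[OF f that] by simp
  have "fan E A X (boundary E A X) ?f"
    unfolding fan_def
  proof (intro conjI disjoint_pathsI ballI)
    show "dipath E (?f i)" if "i \<in> boundary E A X" for i using fanD(1)[OF f that] by simp
    show "i = j" if ij: "i \<in> boundary E A X" "j \<in> boundary E A X" "x \<in> set (?f i)" "x \<in> set (?f j)" for i j x
      using disjoint_paths_eq[OF fan_dpf[OF f] ij(1,2), of x] ij sub by blast
    show "hd (?f i) \<in> A" "last (?f i) = i" "set (butlast (?f i)) \<subseteq> X" if "i \<in> boundary E A X" for i
      using fanD(2-4)[OF f that] by simp_all
  qed
  then show ?thesis using assms by (simp add: wave_def)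
qed

text \<open>Moving \<open>c\<close> into the tree can create waves in the quotient but no hindrance.
  Absorbing the greatest such wave makes the quotient loose again, and since it is not a hindrance
  every source still starts a path.\<close>

lemma tree_step:
  assumes cE: "countable E" and A: "countable A" and w: "wave (del E U) A B X f"
    and UX: "X \<inter> U = {}" and st: "hd ` f ` boundary (del E U) A X = A"
    and L: "loose (del E (U \<union> X)) (boundary (del E U) A X) B"
    and AU: "A \<inter> U = {}" and c: "c \<notin> boundary (del E U) A X" "c \<notin> X"
  shows "\<exists>X' f'. wave (del E (insert c U)) A B X' f' \<and> X' \<inter> insert c U = {} \<and> X \<subseteq> X' \<and>
    hd ` f' ` boundary (del E (insert c U)) A X' = A \<and>
    loose (del E (insert c U \<union> X')) (boundary (del E (insert c U)) A X') B \<and>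
    (\<forall>t\<in>boundary (del E U) A X \<inter> boundary (del E (insert c U)) A X'. f' t = f t)"
proof -
  let ?T = "boundary (del E U) A X" and ?E1 = "del E (insert c U)"
  have f: "fan (del E U) A X ?T f" and XB: "X \<inter> B = {}" using w by (auto simp: wave_def)
  have bd1: "boundary ?E1 A X = ?T" using c by (auto simp: boundary_def Image_iff) metis
  have f1: "fan ?E1 A X (boundary ?E1 A X) f"
    unfolding fan_def bd1
  proof (intro conjI disjoint_pathsI ballI)
    fix t assume t: "t \<in> ?T"
    note F = fanD[OF f t]
    show "hd (f t) \<in> A" "last (f t) = t" "set (butlast (f t)) \<subseteq> X" by fact+
    have "c \<notin> set (f t)" using F(7) c t by blast
    then have "dipath (del (del E U) {c}) (f t)" using dipath_delI[OF F(1), of "{c}"] by simp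
    then show "dipath ?E1 (f t)" by simp
  next
    show "i = j" if "i \<in> ?T" "j \<in> ?T" "x \<in> set (f i)" "x \<in> set (f j)" for i j x
      using disjoint_paths_eq[OF fan_dpf[OF f] that] .
  qed
  have qE: "del (del E (U \<union> X)) {c} = del ?E1 X" by (auto simp: del_def)
  have uh: "unhindered (del ?E1 X) ?T B" using loose_del_nonsource[OF L c(1)] unfolding qE .
  have "countable ?T"
  proof -
    have "?T \<subseteq> A \<union> Range E" by (auto simp: boundary_def)
    then show ?thesis using countable_subset A cE by (metis Range_snd countable_Un countable_image)
  qed
  moreover have "countable (del ?E1 X)" using countable_subset[OF del_subset cE] countable_subset[OF del_subset] by blast
  ultimately obtain X2 f0 where w0: "wave (del ?E1 X) ?T B X2 f0" and X2: "X2 \<subseteq> ?T \<union> Range (del ?E1 X)"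
    and L2: "loose (del (del ?E1 X) X2) (boundary (del ?E1 X) ?T X2) B"
    using greatest_wave_loose[of "?T \<union> Range (del ?E1 X)" ?T "del ?E1 X" B] by (auto simp: Range_snd)
  \<comment> \<open>Targets that are already sources of the quotient get one-vertex paths, so that a
    path with a longer way to go ends off \<open>?T\<close>.\<close>
  define f2 where "f2 = (\<lambda>t. if t \<in> ?T then [t] else f0 t)"
  have w2: "wave (del ?E1 X) ?T B X2 f2" unfolding f2_def by (rule wave_normalise[OF w0])
  have dj: "X \<inter> X2 = {}" using X2 by (auto simp: boundary_def)
  have X2c: "c \<notin> X2" using X2 c by auto
  let ?S = "boundary ?E1 A (X \<union> X2)"
  have bq: "boundary (del ?E1 X) ?T X2 = ?S" using boundary_quotient[OF dj, of ?E1 A] bd1 by simp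
  have f2: "fan (del ?E1 X) ?T X2 ?S f2" using w2 bq unfolding wave_def by metis
  have "fan (del ?E1 X) (boundary ?E1 A X) X2 (boundary ?E1 A (X \<union> X2)) f2" using f2 bd1 by simp
  from quotient_join[OF f1 dj this] obtain f' where f': "fan ?E1 A (X \<union> X2) ?S f'" "\<forall>t\<in>?T - X2. f' t = f t"
    "\<forall>t\<in>?S - ?T. \<exists>u x w. f2 t = u @ x # w \<and> x \<in> ?T \<and> f' t = f x @ w" unfolding bd1 by blast
  have uh2: "?T \<inter> X2 \<subseteq> hd ` f2 ` ?S" using uh w2 bq unfolding unhindered_def by metis
  have "A \<subseteq> hd ` f' ` ?S"
  proof
    fix a assume "a \<in> A"
    then have "a \<in> hd ` f ` ?T" using st by simp
    then obtain \<tau> where tau: "\<tau> \<in> ?T" "hd (f \<tau>) = a" by blast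
    show "a \<in> hd ` f' ` ?S"
    proof (cases "\<tau> \<in> X2")
      case False
      then have "\<tau> \<in> ?S" using tau(1) bd1 by (auto simp: boundary_def)
      then show ?thesis using f'(2) tau False by force
    next
      case True
      then obtain t where t: "t \<in> ?S" "hd (f2 t) = \<tau>" using uh2 tau(1) by auto
      have tX: "t \<notin> X2" using t(1) by (auto simp: boundary_def)
      have "t \<notin> ?T"
      proof
        assume "t \<in> ?T"
        then have "t = \<tau>" using t(2) by (simp add: f2_def)
        then show False using True tX by simp
      qed
      then obtain u x w where x: "f2 t = u @ x # w" "x \<in> ?T" "f' t = f x @ w" using f'(3) t(1) by blast
      \<comment> \<open>If the last visit \<open>x\<close> to \<open>?T\<close> came after the start
        of \<open>f2 t\<close>, then \<open>x\<close> would lie in \<open>X2\<close> and, there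
        being no hindrance, would head a path of its own; disjointness makes that path
        \<open>f2 t\<close> itself.\<close>
      have "u = []"
      proof (rule ccontr)
        assume u: "u \<noteq> []"
        have "w \<noteq> [] \<or> x = t" using fanD(3)[OF f2 t(1)] x(1) by (cases "w = []") auto
        then have "x \<in> X2" using fanD(4)[OF f2 t(1)] x(1,2) \<open>t \<notin> ?T\<close> by (auto simp: butlast_append)
        then obtain t' where t': "t' \<in> ?S" "hd (f2 t') = x" using uh2 x(2) by auto
        have "x \<in> set (f2 t')" using t'(2) fanD(5)[OF f2 t'(1)] hd_in_set by metis
        then have "t' = t" using disjoint_paths_eq[OF fan_dpf[OF f2] t'(1) t(1), of x] x(1) by auto
        then have "hd u = x" using t'(2) x(1) u by simp
        then show False using u fanD(1)[OF f2 t(1)] x(1) hd_in_set[OF u] by (auto simp: dipath_def)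
      qed
      then have "x = \<tau>" using t(2) x(1) by simp
      then have "hd (f' t) = a" using x(3) tau fanD(5)[OF f tau(1)] by simp
      then show ?thesis using t(1) by blast
    qed
  qed
  moreover have "hd ` f' ` ?S \<subseteq> A"
  proof -
    have "\<forall>t\<in>?S. hd (f' t) \<in> A" using fanD(2)[OF f'(1)] by blast
    then show ?thesis by blast
  qed
  moreover have "wave ?E1 A B (X \<union> X2) f'" using f'(1) XB w2 by (auto simp: wave_def)
  moreover have "(X \<union> X2) \<inter> insert c U = {}"
  proof -
    have "?T \<inter> U = {}" using AU by (auto simp: boundary_def)
    then have "X2 \<inter> U = {}" using X2 by auto
    then show ?thesis using UX X2c c(2) by blast
  qed
  moreover have "loose (del E (insert c U \<union> (X \<union> X2))) ?S B"
  proof -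
    have "del (del ?E1 X) X2 = del E (insert c U \<union> (X \<union> X2))" by (simp add: Un_assoc)
    then show ?thesis using L2 bq by simp
  qed
  moreover have "\<forall>t\<in>?T \<inter> ?S. f' t = f t" using f'(2) by (auto simp: boundary_def)
  ultimately show ?thesis by (intro exI[of _ "X \<union> X2"] exI[of _ f']) blast
qed

text \<open>Grow a tree \<open>U\<close> from \<open>a\<close>, pushing the other sources forward along greatest waves. If the tree never
  met \<open>B\<close>, then the tree and the waves together would form a wave containing \<open>a\<close>.\<close>

lemma tree_lemma:
  assumes cE: "countable E" and cA: "countable A" and L: "loose E A B" and a: "a \<in> A"
  obtains q U X g where "dipath E q" "hd q = a" "last q \<in> B" "set q \<subseteq> U" "disjoint_paths (del E U) (A - {a}) g"
    "\<And>t. t \<in> A - {a} \<Longrightarrow> hd (g t) = t \<and> set (butlast (g t)) \<subseteq> X \<and> last (g t) \<notin> X \<union> U"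
    "(A - {a}) \<inter> U = {}" "loose (del E (U \<union> X)) (last ` g ` (A - {a})) B"
proof -
  let ?A = "A - {a}"
  define inv where "inv = (\<lambda>(U, X, f). a \<in> U \<and> ?A \<inter> U = {} \<and> X \<inter> U = {} \<and>
    (\<forall>u\<in>U. \<exists>q. dipath E q \<and> hd q = a \<and> last q = u \<and> set q \<subseteq> U) \<and>
    wave (del E U) ?A B X f \<and> hd ` f ` boundary (del E U) ?A X = ?A \<and>
    loose (del E (U \<union> X)) (boundary (del E U) ?A X) B)"
  have "\<exists>U X f. inv (U, X, f) \<and> U \<inter> B \<noteq> {}"
  proof (rule ccontr)
    assume no: "\<not> ?thesis"
    define C where "C = insert a (Range E)"
    have C: "countable C" "C \<noteq> {}" using cE by (auto simp: C_def Range_snd)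
    \<comment> \<open>Decoding pairs lists every vertex infinitely often, so one that becomes
      adjacent to the tree late is still considered afterwards.\<close>
    define c where "c n = from_nat_into C (fst (prod_decode n))" for n
    let ?P = "\<lambda>(n::nat). inv"
    let ?Q = "\<lambda>n (U, X, f) (U', X', f'). U \<subseteq> U' \<and> X \<subseteq> X' \<and>
       (\<forall>t\<in>boundary (del E U) ?A X \<inter> boundary (del E U') ?A X'. f' t = f t) \<and>
       (c n \<notin> U \<union> X \<union> boundary (del E U) ?A X \<and> c n \<in> E `` U \<longrightarrow> c n \<in> U')"
    have "\<exists>F. \<forall>n. ?P n (F n) \<and> ?Q n (F n) (F (Suc n))"
    proof (rule dependent_nat_choice)
      have "boundary (del E {a}) ?A {} = ?A" by (auto simp: boundary_def)
      then have "inv ({a}, {}, \<lambda>t. [t])"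
        using trivial_wave loose_del_source[OF L a] a unfolding inv_def
        by (auto simp: image_image intro: exI[of _ "[a]"])
      then show "\<exists>s. ?P 0 s" by blast
      show "\<exists>s'. ?P (Suc n) s' \<and> ?Q n s s'" if "?P n s" for s n
      proof -
        obtain U X f where s: "s = (U, X, f)" by (metis prod_cases3)
        have I: "a \<in> U" "?A \<inter> U = {}" "X \<inter> U = {}" "wave (del E U) ?A B X f"
            "hd ` f ` boundary (del E U) ?A X = ?A" "loose (del E (U \<union> X)) (boundary (del E U) ?A X) B"
            "\<forall>u\<in>U. \<exists>q. dipath E q \<and> hd q = a \<and> last q = u \<and> set q \<subseteq> U"
            using that s unfolding inv_def by auto
        show ?thesis
        proof (cases "c n \<notin> U \<union> X \<union> boundary (del E U) ?A X \<and> c n \<in> E `` U")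
          case True
          have "countable ?A" using cA by auto
          then obtain X' f' where s': "wave (del E (insert (c n) U)) ?A B X' f'" "X' \<inter> insert (c n) U = {}" "X \<subseteq> X'"
            "hd ` f' ` boundary (del E (insert (c n) U)) ?A X' = ?A"
            "loose (del E (insert (c n) U \<union> X')) (boundary (del E (insert (c n) U)) ?A X') B"
            "\<forall>t\<in>boundary (del E U) ?A X \<inter> boundary (del E (insert (c n) U)) ?A X'. f' t = f t"
            using tree_step[OF cE _ I(4,3,5,6) I(2), of "c n"] True by auto
          have cA': "c n \<notin> ?A" using True by (auto simp: boundary_def)
          obtain u where u: "u \<in> U" "(u, c n) \<in> E" using True by blast
          obtain q where q: "dipath E q" "hd q = a" "last q = u" "set q \<subseteq> U" using I(7) u(1) by blast
          have "dipath E (q @ [c n])" using dipath_append[OF dipath_ne[OF q(1)], of "[c n]" E] q u True by auto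
          then have "\<exists>q. dipath E q \<and> hd q = a \<and> last q = c n \<and> set q \<subseteq> insert (c n) U"
            using q dipath_ne[OF q(1)] by (intro exI[of _ "q @ [c n]"]) auto
          then have "\<forall>u\<in>insert (c n) U. \<exists>q. dipath E q \<and> hd q = a \<and> last q = u \<and> set q \<subseteq> insert (c n) U"
            using I(7) by (metis insert_iff subset_insertI2)
          then have "inv (insert (c n) U, X', f')" unfolding inv_def prod.case
            using s'(1,2,4,5) I(1,2) cA' by (intro conjI) simp_all
          then show ?thesis using s s' by (intro exI[of _ "(insert (c n) U, X', f')"]) auto
        next
          case False
          then show ?thesis using that s by (intro exI[of _ s]) auto
        qed
      qed
    qed
    then obtain F where F': "\<forall>n. ?P n (F n) \<and> ?Q n (F n) (F (Suc n))" by (elim exE) (rule that)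
    have F: "inv (F n)" "?Q n (F n) (F (Suc n))" for n
      using F'[rule_format, of n] by (rule conjunct1, rule conjunct2)
    define U X f where "U n = fst (F n)" and "X n = fst (snd (F n))" and "f n = snd (snd (F n))" for n
    have FF: "F n = (U n, X n, f n)" for n by (simp add: U_def X_def f_def)
    let ?T = "\<lambda>n. boundary (del E (U n)) ?A (X n)"
    have I: "a \<in> U n" "?A \<inter> U n = {}" "X n \<inter> U n = {}" "wave (del E (U n)) ?A B (X n) (f n)" for n
      using F(1)[of n] unfolding FF inv_def by auto
    have Q: "U n \<subseteq> U (Suc n)" "X n \<subseteq> X (Suc n)" "\<forall>t\<in>?T n \<inter> ?T (Suc n). f (Suc n) t = f n t"
       "c n \<notin> U n \<union> X n \<union> ?T n \<and> c n \<in> E `` U n \<longrightarrow> c n \<in> U (Suc n)" for n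
      using F(2)[of n] unfolding FF by auto
    have Umono: "U n \<subseteq> U m" if "n \<le> m" for n m by (rule lift_Suc_mono_le[of U, OF Q(1) that])
    have Xmono: "X n \<subseteq> X m" if "n \<le> m" for n m by (rule lift_Suc_mono_le[of X, OF Q(2) that])
    have UB: "U n \<inter> B = {}" for n using no F(1)[of n] unfolding FF by blast
    let ?X = "(\<Union>n. X n)" and ?U = "(\<Union>n. U n)"
    have "\<exists>g. fan E ?A ?X {t. \<exists>n. \<forall>m\<ge>n. t \<in> ?T m} g \<and> (\<forall>n t. (\<forall>m\<ge>n. t \<in> ?T m) \<longrightarrow> g t = f n t)"
    proof (rule fan_limit)
      show "fan E ?A (X n) (?T n) (f n)" for n
        using I(4)[of n] unfolding wave_def fan_def using disjoint_paths_mono[OF _ del_subset] by blast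
      show "X n \<subseteq> X (Suc n)" for n by (rule Q(2))
      show "f (Suc n) t = f n t" if "t \<in> ?T n" "t \<in> ?T (Suc n)" for n t using Q(3)[of n] that by blast
    qed
    then obtain g where g: "fan E ?A ?X {t. \<exists>n. \<forall>m\<ge>n. t \<in> ?T m} g" by blast
    \<comment> \<open>A neighbour of the tree that is never added must have been on the boundary of
      the wave when its turn came; it stays there and so keeps its path in the limit.\<close>
    have "boundary E A (?X \<union> ?U) \<subseteq> {t. \<exists>n. \<forall>m\<ge>n. t \<in> ?T m}"
    proof
      fix t assume t: "t \<in> boundary E A (?X \<union> ?U)"
      then have nX: "t \<notin> X n" "t \<notin> U n" for n by (auto simp: boundary_def)
      have up: "t \<in> {t. \<exists>n. \<forall>m\<ge>n. t \<in> ?T m}" if "t \<in> ?A \<union> E `` X n" for n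
      proof -
        have "t \<in> ?T m" if m: "m \<ge> n" for m
        proof (cases "t \<in> ?A")
          case True then show ?thesis using nX by (auto simp: boundary_def)
        next
          case False
          then obtain x where x: "x \<in> X n" "(x, t) \<in> E" using \<open>t \<in> ?A \<union> E `` X n\<close> by blast
          then have "x \<in> X m" using Xmono[OF m] by blast
          then have "x \<notin> U m" using I(3)[of m] by blast
          then have "(x, t) \<in> del E (U m)" using x nX by simp
          then show ?thesis using \<open>x \<in> X m\<close> nX by (auto simp: boundary_def)
        qed
        then show ?thesis by blast
      qed
      show "t \<in> {t. \<exists>n. \<forall>m\<ge>n. t \<in> ?T m}"
      proof (cases "t \<in> A \<or> (\<exists>n. t \<in> E `` X n)")
        case True
        moreover have "t \<noteq> a" using nX(2) I(1) by blast
        ultimately show ?thesis using up by blast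
      next
        case False
        then obtain k u where u: "u \<in> U k" "(u, t) \<in> E" using t by (auto simp: boundary_def)
        then have "t \<in> C" by (auto simp: C_def)
        then obtain i where i: "from_nat_into C i = t" using from_nat_into_surj[OF C(1)] by blast
        define n where "n = prod_encode (i, k)"
        have "k \<le> n" unfolding n_def by (rule le_prod_encode_2)
        then have "c n \<in> E `` U n" "c n = t" using u i Umono[of k n] by (auto simp: c_def n_def)
        then have "t \<in> ?T n" using Q(4)[of n] nX by auto
        then have "t \<in> ?A \<union> E `` X n" by (auto simp: boundary_def)
        then show ?thesis by (rule up)
      qed
    qed
    from fan_subset[OF g this] have "fan E A (?X \<union> ?U) (boundary E A (?X \<union> ?U)) g"
      unfolding fan_def by blast
    moreover have "(?X \<union> ?U) \<inter> B = {}" using UB I(4) unfolding wave_def by blast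
    ultimately have "wave E A B (?X \<union> ?U) g" by (simp add: wave_def)
    then show False using L I(1) a unfolding loose_def by blast
  qed
  then obtain U X f u where I: "inv (U, X, f)" "u \<in> U" "u \<in> B" by blast
  let ?T = "boundary (del E U) ?A X"
  have J: "a \<in> U" "?A \<inter> U = {}" "X \<inter> U = {}" "wave (del E U) ?A B X f"
    "hd ` f ` ?T = ?A" "loose (del E (U \<union> X)) ?T B"
    "\<forall>u\<in>U. \<exists>q. dipath E q \<and> hd q = a \<and> last q = u \<and> set q \<subseteq> U"
    using I(1) unfolding inv_def by auto
  have f: "fan (del E U) ?A X ?T f" using J(4) by (simp add: wave_def)
  obtain q where q: "dipath E q" "hd q = a" "last q = u" "set q \<subseteq> U" using J(7) I(2) by blast
  define e where "e t = (SOME s. s \<in> ?T \<and> hd (f s) = t)" for t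
  have e: "e t \<in> ?T" "hd (f (e t)) = t" if "t \<in> ?A" for t
  proof -
    have "t \<in> hd ` f ` ?T" using that J(5) by simp
    then have "\<exists>s. s \<in> ?T \<and> hd (f s) = t" by blast
    from someI_ex[OF this] show "e t \<in> ?T" "hd (f (e t)) = t" by (auto simp: e_def)
  qed
  have hT: "hd (f s) \<in> set (f s)" if "s \<in> ?T" for s using fanD(5)[OF f that] by simp
  have lg: "(\<lambda>t. last (f (e t))) ` ?A = ?T"
  proof
    show "(\<lambda>t. last (f (e t))) ` ?A \<subseteq> ?T"
    proof
      fix s assume "s \<in> (\<lambda>t. last (f (e t))) ` ?A"
      then obtain t where t: "t \<in> ?A" "s = last (f (e t))" by blast
      then show "s \<in> ?T" using fanD(3)[OF f e(1)[OF t(1)]] e(1)[OF t(1)] by simp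
    qed
    show "?T \<subseteq> (\<lambda>t. last (f (e t))) ` ?A"
    proof
      fix s assume s: "s \<in> ?T"
      let ?t = "hd (f s)"
      have t: "?t \<in> ?A" using fanD(2)[OF f s] .
      have "e ?t = s" using disjoint_paths_eq[OF fan_dpf[OF f] e(1)[OF t] s, of ?t] e(2)[OF t] hT[OF e(1)[OF t]] hT[OF s] by simp
      then have "s = last (f (e ?t))" using fanD(3)[OF f s] by simp
      then show "s \<in> (\<lambda>t. last (f (e t))) ` ?A" using t by blast
    qed
  qed
  show thesis
  proof (rule that[of q U "\<lambda>t. f (e t)" X])
    show "disjoint_paths (del E U) ?A (\<lambda>t. f (e t))"
    proof (rule disjoint_pathsI)
      show "dipath (del E U) (f (e i))" if "i \<in> ?A" for i using fanD(1)[OF f e(1)[OF that]] .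
      show "i = j" if "i \<in> ?A" "j \<in> ?A" "x \<in> set (f (e i))" "x \<in> set (f (e j))" for i j x
        using disjoint_paths_eq[OF fan_dpf[OF f] e(1)[OF that(1)] e(1)[OF that(2)] that(3,4)] e(2) that by metis
    qed
    show "hd (f (e t)) = t \<and> set (butlast (f (e t))) \<subseteq> X \<and> last (f (e t)) \<notin> X \<union> U" if "t \<in> ?A" for t
      using e[OF that] fanD(3,4)[OF f e(1)[OF that]] J(2) by (auto simp: boundary_def)
    show "loose (del E (U \<union> X)) (last ` (\<lambda>t. f (e t)) ` ?A) B" using J(6) lg by (simp add: image_image)
  qed (use q I J in auto)
qed

text \<open>Sources are served one at a time. The path served runs inside a tree, the other paths
  are pushed to the boundary of a wave, and after deleting the used vertices \<open>D\<close> the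
  remaining web is loose again. Served paths never change, so the limit is a linkage.\<close>

theorem loose_linkable:
  assumes cE: "countable E" and cA: "countable A" and L: "loose E A B"
  shows "\<exists>F. disjoint_paths E A F \<and> (\<forall>a\<in>A. hd (F a) = a \<and> last (F a) \<in> B)"
proof (cases "A = {}")
  case True then show ?thesis by (auto simp: disjoint_paths_def)
next
  case False
  define c where "c = from_nat_into A"
  define inv where "inv = (\<lambda>(D, P, F). disjoint_paths E A F \<and> (\<forall>a\<in>A. hd (F a) = a) \<and>
    (\<forall>a\<in>A \<inter> P. set (F a) \<subseteq> D \<and> last (F a) \<in> B) \<and>
    (\<forall>a\<in>A - P. last (F a) \<notin> D \<and> set (F a) \<subseteq> insert (last (F a)) D) \<and>
    loose (del E D) (last ` F ` (A - P)) B)"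
  let ?P = "\<lambda>(n::nat). inv"
  let ?Q = "\<lambda>n (D, P, F) (D', P', F'). P \<subseteq> P' \<and> c n \<in> P' \<and> (\<forall>a\<in>A \<inter> P. F' a = F a)"
  have "\<exists>S. \<forall>n. ?P n (S n) \<and> ?Q n (S n) (S (Suc n))"
  proof (rule dependent_nat_choice)
    have "inv ({}, {}, \<lambda>a. [a])"
      using L unfolding inv_def by (auto simp: disjoint_paths_def image_image del_def)
    then show "\<exists>s. ?P 0 s" by blast
    show "\<exists>s'. ?P (Suc n) s' \<and> ?Q n s s'" if sn: "?P n s" for s n
    proof -
      obtain D P F where s: "s = (D, P, F)" by (metis prod_cases3)
      have I: "disjoint_paths E A F" "\<forall>a\<in>A. hd (F a) = a" "\<forall>a\<in>A \<inter> P. set (F a) \<subseteq> D \<and> last (F a) \<in> B"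
        "\<forall>a\<in>A - P. last (F a) \<notin> D \<and> set (F a) \<subseteq> insert (last (F a)) D"
        "loose (del E D) (last ` F ` (A - P)) B"
        using sn s unfolding inv_def by auto
      have cn: "c n \<in> A" unfolding c_def by (rule from_nat_into[OF False])
      show ?thesis
      proof (cases "c n \<in> P")
        case True then show ?thesis using sn s by (intro exI[of _ s]) auto
      next
        case False
        let ?J = "A - P" and ?c = "c n"
        let ?T = "last ` F ` ?J" and ?t = "last (F (c n))"
        have cT: "countable ?T" using cA by simp
        have cD: "countable (del E D)" using countable_subset[OF del_subset cE] .
        have "?t \<in> ?T" using cn False by blast
        from tree_lemma[OF cD cT I(5) this] obtain q U X g where
          q: "dipath (del E D) q" "hd q = ?t" "last q \<in> B" "set q \<subseteq> U" and
          g: "disjoint_paths (del (del E D) U) (?T - {?t}) g"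
          "\<And>t. t \<in> ?T - {?t} \<Longrightarrow> hd (g t) = t \<and> set (butlast (g t)) \<subseteq> X \<and> last (g t) \<notin> X \<union> U" and
          TU: "(?T - {?t}) \<inter> U = {}" and L': "loose (del (del E D) (U \<union> X)) (last ` g ` (?T - {?t})) B"
          by metis
        have lF: "last (F b) \<in> set (F b)" if "b \<in> A" for b using dipath_ne[OF disjoint_pathsD[OF I(1) that]] by simp
        have linj: "b = b'" if "b \<in> A" "b' \<in> A" "last (F b) = last (F b')" for b b'
          using disjoint_paths_eq[OF I(1) that(1,2), of "last (F b)"] lF[OF that(1)] lF[OF that(2)] that(3) by simp
        define G where "G b = (if b = ?c then q else g (last (F b)))" for b
        have lb: "last (F b) \<in> ?T - {?t}" if "b \<in> ?J" "b \<noteq> ?c" for b using that linj cn by blast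
        have gp: "dipath (del E D) (g t) \<and> set (g t) \<inter> (D \<union> U) = {}" if t: "t \<in> ?T - {?t}" for t
        proof -
          have p: "dipath (del E (D \<union> U)) (g t)" using disjoint_pathsD[OF g(1) t] by simp
          have "t \<notin> U" using t TU by blast
          moreover have "t \<notin> D" using t I(4) by blast
          ultimately have "t \<notin> D \<union> U" by blast
          then have "set (g t) \<inter> (D \<union> U) = {}" using dipath_del_avoid[OF p] g(2)[OF t] by simp
          then show ?thesis using p disjoint_pathsD[OF g(1) t] dipath_delD by blast
        qed
        have qD: "set q \<inter> D = {}" using dipath_del_avoid[OF q(1)] q(2) I(4) cn False by auto
        have G: "disjoint_paths (del E D) ?J G"
        proof (rule disjoint_pathsI)
          show "dipath (del E D) (G i)" if "i \<in> ?J" for i using gp[OF lb[OF that]] q(1) by (auto simp: G_def)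
          show "i = j" if ij: "i \<in> ?J" "j \<in> ?J" "x \<in> set (G i)" "x \<in> set (G j)" for i j x
          proof -
            have 1: "x \<notin> U" if "i \<in> ?J" "i \<noteq> ?c" "x \<in> set (G i)" for i
              using gp[OF lb[OF that(1,2)]] that by (auto simp: G_def)
            have 2: "x \<in> U" if "x \<in> set (G ?c)" using that q(4) by (auto simp: G_def)
            show ?thesis
            proof (cases "i = ?c \<or> j = ?c")
              case True then show ?thesis using 1 2 ij by metis
            next
              case False
              then have ii: "last (F i) \<in> ?T - {?t}" "last (F j) \<in> ?T - {?t}" using lb ij by auto
              have "last (F i) = last (F j)" using disjoint_paths_eq[OF g(1) ii, of x] ij False by (simp add: G_def)
              then show ?thesis using linj ij by blast
            qed
          qed
        qed
        have hG: "hd (G b) = last (F b)" if "b \<in> ?J" for b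
          using g(2)[OF lb[OF that]] q(2) by (auto simp: G_def)
        have GD: "set (G b) \<inter> D = {}" if "b \<in> ?J" for b using gp[OF lb[OF that]] qD by (auto simp: G_def)
        have dj: "set (tl (G b)) \<inter> set (F b') = {}" if b: "b \<in> ?J" "b' \<in> A" for b b'
        proof (rule ccontr)
          assume "\<not> ?thesis"
          then obtain x where x: "x \<in> set (tl (G b))" "x \<in> set (F b')" by blast
          have ne: "G b \<noteq> []" using dipath_ne[OF disjoint_pathsD[OF G b(1)]] .
          then have xG: "x \<in> set (G b)" "x \<noteq> hd (G b)" using x(1) disjoint_pathsD[OF G b(1)]
            by (cases "G b"; auto simp: dipath_def)+
          have "x \<notin> D" using xG GD[OF b(1)] by blast
          then have b': "b' \<in> ?J" "x = last (F b')" using I(3,4) b(2) x(2) by blast+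
          have "x \<in> set (G b')" using hG[OF b'(1)] b'(2) dipath_ne[OF disjoint_pathsD[OF G b'(1)]] hd_in_set by metis
          then have "b = b'" using disjoint_paths_eq[OF G b(1) b'(1) xG(1)] by blast
          then show False using xG(2) hG[OF b(1)] b'(2) by simp
        qed
        let ?F = "\<lambda>b. if b \<in> ?J then F b @ tl (G b) else F b"
        have JA: "?J \<subseteq> A" by blast
        have ext: "disjoint_paths E A ?F" "\<And>b. b \<in> A \<Longrightarrow> hd (?F b) = hd (F b)"
          "\<And>b. b \<in> ?J \<Longrightarrow> last (?F b) = last (G b)"
          using disjoint_paths_extend[OF I(1) JA disjoint_paths_mono[OF G del_subset]] hG dj by blast+
        have tlG: "set (tl (G b)) \<subseteq> set (G b)" for b by (cases "G b") auto
        have GX: "set (G b) \<subseteq> insert (last (G b)) X" "last (G b) \<notin> X \<union> U \<union> D" if "b \<in> ?J" "b \<noteq> ?c" for b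
        proof -
          have Gb: "G b = g (last (F b))" using that by (simp add: G_def)
          have ne: "G b \<noteq> []" using dipath_ne[OF disjoint_pathsD[OF G that(1)]] .
          show "set (G b) \<subseteq> insert (last (G b)) X"
            using g(2)[OF lb[OF that]] set_butlast_last[OF ne] unfolding Gb by auto
          show "last (G b) \<notin> X \<union> U \<union> D"
            using g(2)[OF lb[OF that]] gp[OF lb[OF that]] last_in_set[OF ne] unfolding Gb by auto
        qed
        have "inv (D \<union> U \<union> X, insert ?c P, ?F)"
          unfolding inv_def
        proof (clarify, intro conjI ballI)
          show "disjoint_paths E A ?F" by (rule ext(1))
          show "hd (?F b) = b" if "b \<in> A" for b using ext(2)[OF that] I(2) that by simp
          show "set (?F b) \<subseteq> D \<union> U \<union> X" if b: "b \<in> A \<inter> insert ?c P" for b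
          proof (cases "b = ?c")
            case True
            have "last (F ?c) \<in> set (G ?c)" using hG[of ?c] cn False dipath_ne[OF disjoint_pathsD[OF G, of ?c]]
              by (metis DiffI hd_in_set)
            moreover have "G ?c = q" by (simp add: G_def)
            ultimately have "set (F ?c) \<subseteq> D \<union> U" "set (G ?c) \<subseteq> U" using I(4) cn False q(4) by auto
            then show ?thesis using True tlG[of ?c] by auto
          next
            case F: False then show ?thesis using b I(3) by auto
          qed
          show "last (?F b) \<in> B" if b: "b \<in> A \<inter> insert ?c P" for b
          proof (cases "b = ?c")
            case True
            have bJ: "b \<in> ?J" unfolding True using cn False by blast
            have Gq: "G b = q" by (simp add: G_def True)
            have e: "last (?F b) = last q" using ext(3)[OF bJ] unfolding Gq .
            show ?thesis unfolding e by (rule q(3))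
          next
            case F: False then show ?thesis using b I(3) by auto
          qed
          fix b assume b: "b \<in> A - insert ?c P"
          then have bJ: "b \<in> ?J" "b \<noteq> ?c" by auto
          have l: "last (?F b) = last (G b)" by (rule ext(3)[OF bJ(1)])
          show "last (?F b) \<notin> D \<union> U \<union> X" using GX(2)[OF bJ] l by auto
          have "last (F b) \<in> set (G b)" using hG[OF bJ(1)] dipath_ne[OF disjoint_pathsD[OF G bJ(1)]] hd_in_set by metis
          then have "set (F b) \<subseteq> D \<union> insert (last (G b)) X" using I(4) bJ(1) GX(1)[OF bJ] by blast
          then show "set (?F b) \<subseteq> insert (last (?F b)) (D \<union> U \<union> X)"
            unfolding l using bJ GX(1)[OF bJ] tlG[of b] by auto
        next
          have "last ` ?F ` (A - insert ?c P) = last ` g ` (?T - {?t})"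
          proof -
            have "last (?F b) = last (g (last (F b)))" if "b \<in> A - insert ?c P" for b
              using ext(3)[of b] that by (simp add: G_def)
            then have "last ` ?F ` (A - insert ?c P) = (\<lambda>b. last (g (last (F b)))) ` (A - insert ?c P)"
              by (simp add: image_image)
            also have "\<dots> = last ` g ` last ` F ` (A - insert ?c P)" by (simp add: image_image)
            also have "last ` F ` (A - insert ?c P) = ?T - {?t}" using linj cn by blast
            finally show ?thesis .
          qed
          then show "loose (del E (D \<union> U \<union> X)) (last ` ?F ` (A - insert ?c P)) B"
            using L' by (simp add: Un_assoc)
        qed
        then show ?thesis using s by (intro exI[of _ "(D \<union> U \<union> X, insert ?c P, ?F)"]) auto
      qed
    qed
  qed
  then obtain S where S': "\<forall>n. ?P n (S n) \<and> ?Q n (S n) (S (Suc n))" by (elim exE) (rule that)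
  have S: "inv (S n)" "?Q n (S n) (S (Suc n))" for n
    using S'[rule_format, of n] by (rule conjunct1, rule conjunct2)
  define D P F where "D n = fst (S n)" and "P n = fst (snd (S n))" and "F n = snd (snd (S n))" for n
  have SS: "S n = (D n, P n, F n)" for n by (simp add: D_def P_def F_def)
  have I: "disjoint_paths E A (F n)" "\<forall>a\<in>A. hd (F n a) = a" "\<forall>a\<in>A \<inter> P n. last (F n a) \<in> B" for n
    using S(1)[of n] unfolding SS inv_def by auto
  have Q: "P n \<subseteq> P (Suc n)" "c n \<in> P (Suc n)" "\<forall>a\<in>A \<inter> P n. F (Suc n) a = F n a" for n
    using S(2)[of n] unfolding SS by auto
  have Pm: "P n \<subseteq> P m" if "n \<le> m" for n m by (rule lift_Suc_mono_le[of P, OF Q(1) that])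
  have st: "F m a = F n a" if "a \<in> A" "a \<in> P n" "n \<le> m" for n m a
    using that(3)
  proof (induction m rule: dec_induct)
    case (step k)
    then show ?case using Q(3)[of k] Pm[of n k] that by auto
  qed simp
  define N where "N a = (SOME n. a \<in> P n)" for a
  have N: "a \<in> P (N a)" if aA: "a \<in> A" for a
  proof -
    obtain n where "c n = a" using from_nat_into_surj[OF cA aA] unfolding c_def by blast
    then have "\<exists>n. a \<in> P n" using Q(2) by blast
    then show ?thesis unfolding N_def by (rule someI_ex)
  qed
  let ?F = "\<lambda>a. F (N a) a"
  have "disjoint_paths E A ?F"
  proof (rule disjoint_pathsI)
    show "dipath E (?F i)" if "i \<in> A" for i using disjoint_pathsD[OF I(1) that] .
    show "i = j" if ij: "i \<in> A" "j \<in> A" "x \<in> set (?F i)" "x \<in> set (?F j)" for i j x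
    proof -
      let ?k = "max (N i) (N j)"
      have "F ?k i = ?F i" "F ?k j = ?F j" using st[OF ij(1) N[OF ij(1)], of ?k] st[OF ij(2) N[OF ij(2)], of ?k] by auto
      then show ?thesis using disjoint_paths_eq[OF I(1)[of ?k] ij(1,2), of x] ij by simp
    qed
  qed
  then show ?thesis using I(2,3) N by (intro exI[of _ ?F]) auto
qed

text \<open>Countable Menger theorem in wave form: the boundary is reached from \<open>A\<close>
  inside the region and linked to \<open>B\<close> outside it, so the two families join to paths
  that each cross this separator once.\<close>

theorem menger_wave:
  assumes cE: "countable E" and cC: "countable C" and C: "A \<union> Range E \<subseteq> C"
  shows "\<exists>X f g. wave E A B X f \<and> X \<subseteq> C \<and>
    (\<forall>z\<in>C. (\<exists>X' f'. wave E A B X' f' \<and> z \<in> X') \<longrightarrow> z \<in> X) \<and>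
    disjoint_paths (del E X) (boundary E A X) g \<and> (\<forall>t\<in>boundary E A X. hd (g t) = t \<and> last (g t) \<in> B)"
proof -
  obtain X f where w: "wave E A B X f" "X \<subseteq> C" "loose (del E X) (boundary E A X) B"
    "\<forall>z\<in>C. (\<exists>X' f'. wave E A B X' f' \<and> z \<in> X') \<longrightarrow> z \<in> X"
    using greatest_wave_loose[OF cC C] by blast
  have "boundary E A X \<subseteq> C" using C by (auto simp: boundary_def)
  then have "countable (boundary E A X)" using cC countable_subset by blast
  from loose_linkable[OF countable_subset[OF del_subset cE] this w(3)] show ?thesis using w by blast
qed

section \<open>Combining path families\<close>

lemma pym:
  assumes P: "disjoint_paths E T P" and hP: "\<And>t. t \<in> T \<Longrightarrow> hd (P t) = t"
    and Q: "disjoint_paths E S Q" and hQ: "\<And>s. s \<in> S \<Longrightarrow> last (Q s) = s \<and> hd (Q s) \<in> T"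
  shows "\<exists>R. disjoint_paths E T R \<and> (\<forall>t\<in>T. hd (R t) = t) \<and> S \<subseteq> last ` R ` T \<and> last ` R ` T \<subseteq> S \<union> last ` P ` T \<and>
    (\<forall>t\<in>T. set (R t) \<subseteq> (\<Union>t\<in>T. set (P t)) \<union> (\<Union>s\<in>S. set (Q s)))"
proof -
  \<comment> \<open>Stable matching: a \<open>P\<close>-path wants to switch as early, a \<open>Q\<close>-path as late as possible; \<open>R\<close> consists of
    the switching points refused by the \<open>Q\<close>-paths.\<close>
  define M where "M = (\<Union>t\<in>T. set (P t)) \<inter> (\<Union>s\<in>S. set (Q s))"
  \<comment> \<open>A \<open>P\<close>-path offers a meeting point only after all its earlier ones
    have been refused; \<open>\<Phi>\<close> refuses an offer as soon as its \<open>Q\<close>-path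
    has a later one. Both are monotone in the refusals, so deferred acceptance has a least fixed
    point even for infinitely many paths.\<close>
  define Made where "Made R = {x \<in> M. \<forall>t\<in>T. \<forall>u w. P t = u @ x # w \<longrightarrow> set u \<inter> M \<subseteq> R}" for R
  define \<Phi> where "\<Phi> R = {x \<in> Made R. \<exists>s\<in>S. \<exists>u w. Q s = u @ x # w \<and> set w \<inter> Made R \<noteq> {}}" for R
  define R where "R = lfp \<Phi>"
  have MadeMono: "Made A \<subseteq> Made B" if "A \<subseteq> B" for A B using that unfolding Made_def by blast
  have "mono \<Phi>"
  proof (rule monoI)
    fix A B :: "'a set" assume "A \<subseteq> B"
    from MadeMono[OF this] show "\<Phi> A \<subseteq> \<Phi> B" unfolding \<Phi>_def by blast
  qed
  then have R: "R = \<Phi> R" unfolding R_def by (rule lfp_unfold)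
  let ?D = "Made R" and ?Acc = "Made R - R"
  have RD: "R \<subseteq> ?D" using R unfolding \<Phi>_def by blast
  have DM: "?D \<subseteq> M" unfolding Made_def by blast
  have Dd: "set u \<inter> M \<subseteq> R" if "x \<in> ?D" "t \<in> T" "P t = u @ x # w" for x t u w
    using that unfolding Made_def by blast
  have dP: "distinct (P t)" if "t \<in> T" for t using disjoint_pathsD[OF P that] by (simp add: dipath_def)
  have dQ: "distinct (Q s)" if "s \<in> S" for s using disjoint_pathsD[OF Q that] by (simp add: dipath_def)
  have late: "x \<in> R" if "x \<in> ?D" "s \<in> S" "Q s = u @ x # w" "y \<in> set w" "y \<in> ?D" for x s u w y
  proof -
    have "x \<in> \<Phi> R" unfolding \<Phi>_def using that by blast
    then show ?thesis using R by simp
  qed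
  have uniq: "u = u' \<and> w = w'" if "distinct l" "l = u @ x # w" "l = u' @ x # w'" for l u w u' w' and x :: 'a
  proof -
    have "x \<notin> set u" "x \<notin> set w" using that(1,2) by auto
    moreover have "u @ x # w = u' @ x # w'" using that(2,3) by simp
    ultimately show ?thesis by (simp add: append_Cons_eq_iff)
  qed
  have accP: "x = y" if acc: "t \<in> T" "x \<in> ?Acc" "y \<in> ?Acc" "x \<in> set (P t)" "y \<in> set (P t)" for x y t
  proof (rule ccontr)
    assume ne: "x \<noteq> y"
    obtain u w where u: "P t = u @ x # w" using acc(4) by (metis split_list)
    have "y \<in> set u \<or> y \<in> set w" using acc(5) u ne by auto
    then show False
    proof
      assume "y \<in> set u"
      then show False using Dd[OF _ acc(1) u] acc DM by blast
    next
      assume "y \<in> set w"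
      then obtain w1 w2 where "w = w1 @ y # w2" by (metis split_list)
      then have "P t = (u @ x # w1) @ y # w2" using u by simp
      from Dd[OF _ acc(1) this] show False using acc DM by auto
    qed
  qed
  have accQ: "\<exists>x u w. Q s = u @ x # w \<and> x \<in> ?Acc" if s: "s \<in> S" and sD: "set (Q s) \<inter> ?D \<noteq> {}" for s
  proof -
    obtain u x w where x: "Q s = u @ x # w" "x \<in> ?D" "set w \<inter> ?D = {}" using split_last_in[OF sD] by blast
    have "x \<notin> R"
    proof
      assume "x \<in> R"
      then have "x \<in> \<Phi> R" using R by simp
      then obtain s' u' w' where s': "s' \<in> S" "Q s' = u' @ x # w'" "set w' \<inter> ?D \<noteq> {}" unfolding \<Phi>_def by blast
      have "s' = s" using disjoint_paths_eq[OF Q s'(1) s, of x] s'(2) x(1) by simp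
      then have "w' = w" using uniq[OF dQ[OF s], of u x w u' w'] x(1) s'(2) by simp
      then show False using s'(3) x(3) by simp
    qed
    then show ?thesis using x by blast
  qed
  \<comment> \<open>The head of a \<open>Q\<close>-path is the first vertex of a
    \<open>P\<close>-path, so it is offered unconditionally. Hence every \<open>Q\<close>-path holds
    an accepted offer.\<close>
  have startD: "t \<in> ?D" if s: "s \<in> S" and t: "t = hd (Q s)" for s t
  proof -
    have tT: "t \<in> T" using hQ[OF s] t by simp
    have "t \<in> set (Q s)" using t dipath_ne[OF disjoint_pathsD[OF Q s]] by simp
    moreover have tP: "t \<in> set (P t)" using hP[OF tT] dipath_ne[OF disjoint_pathsD[OF P tT]] hd_in_set by metis
    ultimately have tM: "t \<in> M" using s tT unfolding M_def by blast
    have "u = []" if t': "t' \<in> T" "P t' = u @ t # w" for t' u w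
    proof (rule ccontr)
      assume u: "u \<noteq> []"
      have "t' = t" using disjoint_paths_eq[OF P t'(1) tT, of t] tP t'(2) by simp
      then have "hd u = t" using hP[OF tT] t'(2) u by simp
      then show False using dP[OF t'(1)] t'(2) hd_in_set[OF u] by auto
    qed
    then have "\<forall>t'\<in>T. \<forall>u w. P t' = u @ t # w \<longrightarrow> set u \<inter> M \<subseteq> R" by fastforce
    with tM show ?thesis unfolding Made_def by simp
  qed
  have unm: "set (P t) \<inter> M \<subseteq> R" if t: "t \<in> T" and na: "set (P t) \<inter> ?Acc = {}" for t
  proof (rule ccontr)
    assume "\<not> ?thesis"
    then have "\<exists>x\<in>set (P t). x \<in> M - R" by blast
    from split_list_first_prop[OF this] obtain u x w where
      x: "P t = u @ x # w" "x \<in> M - R" "\<forall>y\<in>set u. y \<notin> M - R" by blast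
    have "set u' \<inter> M \<subseteq> R" if t': "t' \<in> T" "P t' = u' @ x # w'" for t' u' w'
    proof -
      have "t' = t" using disjoint_paths_eq[OF P t'(1) t, of x] x(1) t'(2) by simp
      then have "u' = u" using uniq[OF dP[OF t], of u x w u' w'] x(1) t'(2) by simp
      then show ?thesis using x(3) by blast
    qed
    then have "x \<in> ?D" using x(2) unfolding Made_def by blast
    then show False using na x by auto
  qed
  let ?mat = "\<lambda>t p. \<exists>x\<in>?Acc. \<exists>s\<in>S. \<exists>u w u' w'. P t = u @ x # w \<and> Q s = u' @ x # w' \<and> p = u @ x # w' \<and> set w' \<inter> ?D = {}"
  have "\<exists>G. \<forall>t\<in>T. ?mat t (G t) \<or> set (P t) \<inter> ?Acc = {} \<and> G t = P t"
  proof (intro bchoice ballI)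
    fix t assume t: "t \<in> T"
    show "\<exists>p. ?mat t p \<or> set (P t) \<inter> ?Acc = {} \<and> p = P t"
    proof (cases "set (P t) \<inter> ?Acc = {}")
      case False
      then obtain x where x: "x \<in> set (P t)" "x \<in> ?Acc" by blast
      obtain u w where u: "P t = u @ x # w" using x(1) by (metis split_list)
      have "x \<in> M" using x(2) DM by blast
      then obtain s where s: "s \<in> S" "x \<in> set (Q s)" unfolding M_def by blast
      obtain u' w' where u': "Q s = u' @ x # w'" using s(2) by (metis split_list)
      have "set w' \<inter> ?D = {}" using late[OF _ s(1) u'] x(2) by blast
      then have "?mat t (u @ x # w')" using x(2) s(1) u u' by blast
      then show ?thesis by blast
    qed blast
  qed
  then obtain G where G: "\<And>t. t \<in> T \<Longrightarrow> ?mat t (G t) \<or> set (P t) \<inter> ?Acc = {} \<and> G t = P t" by blast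
  \<comment> \<open>A new path consists of vertices of a \<open>P\<close>-path whose meeting points
    are all offers, followed by vertices of a \<open>Q\<close>-path behind its last offer. The two
    kinds never coincide, which is the reason for disjointness.\<close>
  have parts: "(y \<in> set (P t) \<and> (y \<in> M \<longrightarrow> y \<in> ?D)) \<or>
      (\<exists>x\<in>?Acc. \<exists>s\<in>S. \<exists>u' w'. x \<in> set (P t) \<and> Q s = u' @ x # w' \<and> y \<in> set w' \<and> set w' \<inter> ?D = {})"
    if t: "t \<in> T" and y: "y \<in> set (G t)" for t y
    using G[OF t]
  proof
    assume "?mat t (G t)"
    then obtain x s u w u' w' where x: "x \<in> ?Acc" "s \<in> S" "P t = u @ x # w" "Q s = u' @ x # w'" "G t = u @ x # w'" "set w' \<inter> ?D = {}"
      by blast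
    have "y \<in> set u \<or> y = x \<or> y \<in> set w'" using y x(5) by auto
    then show ?thesis
    proof (elim disjE)
      assume "y \<in> set u"
      moreover have "set u \<inter> M \<subseteq> R" using Dd[OF _ t x(3)] x(1) by blast
      ultimately show ?thesis using x(3) RD by auto
    next
      assume "y = x" then show ?thesis using x(1,3) by auto
    next
      assume "y \<in> set w'"
      moreover have "x \<in> set (P t)" using x(3) by simp
      ultimately show ?thesis using x(1,2,4,6) by blast
    qed
  next
    assume "set (P t) \<inter> ?Acc = {} \<and> G t = P t"
    then show ?thesis using unm[OF t] y RD by auto
  qed
  have inM: "y \<in> M" if "t \<in> T" "y \<in> set (P t)" "s \<in> S" "y \<in> set (Q s)" for t s y
    using that unfolding M_def by blast
  have AB: False if "t \<in> T" "y \<in> set (P t)" "y \<in> M \<longrightarrow> y \<in> ?D" "s \<in> S" "Q s = u' @ x # w'" "y \<in> set w'" "set w' \<inter> ?D = {}"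
    for t y s u' x w'
    using inM[OF that(1,2,4)] that by auto
  have pG: "dipath E (G t) \<and> hd (G t) = t" if t: "t \<in> T" for t
    using G[OF t]
  proof
    assume "?mat t (G t)"
    then obtain x s u w u' w' where x: "x \<in> ?Acc" "s \<in> S" "P t = u @ x # w" "Q s = u' @ x # w'" "G t = u @ x # w'" "set w' \<inter> ?D = {}"
      by blast
    have 1: "dipath E (u @ [x])" using disjoint_pathsD[OF P t] x(3) dipath_prefix by metis
    have 2: "dipath E (x # w')" using disjoint_pathsD[OF Q x(2)] x(4) dipath_appendD2[of E u' "x # w'"] by simp
    have "set u \<inter> M \<subseteq> ?D" using Dd[OF _ t x(3)] x(1) RD by blast
    moreover have "y \<in> M" if "y \<in> set u" "y \<in> set w'" for y using inM[OF t _ x(2), of y] x(3,4) that by simp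
    moreover have "x \<notin> set w'" using 2 by (simp add: dipath_def)
    ultimately have "set (u @ [x]) \<inter> set (tl (x # w')) = {}" using x(6) by auto
    from dipath_concat(1)[OF 1 2 _ this] have "dipath E (G t)" using x(5) by simp
    moreover have "hd (G t) = hd (P t)" unfolding x(3,5) by (cases u) auto
    ultimately show ?thesis using hP[OF t] by simp
  next
    assume "set (P t) \<inter> ?Acc = {} \<and> G t = P t"
    then show ?thesis using disjoint_pathsD[OF P t] hP[OF t] by simp
  qed
  have "disjoint_paths E T G"
  proof (rule disjoint_pathsI)
    show "dipath E (G t)" if "t \<in> T" for t using pG[OF that] by blast
    show "t = t'" if tt: "t \<in> T" "t' \<in> T" "y \<in> set (G t)" "y \<in> set (G t')" for t t' y
      using parts[OF tt(1,3)] parts[OF tt(2,4)]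
    proof (elim disjE)
      assume "y \<in> set (P t) \<and> (y \<in> M \<longrightarrow> y \<in> ?D)" "y \<in> set (P t') \<and> (y \<in> M \<longrightarrow> y \<in> ?D)"
      then show ?thesis using disjoint_paths_eq[OF P tt(1,2)] by blast
    next
      assume "y \<in> set (P t) \<and> (y \<in> M \<longrightarrow> y \<in> ?D)"
        "\<exists>x\<in>?Acc. \<exists>s\<in>S. \<exists>u' w'. x \<in> set (P t') \<and> Q s = u' @ x # w' \<and> y \<in> set w' \<and> set w' \<inter> ?D = {}"
      then show ?thesis using AB[OF tt(1)] by blast
    next
      assume "\<exists>x\<in>?Acc. \<exists>s\<in>S. \<exists>u' w'. x \<in> set (P t) \<and> Q s = u' @ x # w' \<and> y \<in> set w' \<and> set w' \<inter> ?D = {}"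
        "y \<in> set (P t') \<and> (y \<in> M \<longrightarrow> y \<in> ?D)"
      then show ?thesis using AB[OF tt(2)] by blast
    next
      assume "\<exists>x\<in>?Acc. \<exists>s\<in>S. \<exists>u' w'. x \<in> set (P t) \<and> Q s = u' @ x # w' \<and> y \<in> set w' \<and> set w' \<inter> ?D = {}"
        "\<exists>x\<in>?Acc. \<exists>s\<in>S. \<exists>u' w'. x \<in> set (P t') \<and> Q s = u' @ x # w' \<and> y \<in> set w' \<and> set w' \<inter> ?D = {}"
      then obtain x s u w x' s' u' w' where x: "x \<in> ?Acc" "s \<in> S" "x \<in> set (P t)" "Q s = u @ x # w" "y \<in> set w" "set w \<inter> ?D = {}"
        and x': "x' \<in> ?Acc" "s' \<in> S" "x' \<in> set (P t')" "Q s' = u' @ x' # w'" "y \<in> set w'" "set w' \<inter> ?D = {}" by blast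
      have "s = s'" using disjoint_paths_eq[OF Q x(2) x'(2), of y] x(4,5) x'(4,5) by simp
      then have eq: "u @ x # w = u' @ x' # w'" using x(4) x'(4) by simp
      have "x = x'"
      proof (rule ccontr)
        assume ne: "x \<noteq> x'"
        have "x' \<in> set w \<or> x \<in> set w'" using eq ne
          by (auto simp: append_eq_append_conv2 Cons_eq_append_conv append_eq_Cons_conv)
        then show False using x(1,6) x'(1,6) by blast
      qed
      then show ?thesis using disjoint_paths_eq[OF P tt(1,2) x(3)] x'(3) by simp
    qed
  qed
  moreover have "S \<subseteq> last ` G ` T"
  proof
    fix s assume s: "s \<in> S"
    have "hd (Q s) \<in> set (Q s)" using dipath_ne[OF disjoint_pathsD[OF Q s]] by simp
    then have "set (Q s) \<inter> ?D \<noteq> {}" using startD[OF s] by blast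
    then obtain x u w where x: "Q s = u @ x # w" "x \<in> ?Acc" using accQ[OF s] by blast
    then have "x \<in> M" using DM by blast
    then obtain t where t: "t \<in> T" "x \<in> set (P t)" unfolding M_def by blast
    then have "?mat t (G t)" using G[OF t(1)] x(2) by blast
    then obtain x' s' u1 w1 u2 w2 where x': "x' \<in> ?Acc" "s' \<in> S" "P t = u1 @ x' # w1" "Q s' = u2 @ x' # w2" "G t = u1 @ x' # w2"
      by blast
    have "x' = x" using accP[OF t(1) x'(1) x(2) _ t(2)] x'(3) by simp
    then have "s' = s" using disjoint_paths_eq[OF Q x'(2) s, of x] x(1) x'(4) by simp
    then have "last (G t) = s" using hQ[OF s] x'(4,5) by simp
    then show "s \<in> last ` G ` T" using t(1) by blast
  qed
  moreover have "last ` G ` T \<subseteq> S \<union> last ` P ` T"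
  proof
    fix z assume "z \<in> last ` G ` T"
    then obtain t where t: "t \<in> T" "z = last (G t)" by blast
    from G[OF t(1)] show "z \<in> S \<union> last ` P ` T"
    proof
      assume "?mat t (G t)"
      then obtain x' s' u1 w1 u2 w2 where x': "s' \<in> S" "Q s' = u2 @ x' # w2" "G t = u1 @ x' # w2"
        by blast
      then have "z = s'" using hQ[OF x'(1)] t(2) by simp
      then show ?thesis using x'(1) by blast
    next
      assume "set (P t) \<inter> ?Acc = {} \<and> G t = P t"
      then show ?thesis using t by blast
    qed
  qed
  moreover have pset: "set (G t) \<subseteq> (\<Union>t\<in>T. set (P t)) \<union> (\<Union>s\<in>S. set (Q s))" if t: "t \<in> T" for t
  proof
    fix y assume "y \<in> set (G t)"
    from parts[OF t this] show "y \<in> (\<Union>t\<in>T. set (P t)) \<union> (\<Union>s\<in>S. set (Q s))"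
    proof (elim disjE bexE exE conjE)
      assume "y \<in> set (P t)" then show ?thesis using t by blast
    next
      fix x s u' w' assume "s \<in> S" "Q s = u' @ x # w'" "y \<in> set w'"
      then have "y \<in> set (Q s)" by simp
      then show ?thesis using \<open>s \<in> S\<close> by blast
    qed
  qed
  moreover have "\<forall>t\<in>T. set (G t) \<subseteq> (\<Union>t\<in>T. set (P t)) \<union> (\<Union>s\<in>S. set (Q s))" using pset by blast
  moreover have "\<forall>t\<in>T. hd (G t) = t" using pG by blast
  ultimately show ?thesis by (intro exI conjI)
qed

text \<open>A virtual source \<open>s\<close> offers all the vertices of \<open>C\<close> as new starting points at once.\<close>

lemma augment:
  assumes f0: "disjoint_paths H B f0" "\<forall>b\<in>B. last (f0 b) = b" and s: "s \<notin> Field H" "\<forall>b\<in>B. s \<notin> set (f0 b)"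
    and z: "z \<in> exposed (H \<union> {s} \<times> C) B f0 s" "z \<noteq> s"
  shows "\<exists>g. disjoint_paths H (insert z B) g \<and> (\<forall>b\<in>insert z B. last (g b) = b) \<and>
    (\<exists>c\<in>C. hd ` g ` insert z B = insert c (hd ` f0 ` B)) \<and> finite {b\<in>B. g b \<noteq> f0 b}"
proof -
  let ?W = "H \<union> {s} \<times> C"
  have W: "disjoint_paths ?W B f0" by (rule disjoint_paths_mono[OF f0(1)]) auto
  obtain f h where fh: "disjoint_paths ?W B f" "\<forall>b\<in>B. last (f b) = b" "dipath ?W h" "last h = z"
    "\<forall>b\<in>B. set h \<inter> set (f b) = {}" "insert (hd h) (hd ` f ` B) = insert s (hd ` f0 ` B)"
    "finite {b\<in>B. f b \<noteq> f0 b}"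
    using exposed_augment[OF W f0(2) s(2) z(1)] by (elim exE conjE) (rule that)
  have zB: "z \<notin> B" using exposed_targets[OF W f0(2) s(2)] z(1) by blast
  define k where "k = f(z := h)"
  let ?B = "insert z B"
  have kB: "k b = f b" if "b \<in> B" for b using zB that by (auto simp: k_def)
  have kz: "k z = h" by (simp add: k_def)
  have k: "disjoint_paths ?W ?B k"
  proof (rule disjoint_pathsI)
    show "dipath ?W (k i)" if "i \<in> ?B" for i using that kB kz fh(3) disjoint_pathsD[OF fh(1)] by auto
    show "i = j" if "i \<in> ?B" "j \<in> ?B" "x \<in> set (k i)" "x \<in> set (k j)" for i j x
    proof (cases "i = z"; cases "j = z")
      assume "i \<noteq> z" "j \<noteq> z"
      then show ?thesis using that kB disjoint_paths_eq[OF fh(1), of i j x] by simp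
    next
      assume a: "i = z" "j \<noteq> z"
      then have "j \<in> B" using that(2) by simp
      then show ?thesis using that(3,4) kB[of j] kz a fh(5) by auto
    next
      assume a: "i \<noteq> z" "j = z"
      then have "i \<in> B" using that(1) by simp
      then show ?thesis using that(3,4) kB[of i] kz a fh(5) by auto
    qed simp
  qed
  have kl: "last (k b) = b" if "b \<in> ?B" for b using that kB kz fh(2,4) by auto
  have "hd ` k ` B = hd ` f ` B" using kB by (simp cong: image_cong)
  then have ks: "hd ` k ` ?B = insert s (hd ` f0 ` B)" using fh(6) kz by simp
  then have "s \<in> hd ` k ` ?B" by simp
  \<comment> \<open>The path now starting at the virtual source loses that vertex and starts in
    \<open>C\<close> instead.\<close>
  then obtain b0 where b0: "b0 \<in> ?B" "hd (k b0) = s" by blast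
  have sb0: "b0 \<noteq> s"
  proof
    assume "b0 = s"
    then have "s \<in> B" using b0 z by auto
    then show False using s(2) f0 by (metis disjoint_pathsD last_in_set dipath_ne)
  qed
  obtain p where p: "k b0 = s # p" using b0 dipath_ne[OF disjoint_pathsD[OF k b0(1)]] by (metis list.collapse)
  have pne: "p \<noteq> []" using p kl[OF b0(1)] sb0 by auto
  have pp: "dipath ?W (s # p)" using disjoint_pathsD[OF k b0(1)] p by simp
  then have sp: "dipath ?W p" "(s, hd p) \<in> ?W" "s \<notin> set p" using dipath_append[of "[s]" p ?W] pne by auto
  have hp: "hd p \<in> C" using sp(2) s(1) by (auto simp: Field_def)
  let ?g = "k(b0 := p)"
  have sub: "set (?g b) \<subseteq> set (k b)" for b using p by auto
  have nos: "s \<notin> set (?g b)" if "b \<in> ?B" for b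
  proof (cases "b = b0")
    case False
    have "s \<in> set (k b0)" using p by simp
    then show ?thesis using disjoint_paths_eq[OF k that b0(1), of s] False by auto
  qed (use sp in simp)
  have "disjoint_paths H ?B ?g"
  proof (rule disjoint_pathsI)
    show "dipath H (?g i)" if "i \<in> ?B" for i
    proof (rule dipath_cong)
      show "dipath ?W (?g i)" using sp(1) disjoint_pathsD[OF k that] by simp
    qed (use nos[OF that] in auto)
    show "i = j" if "i \<in> ?B" "j \<in> ?B" "x \<in> set (?g i)" "x \<in> set (?g j)" for i j x
      using disjoint_paths_eq[OF k that(1,2), of x] that(3,4) sub by blast
  qed
  moreover have "last (?g b) = b" if "b \<in> ?B" for b using kl[OF that] kl[OF b0(1)] p pne by auto
  moreover have "hd ` ?g ` ?B = insert (hd p) (hd ` f0 ` B)"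
  proof -
    have 1: "hd ` k ` ?B = insert s (hd ` k ` (?B - {b0}))" 
    proof -
      have "k ` ?B = insert (k b0) (k ` (?B - {b0}))" using b0(1) by blast
      then show ?thesis using b0(2) by simp
    qed
    have 2: "s \<notin> hd ` k ` (?B - {b0})"
    proof
      assume "s \<in> hd ` k ` (?B - {b0})"
      then obtain b where b: "b \<in> ?B - {b0}" "hd (k b) = s" by blast
      have "s \<in> set (k b)" using b dipath_ne[OF disjoint_pathsD[OF k, of b]] hd_in_set[of "k b"] by auto
      then show False using nos[of b] b(1) by simp
    qed
    have 3: "s \<notin> hd ` f0 ` B"
    proof
      assume "s \<in> hd ` f0 ` B"
      then obtain b where "b \<in> B" "s = hd (f0 b)" by blast
      then show False using s(2) dipath_ne[OF disjoint_pathsD[OF f0(1)]] hd_in_set by metis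
    qed
    have "hd ` k ` (?B - {b0}) = hd ` f0 ` B" using 1 2 3 ks by (metis insert_ident)
    moreover have "hd ` ?g ` ?B = insert (hd p) (hd ` ?g ` (?B - {b0}))"
    proof -
      have "?g ` ?B = insert (?g b0) (?g ` (?B - {b0}))" using b0(1) by blast
      then show ?thesis by simp
    qed
    moreover have "?g ` (?B - {b0}) = k ` (?B - {b0})" by auto
    ultimately show ?thesis by simp
  qed
  moreover have "finite {b\<in>B. ?g b \<noteq> f0 b}"
    by (rule finite_subset[of _ "insert b0 {b\<in>B. f b \<noteq> f0 b}"]) (use fh(7) kB in auto)
  ultimately show ?thesis using hp by (intro exI[of _ ?g]) blast
qed

section \<open>Waves with extra targets that meet finite demands\<close>

lemma fan_dec:
  assumes f: "fan E A X2 S f" and t: "t \<in> S" "t \<notin> X1"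
  shows "\<exists>u x w. f t = u @ x # w \<and> x \<in> boundary E A X1 \<and>
       set w \<inter> (X1 \<union> boundary E A X1) = {} \<and> dipath E (x # w) \<and> last (x # w) = t \<and> set (butlast (x # w)) \<subseteq> X2"
proof -
  note F = fanD[OF f t(1)]
  have "hd (f t) \<in> set (f t)" using F(5) by simp
  then have "set (f t) \<inter> (X1 \<union> boundary E A X1) \<noteq> {}" using F(2) by (auto simp: boundary_def)
  then obtain u x w where w: "f t = u @ x # w" "x \<in> boundary E A X1" "set w \<inter> (X1 \<union> boundary E A X1) = {}" "dipath E (x # w)"
    using last_exit[OF F(1)] F(3) t(2) by metis
  then have "last (x # w) = t" "set (butlast (x # w)) \<subseteq> X2"
    using F(3,4) by (auto simp: butlast_append)
  then show ?thesis using w by blast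
qed

text \<open>An extra target of the second fan that the first region swallows can be reached only by
  a path of the first fan; hence the condition on \<open>H2 \<inter> X1\<close>.\<close>

lemma fan_join_extra:
  assumes f1: "fan E A X1 (boundary E A X1 \<union> H1) f1" "H1 \<subseteq> X1"
    and f2: "fan E A X2 (boundary E A X2 \<union> H2) f2" "H2 \<inter> X1 \<subseteq> H1"
  shows "\<exists>f. fan E A (X1 \<union> X2) (boundary E A (X1 \<union> X2) \<union> (H1 \<union> H2)) f \<and>
    (\<forall>t\<in>(boundary E A X1 - X2) \<union> H1. f t = f1 t)"
proof -
  let ?T = "boundary E A X1" and ?S = "boundary E A X2 \<union> H2"
  have "\<exists>f. fan E A (X1 \<union> X2) ((?T - X2) \<union> H1 \<union> (?T \<inter> ?S) \<union> (?S - X1 - ?T)) f \<and>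
     (\<forall>t\<in>(?T - X2) \<union> H1 \<union> (?T \<inter> ?S). f t = f1 t) \<and>
     (\<forall>t\<in>?S - X1 - ?T. \<exists>u x w. f2 t = u @ x # w \<and> x \<in> ?T \<and> f t = f1 x @ w)"
    by (rule fan_compose[OF f1 fan_dpf[OF f2(1)] fanD(6)[OF f2(1)] fan_dec[OF f2(1)]])
  then obtain f where f: "fan E A (X1 \<union> X2) ((?T - X2) \<union> H1 \<union> (?T \<inter> ?S) \<union> (?S - X1 - ?T)) f"
    "\<forall>t\<in>(?T - X2) \<union> H1 \<union> (?T \<inter> ?S). f t = f1 t"
    by (elim exE conjE) (rule that)
  have "boundary E A (X1 \<union> X2) \<union> (H1 \<union> H2) \<subseteq> (?T - X2) \<union> H1 \<union> (?T \<inter> ?S) \<union> (?S - X1 - ?T)"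
  proof
    fix t assume "t \<in> boundary E A (X1 \<union> X2) \<union> (H1 \<union> H2)"
    then consider "t \<in> boundary E A (X1 \<union> X2)" | "t \<in> H1" | "t \<in> H2" by blast
    then show "t \<in> (?T - X2) \<union> H1 \<union> (?T \<inter> ?S) \<union> (?S - X1 - ?T)"
    proof cases
      case 1 then show ?thesis by (auto simp: boundary_def)
    next
      case 3 then show ?thesis using f2(2) by blast
    qed blast
  qed
  then show ?thesis using fan_subset[OF f(1)] f(2) by (intro exI[of _ f]) blast
qed

text \<open>Demands inside \<open>G\<close> are met already, so an unmet one contains a vertex
  outside \<open>G\<close>, hence outside \<open>X\<close>. Joining in the order \<open>X\<close>,
  \<open>Y\<close>, \<open>X1\<close> preserves the old paths and the new target, and
  \<open>Y\<close> swallows no target of \<open>H1\<close>, because \<open>Y \<inter> Z\<close> lies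
  in a demand that \<open>H1\<close> misses.\<close>

lemma hitting_extend:
  assumes b: "fan E A X (boundary E A X \<union> H) f" "H \<subseteq> X \<inter> Z" "X \<inter> Z \<subseteq> G"
    and dem: "\<And>D x. D \<in> \<D> \<Longrightarrow> x \<in> D \<Longrightarrow> \<exists>X f. fan E A X (boundary E A X \<union> {x}) f \<and> x \<in> X \<and> X \<inter> Z \<subseteq> D"
    and DZ: "\<And>D. D \<in> \<D> \<Longrightarrow> D \<subseteq> Z" and sat: "\<And>D. D \<in> \<D> \<Longrightarrow> D \<subseteq> G \<Longrightarrow> D \<inter> H \<noteq> {}"
    and GG: "G \<subseteq> G'" and fin: "finite \<U>" and U: "\<U> \<subseteq> {D \<in> \<D>. D \<subseteq> G'}"
  shows "\<exists>X' H' f'. fan E A X' (boundary E A X' \<union> H') f' \<and> H' \<subseteq> X' \<inter> Z \<and> X' \<inter> Z \<subseteq> G' \<and> X \<subseteq> X' \<and>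
    H \<subseteq> H' \<and> H' \<inter> X = H \<and> (\<forall>t\<in>(boundary E A X - X') \<union> H. f' t = f t) \<and> (\<forall>D\<in>\<U>. D \<inter> H' \<noteq> {})"
  using fin U
proof (induction \<U>)
  case empty
  show ?case by (rule exI[of _ X], rule exI[of _ H], rule exI[of _ f]) (use b GG in auto)
next
  case (insert D \<U>)
  then obtain X1 H1 f1 where I: "fan E A X1 (boundary E A X1 \<union> H1) f1" "H1 \<subseteq> X1 \<inter> Z" "X1 \<inter> Z \<subseteq> G'" "X \<subseteq> X1"
    "H \<subseteq> H1" "H1 \<inter> X = H" "\<forall>t\<in>(boundary E A X - X1) \<union> H. f1 t = f t" "\<forall>D\<in>\<U>. D \<inter> H1 \<noteq> {}"
    by auto
  have D: "D \<in> \<D>" "D \<subseteq> G'" using insert.prems by auto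
  show ?case
  proof (cases "D \<inter> H1 = {}")
    case False
    then have "\<forall>D\<in>insert D \<U>. D \<inter> H1 \<noteq> {}" using I(8) by simp
    with I(1-7) show ?thesis by (intro exI conjI)
  next
    case True
    then have "\<not> D \<subseteq> G" using sat[OF D(1)] I(5) by blast
    then obtain x where x: "x \<in> D" "x \<notin> G" by blast
    obtain Y g where Y: "fan E A Y (boundary E A Y \<union> {x}) g" "x \<in> Y" "Y \<inter> Z \<subseteq> D" using dem[OF D(1) x(1)] by blast
    have xZ: "x \<in> Z" using DZ[OF D(1)] x(1) by blast
    have xX: "x \<notin> X" using x(2) b(3) xZ by blast
    obtain f2 where f2: "fan E A (X \<union> Y) (boundary E A (X \<union> Y) \<union> (H \<union> {x})) f2" "\<forall>t\<in>(boundary E A X - Y) \<union> H. f2 t = f t"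
      using fan_join_extra[OF b(1) _ Y(1)] b(2) xX by blast
    have "H1 \<inter> (X \<union> Y) \<subseteq> H \<union> {x}" using I(2,6) Y(3) True by blast
    moreover have "H \<union> {x} \<subseteq> X \<union> Y" using b(2) Y(2) by blast
    ultimately obtain f3 where f3: "fan E A (X \<union> Y \<union> X1) (boundary E A (X \<union> Y \<union> X1) \<union> (H \<union> {x} \<union> H1)) f3"
      "\<forall>t\<in>(boundary E A (X \<union> Y) - X1) \<union> (H \<union> {x}). f3 t = f2 t"
      using fan_join_extra[OF f2(1) _ I(1)] by blast
    have ft: "f3 t = f t" if "t \<in> (boundary E A X - (X \<union> Y \<union> X1)) \<union> H" for t
    proof -
      have "t \<in> (boundary E A (X \<union> Y) - X1) \<union> (H \<union> {x})" "t \<in> (boundary E A X - Y) \<union> H" using that by (auto simp: boundary_def)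
      then show ?thesis using f2(2) f3(2) by metis
    qed
    have "H \<union> {x} \<union> H1 \<subseteq> (X \<union> Y \<union> X1) \<inter> Z" using b(2) Y(2) xZ I(2) by blast
    moreover have "(X \<union> Y \<union> X1) \<inter> Z \<subseteq> G'" using b(3) GG Y(3) D(2) I(3) by blast
    moreover have "(H \<union> {x} \<union> H1) \<inter> X = H" using I(6) xX b(2) by blast
    moreover have "\<forall>D\<in>insert D \<U>. D \<inter> (H \<union> {x} \<union> H1) \<noteq> {}" using I(8) x(1) by blast
    moreover have "X \<subseteq> X \<union> Y \<union> X1" "H \<subseteq> H \<union> {x} \<union> H1" by blast+
    moreover have "\<forall>t\<in>(boundary E A X - (X \<union> Y \<union> X1)) \<union> H. f3 t = f t" using ft by blast
    ultimately show ?thesis using f3(1) by (intro exI conjI)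
  qed
qed

text \<open>A demand \<open>D\<close> is met at a vertex \<open>x\<close> outside the finite set \<open>G\<close> to which the waves used so far are
  confined, so earlier choices are never swallowed by a later wave.\<close>

lemma hitting:
  assumes Z: "countable Z" and fin: "\<And>D. D \<in> \<D> \<Longrightarrow> finite D \<and> D \<subseteq> Z \<and> D \<noteq> {}"
    and dem: "\<And>D x. D \<in> \<D> \<Longrightarrow> x \<in> D \<Longrightarrow> \<exists>X f. fan E A X (boundary E A X \<union> {x}) f \<and> x \<in> X \<and> X \<inter> Z \<subseteq> D"
  shows "\<exists>X H f. fan E A X (boundary E A X \<union> H) f \<and> H \<subseteq> X \<inter> Z \<and> X \<inter> Z \<subseteq> \<Union>\<D> \<and> (\<forall>D\<in>\<D>. D \<inter> H \<noteq> {})"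
proof (cases "\<D> = {}")
  case True
  have "fan E A {} (boundary E A {} \<union> {}) (\<lambda>t. [t])" using trivial_wave[of E A "{}"] by (simp add: wave_def)
  then show ?thesis using True by (intro exI[of _ "{}"] exI[of _ "\<lambda>t. [t]"]) auto
next
  case False
  have "\<D> \<subseteq> {D. finite D \<and> D \<subseteq> Z}" using fin by blast
  then have cD: "countable \<D>" using countable_Collect_finite_subset[OF Z] countable_subset by blast
  define d where "d = from_nat_into \<D>"
  have d: "d n \<in> \<D>" for n unfolding d_def by (rule from_nat_into[OF False])
  define inv where "inv = (\<lambda>(X, H, f, G). fan E A X (boundary E A X \<union> H) f \<and> H \<subseteq> X \<inter> Z \<and> X \<inter> Z \<subseteq> G \<and>
    finite G \<and> G \<subseteq> \<Union>\<D> \<and> (\<forall>D\<in>\<D>. D \<subseteq> G \<longrightarrow> D \<inter> H \<noteq> {}))"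
  let ?P = "\<lambda>(n::nat). inv"
  let ?Q = "\<lambda>n (X, H, f, G) (X', H', f', G'). X \<subseteq> X' \<and> H \<subseteq> H' \<and> H' \<inter> X = H \<and>
     (\<forall>t\<in>(boundary E A X - X') \<union> H. f' t = f t) \<and> d n \<subseteq> G'"
  have "\<exists>F. \<forall>n. ?P n (F n) \<and> ?Q n (F n) (F (Suc n))"
  proof (rule dependent_nat_choice)
    have "fan E A {} (boundary E A {} \<union> {}) (\<lambda>t. [t])" using trivial_wave[of E A "{}"] by (simp add: wave_def)
    moreover have "\<forall>D\<in>\<D>. D \<subseteq> {} \<longrightarrow> D \<inter> {} \<noteq> {}" using fin by blast
    ultimately have "inv ({}, {}, \<lambda>t. [t], {})" unfolding inv_def prod.case by (intro conjI) auto
    then show "\<exists>s. ?P 0 s" by blast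
    show "\<exists>s'. ?P (Suc n) s' \<and> ?Q n s s'" if sn: "?P n s" for s n
    proof -
      obtain X H f G where s: "s = (X, H, f, G)" by (metis prod_cases4)
      have I: "fan E A X (boundary E A X \<union> H) f" "H \<subseteq> X \<inter> Z" "X \<inter> Z \<subseteq> G" "finite G" "G \<subseteq> \<Union>\<D>"
        "\<forall>D\<in>\<D>. D \<subseteq> G \<longrightarrow> D \<inter> H \<noteq> {}"
        using sn unfolding s inv_def prod.case by simp_all
      let ?G = "G \<union> d n"
      have fG: "finite ?G" using I(4) fin[OF d] by simp
      \<comment> \<open>Enlarging the finite set by one demand may bring other demands inside it,
        but only finitely many; all of them are met before the next stage.\<close>
      have "{D \<in> \<D>. D \<subseteq> ?G} \<subseteq> Pow ?G" by blast
      then have fU: "finite {D \<in> \<D>. D \<subseteq> ?G}" using fG by (meson finite_Pow_iff finite_subset)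
      have "\<exists>X' H' f'. fan E A X' (boundary E A X' \<union> H') f' \<and> H' \<subseteq> X' \<inter> Z \<and> X' \<inter> Z \<subseteq> ?G \<and> X \<subseteq> X' \<and>
        H \<subseteq> H' \<and> H' \<inter> X = H \<and> (\<forall>t\<in>(boundary E A X - X') \<union> H. f' t = f t) \<and> (\<forall>D\<in>{D \<in> \<D>. D \<subseteq> ?G}. D \<inter> H' \<noteq> {})"
        by (rule hitting_extend[OF I(1-3) dem _ _ _ fU order_refl]) (use fin I(6) in auto)
      then obtain X' H' f' where s': "fan E A X' (boundary E A X' \<union> H') f'" "H' \<subseteq> X' \<inter> Z" "X' \<inter> Z \<subseteq> ?G" "X \<subseteq> X'"
        "H \<subseteq> H'" "H' \<inter> X = H" "\<forall>t\<in>(boundary E A X - X') \<union> H. f' t = f t" "\<forall>D\<in>{D \<in> \<D>. D \<subseteq> ?G}. D \<inter> H' \<noteq> {}"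
        by (elim exE conjE) (rule that)
      have "?G \<subseteq> \<Union>\<D>" using I(5) d by blast
      then have "inv (X', H', f', ?G)" unfolding inv_def prod.case using s'(1,2,3,8) fG by blast
      then show ?thesis using s'(4-7) unfolding s by (intro exI[of _ "(X', H', f', ?G)"]) auto
    qed
  qed
  then obtain F where F': "\<forall>n. ?P n (F n) \<and> ?Q n (F n) (F (Suc n))" by (elim exE) (rule that)
  have F: "inv (F n)" "?Q n (F n) (F (Suc n))" for n
    using F'[rule_format, of n] by (rule conjunct1, rule conjunct2)
  define X H f G where "X n = fst (F n)" and "H n = fst (snd (F n))" and "f n = fst (snd (snd (F n)))"
    and "G n = snd (snd (snd (F n)))" for n
  have FF: "F n = (X n, H n, f n, G n)" for n by (simp add: X_def H_def f_def G_def)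
  have I: "fan E A (X n) (boundary E A (X n) \<union> H n) (f n)" "H n \<subseteq> X n \<inter> Z" "X n \<inter> Z \<subseteq> G n" "G n \<subseteq> \<Union>\<D>"
    "\<forall>D\<in>\<D>. D \<subseteq> G n \<longrightarrow> D \<inter> H n \<noteq> {}" for n
    using F(1)[of n] unfolding FF inv_def prod.case by simp_all
  have Q: "X n \<subseteq> X (Suc n)" "H n \<subseteq> H (Suc n)" "H (Suc n) \<inter> X n = H n"
    "\<forall>t\<in>(boundary E A (X n) - X (Suc n)) \<union> H n. f (Suc n) t = f n t" "d n \<subseteq> G (Suc n)" for n
    using F(2)[of n] unfolding FF prod.case by simp_all
  have Xm: "X n \<subseteq> X m" if "n \<le> m" for n m by (rule lift_Suc_mono_le[of X, OF Q(1) that])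
  have Hm: "H n \<subseteq> H m" if "n \<le> m" for n m by (rule lift_Suc_mono_le[of H, OF Q(2) that])
  let ?X = "\<Union>n. X n" and ?H = "\<Union>n. H n"
  \<comment> \<open>A boundary vertex that joins \<open>?H\<close> at a later stage may get a
    different path then, so it is left out until that stage.\<close>
  define S where "S n = (boundary E A (X n) - ?H) \<union> H n" for n
  have "\<exists>g. fan E A ?X {t. \<exists>n. \<forall>m\<ge>n. t \<in> S m} g \<and> (\<forall>n t. (\<forall>m\<ge>n. t \<in> S m) \<longrightarrow> g t = f n t)"
  proof (rule fan_limit)
    show "fan E A (X n) (S n) (f n)" for n by (rule fan_subset[OF I(1)]) (auto simp: S_def)
    show "X n \<subseteq> X (Suc n)" for n by (rule Q(1))
    show "f (Suc n) t = f n t" if "t \<in> S n" "t \<in> S (Suc n)" for n t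
    proof -
      have "t \<in> (boundary E A (X n) - X (Suc n)) \<union> H n" using that by (auto simp: S_def boundary_def)
      then show ?thesis using Q(4) by blast
    qed
  qed
  then obtain g where g: "fan E A ?X {t. \<exists>n. \<forall>m\<ge>n. t \<in> S m} g" by blast
  have "boundary E A ?X \<union> ?H \<subseteq> {t. \<exists>n. \<forall>m\<ge>n. t \<in> S m}"
  proof
    fix t assume "t \<in> boundary E A ?X \<union> ?H"
    then show "t \<in> {t. \<exists>n. \<forall>m\<ge>n. t \<in> S m}"
    proof
      assume "t \<in> ?H"
      then obtain n where "t \<in> H n" by blast
      then have "\<forall>m\<ge>n. t \<in> S m" using Hm by (auto simp: S_def)
      then show ?thesis by blast
    next
      assume t: "t \<in> boundary E A ?X"
      then have nX: "t \<notin> X n" for n by (auto simp: boundary_def)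
      have nH: "t \<notin> ?H" using nX I(2) by blast
      obtain n where "t \<in> A \<union> E `` X n" using t by (auto simp: boundary_def)
      then have "t \<in> A \<union> E `` X m" if "m \<ge> n" for m using Xm[OF that] by blast
      then have "t \<in> S m" if "m \<ge> n" for m using nX nH that by (auto simp: S_def boundary_def)
      then show ?thesis by blast
    qed
  qed
  then have "fan E A ?X (boundary E A ?X \<union> ?H) g" using fan_subset[OF g] by blast
  moreover have "?H \<subseteq> ?X \<inter> Z" using I(2) by blast
  moreover have "?X \<inter> Z \<subseteq> \<Union>\<D>" using I(3,4) by blast
  moreover have dd: "D \<inter> ?H \<noteq> {}" if D: "D \<in> \<D>" for D
  proof -
    obtain n where "d n = D" using from_nat_into_surj[OF cD D] unfolding d_def by blast
    then have "D \<inter> H (Suc n) \<noteq> {}" using I(5)[of "Suc n"] Q(5)[of n] D by blast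
    then show ?thesis by blast
  qed
  moreover have "\<forall>D\<in>\<D>. D \<inter> ?H \<noteq> {}" using dd by blast
  ultimately show ?thesis by (intro exI conjI)
qed

section \<open>Rooted digraphs and finite deviation\<close>

text \<open>Gives access to the position of an edge on the path, which is needed when a deletion
  must be checked against particular edges of a fixed linkage.\<close>

lemma dipath_steps:
  assumes "dipath E p" "\<And>q a b w. p = q @ a # b # w \<Longrightarrow> (a, b) \<in> E \<Longrightarrow> (a, b) \<in> E'"
  shows "dipath E' p"
  using assms
proof (induction p)
  case (Cons x p)
  show ?case
  proof (cases "p = []")
    case False
    then obtain y p' where p: "p = y # p'" by (cases p) auto
    have 1: "dipath E p" "(x, y) \<in> E" "x \<notin> set p" using Cons.prems(1) dipath_append[of "[x]" p E] p by auto
    have "dipath E' p"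
    proof (rule Cons.IH[OF 1(1)])
      fix q a b w assume "p = q @ a # b # w" "(a, b) \<in> E"
      then show "(a, b) \<in> E'" using Cons.prems(2)[of "x # q" a b w] by simp
    qed
    moreover have "(x, y) \<in> E'" using Cons.prems(2)[of "[]" x y p'] p 1(2) by simp
    ultimately show ?thesis using dipath_append[of "[x]" p E'] p 1(3) by auto
  qed simp
qed (simp add: dipath_def)

lemma path_leave:
  assumes "hd p \<in> X" "last p \<notin> X" "p \<noteq> []"
  shows "\<exists>q a b w. p = q @ a # b # w \<and> set (q @ [a]) \<subseteq> X \<and> b \<notin> X"
proof -
  have "\<exists>x\<in>set p. x \<notin> X" using assms by auto
  from split_list_first_prop[OF this] obtain u b w where u: "p = u @ b # w" "b \<notin> X" "\<forall>y\<in>set u. \<not> y \<notin> X" by blast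
  have "u \<noteq> []" using u assms(1) by auto
  then obtain q a where "u = q @ [a]" by (metis append_butlast_last_id)
  then show ?thesis using u by (intro exI[of _ q] exI[of _ a] exI[of _ b] exI[of _ w]) auto
qed

lemma path_enter:
  assumes "hd p \<notin> X" "last p \<in> X" "p \<noteq> []"
  shows "\<exists>q a b w. p = q @ a # b # w \<and> a \<notin> X \<and> b \<in> X"
  using path_leave[of p "- X"] assms by auto

lemma split_entry_unique:
  assumes "p @ x # q = p' @ x' # q'" "set q \<subseteq> X" "set q' \<subseteq> X" "x \<notin> X" "x' \<notin> X"
  shows "x = x'"
proof -
  have "rev q @ x # rev p = rev q' @ x' # rev p'" using arg_cong[OF assms(1), of rev] by simp
  then show ?thesis using split_exit_unique[of "rev q" x "rev p" "rev q'" x' "rev p'" X] assms by simp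
qed

lemma reindex_rev:
  assumes g: "disjoint_paths E I g"
  shows "\<exists>f. disjoint_paths (E\<inverse>) (hd ` g ` I) f \<and> (\<forall>i\<in>I. f (hd (g i)) = rev (g i))"
proof -
  define e where "e n = (SOME i. i \<in> I \<and> hd (g i) = n)" for n
  have e: "e (hd (g i)) = i" if i: "i \<in> I" for i
  proof -
    have "\<exists>j. j \<in> I \<and> hd (g j) = hd (g i)" using i by blast
    then have j: "e (hd (g i)) \<in> I \<and> hd (g (e (hd (g i)))) = hd (g i)" unfolding e_def by (rule someI_ex)
    have hs: "hd (g j) \<in> set (g j)" if "j \<in> I" for j using dipath_ne[OF disjoint_pathsD[OF g that]] by simp
    show ?thesis using disjoint_paths_eq[OF g, of "e (hd (g i))" i "hd (g i)"] j i hs by metis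
  qed
  let ?f = "\<lambda>n. rev (g (e n))"
  have "disjoint_paths (E\<inverse>) (hd ` g ` I) ?f"
  proof (rule disjoint_pathsI)
    fix n assume "n \<in> hd ` g ` I"
    then obtain i where i: "i \<in> I" "n = hd (g i)" by blast
    then show "dipath (E\<inverse>) (?f n)" using e[OF i(1)] disjoint_pathsD[OF g i(1)] by simp
  next
    fix n m x assume "n \<in> hd ` g ` I" "m \<in> hd ` g ` I" and x: "x \<in> set (?f n)" "x \<in> set (?f m)"
    then obtain i j where ij: "i \<in> I" "n = hd (g i)" "j \<in> I" "m = hd (g j)" by blast
    have "x \<in> set (g i)" "x \<in> set (g j)" using x e[OF ij(1)] e[OF ij(3)] ij by auto
    then have "i = j" using disjoint_paths_eq[OF g ij(1,3)] by blast
    then show "n = m" using ij by simp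
  qed
  then show ?thesis using e by (intro exI[of _ ?f]) simp
qed

text \<open>Mirror image of the augmentation: the search runs against the edges from a virtual sink
  \<open>v\<close>, and \<open>C\<close> contains the candidates for a new end vertex. Edges into
  the region come from the last vertices of linked paths outside it.\<close>

lemma augment_rev:
  assumes g: "disjoint_paths H B g" "\<And>s. s \<in> B \<Longrightarrow> last (g s) = s" and v: "v \<notin> Field H" "\<And>s. s \<in> B \<Longrightarrow> v \<notin> set (g s)"
  obtains X where "v \<in> X" "X \<inter> hd ` g ` B = {}"
    "\<And>x y. x \<in> X \<Longrightarrow> (y, x) \<in> H \<or> x = v \<and> y \<in> C \<Longrightarrow> y \<notin> X \<Longrightarrow> \<exists>s\<in>B. \<exists>p q. g s = p @ y # q \<and> set q \<subseteq> X"
    "\<And>z. z \<in> X \<Longrightarrow> z \<noteq> v \<Longrightarrow> \<exists>c\<in>C. \<exists>k. disjoint_paths H (insert c B) k \<and> (\<forall>s\<in>insert c B. last (k s) = s) \<and>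
       hd ` k ` insert c B = insert z (hd ` g ` B) \<and> finite {s\<in>B. k s \<noteq> g s}"
proof -
  let ?B = "hd ` g ` B" and ?H = "H\<inverse>"
  obtain f where f: "disjoint_paths ?H ?B f" "\<And>s. s \<in> B \<Longrightarrow> f (hd (g s)) = rev (g s)" using reindex_rev[OF g(1)] by blast
  have gne: "g s \<noteq> []" if "s \<in> B" for s using dipath_ne[OF disjoint_pathsD[OF g(1) that]] .
  have lf: "\<forall>b\<in>?B. last (f b) = b" using f(2) gne by (auto simp: last_rev)
  have hf: "hd (f (hd (g s))) = s" if "s \<in> B" for s using f(2)[OF that] g(2)[OF that] gne[OF that] by (simp add: hd_rev)
  have vf: "\<forall>b\<in>?B. v \<notin> set (f b)" using f(2) v(2) by auto
  have vH: "v \<notin> Field ?H" using v(1) by simp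
  let ?W = "?H \<union> {v} \<times> C"
  have W: "disjoint_paths ?W ?B f" by (rule disjoint_paths_mono[OF f(1)]) auto
  let ?X = "exposed ?W ?B f v"
  show thesis
  proof (rule that[of ?X])
    show "v \<in> ?X" by (rule exposed_source[OF W lf vf])
    show "?X \<inter> ?B = {}" by (rule exposed_targets[OF W lf vf])
    fix x y assume x: "x \<in> ?X" "(y, x) \<in> H \<or> x = v \<and> y \<in> C" "y \<notin> ?X"
    then have "(x, y) \<in> ?W" by auto
    from exposed_boundary[OF W lf vf x(1) this x(3)] obtain s p q where
      s: "s \<in> B" "f (hd (g s)) = p @ y # q" "set p \<subseteq> ?X" by blast
    then have "g s = rev q @ y # rev p" using f(2)[OF s(1)] by (metis rev_rev_ident rev_append rev.simps(2) append_assoc append_Cons append_Nil)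
    then show "\<exists>s\<in>B. \<exists>p q. g s = p @ y # q \<and> set q \<subseteq> ?X" using s by (metis set_rev)
  next
    fix z assume z: "z \<in> ?X" "z \<noteq> v"
    obtain G c where G: "disjoint_paths ?H (insert z ?B) G" "\<forall>b\<in>insert z ?B. last (G b) = b" "c \<in> C"
      "hd ` G ` insert z ?B = insert c (hd ` f ` ?B)" "finite {b\<in>?B. G b \<noteq> f b}"
      using augment[OF f(1) lf vH vf z] by blast
    have hfB: "hd ` f ` ?B = B" using hf by (force simp: image_image)
    obtain k where k: "disjoint_paths (?H\<inverse>) (hd ` G ` insert z ?B) k" "\<And>n. n \<in> insert z ?B \<Longrightarrow> k (hd (G n)) = rev (G n)"
      using reindex_rev[OF G(1)] by blast
    have im: "hd ` G ` insert z ?B = insert c B" using G(4) hfB by simp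
    have Gne: "G n \<noteq> []" if "n \<in> insert z ?B" for n using dipath_ne[OF disjoint_pathsD[OF G(1) that]] .
    have kn: "\<exists>n\<in>insert z ?B. s = hd (G n) \<and> k s = rev (G n) \<and> hd (k s) = n \<and> last (k s) = s" if "s \<in> insert c B" for s
    proof -
      have "s \<in> hd ` G ` insert z ?B" using that im by simp
      then obtain n where n: "n \<in> insert z ?B" "s = hd (G n)" by blast
      then show ?thesis using k(2)[OF n(1)] G(2) Gne[OF n(1)] by (intro bexI[of _ n]) (auto simp: hd_rev last_rev)
    qed
    have "hd ` k ` insert c B = insert z ?B"
    proof
      show "hd ` k ` insert c B \<subseteq> insert z ?B" using kn by blast
      show "insert z ?B \<subseteq> hd ` k ` insert c B"
      proof
        fix n assume n: "n \<in> insert z ?B"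
        have "hd (G n) \<in> insert c B" using im n by blast
        moreover have "last (G n) = n" using G(2) n by (rule bspec)
        then have "hd (k (hd (G n))) = n" using k(2)[OF n] Gne[OF n] by (simp add: hd_rev)
        ultimately show "n \<in> hd ` k ` insert c B" by force
      qed
    qed
    moreover have "{s\<in>B. k s \<noteq> g s} \<subseteq> (\<lambda>n. hd (f n)) ` {b\<in>?B. G b \<noteq> f b}"
    proof
      fix s assume s: "s \<in> {s\<in>B. k s \<noteq> g s}"
      let ?n = "hd (g s)"
      have "G ?n \<noteq> f ?n"
      proof
        assume e: "G ?n = f ?n"
        then have "hd (G ?n) = s" using hf s by simp
        then have "k s = rev (f ?n)" using k(2)[of ?n] s e by auto
        then show False using f(2)[of s] s by simp
      qed
      then show "s \<in> (\<lambda>n. hd (f n)) ` {b\<in>?B. G b \<noteq> f b}" using s hf[of s] by (intro image_eqI[of _ _ ?n]) auto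
    qed
    moreover have "disjoint_paths H (insert c B) k" using k(1) im by simp
    ultimately show "\<exists>c\<in>C. \<exists>k. disjoint_paths H (insert c B) k \<and> (\<forall>s\<in>insert c B. last (k s) = s) \<and>
       hd ` k ` insert c B = insert z ?B \<and> finite {s\<in>B. k s \<noteq> g s}"
      using kn G(3,5) by (meson finite_imageI finite_subset)
  qed
qed

lemma disjoint_paths_limit:
  assumes f: "\<And>n. disjoint_paths E (Z n) (f n)" and Z: "\<And>n. Z n \<subseteq> Z (Suc n)"
    and ag: "\<And>n z. z \<in> Z n \<Longrightarrow> f (Suc n) z = f n z"
  shows "\<exists>g. disjoint_paths E (\<Union>n. Z n) g \<and> (\<forall>n. \<forall>z\<in>Z n. g z = f n z)"
proof -
  have Zm: "Z n \<subseteq> Z m" if "n \<le> m" for n m by (rule lift_Suc_mono_le[of Z, OF Z that])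
  have st: "f m z = f n z" if "z \<in> Z n" "n \<le> m" for n m z
    using that(2)
  proof (induction m rule: dec_induct)
    case (step k)
    have "z \<in> Z k" using Zm[OF step(1)] that(1) by blast
    then show ?case using ag step.IH by simp
  qed simp
  define k where "k z = (SOME n. z \<in> Z n)" for z
  have g: "f (k z) z = f n z" if "z \<in> Z n" for n z
  proof -
    have kz: "z \<in> Z (k z)" unfolding k_def using that by (rule someI)
    show ?thesis using st[OF kz, of "max n (k z)"] st[OF that, of "max n (k z)"] by simp
  qed
  have "disjoint_paths E (\<Union>n. Z n) (\<lambda>z. f (k z) z)"
  proof (rule disjoint_pathsI)
    fix i assume "i \<in> (\<Union>n. Z n)"
    then obtain n where n: "i \<in> Z n" by blast
    then show "dipath E (f (k i) i)" using g[OF n] disjoint_pathsD[OF f n] by simp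
  next
    fix i j x assume "i \<in> (\<Union>n. Z n)" "j \<in> (\<Union>n. Z n)" and x: "x \<in> set (f (k i) i)" "x \<in> set (f (k j) j)"
    then obtain n m where n: "i \<in> Z n" "j \<in> Z m" by blast
    let ?k = "max n m"
    have k: "i \<in> Z ?k" "j \<in> Z ?k" using Zm[of n ?k] Zm[of m ?k] n by auto
    have "x \<in> set (f ?k i)" "x \<in> set (f ?k j)" using x g[OF k(1)] g[OF k(2)] by simp_all
    then show "i = j" by (rule disjoint_paths_eq[OF f k])
  qed
  then show ?thesis using g by (intro exI[of _ "\<lambda>z. f (k z) z"]) blast
qed

section \<open>The rooted setting and its linkage conditions\<close>

locale rooted =
  fixes V :: "'a set" and E :: "('a \<times> 'a) set" and r :: 'a and F :: "('a \<times> 'a) set" and R :: "'a \<Rightarrow> 'a \<Rightarrow> 'a list"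
    and N :: "'a set"
  assumes EV: "E \<subseteq> V \<times> V" and irr: "(x, x) \<notin> E" and cV: "countable V" and rV: "r \<in> V"
    and FE: "F \<subseteq> E" and N_def: "N = {n. (r, n) \<in> E}" and rF: "(r, n) \<in> E \<Longrightarrow> (r, n) \<in> F"
begin

text \<open>The root is left out: edges from it are never deleted, and the path formed by such a
  single edge is treated separately.\<close>

definition tails :: "('a \<times> 'a) set \<Rightarrow> 'a \<Rightarrow> 'a set" where
  "tails H u = {x. (x, u) \<in> H \<and> x \<noteq> r}"

text \<open>An \<open>(r, u)\<close>-path-system with both ends stripped; \<open>S\<close>
  corresponds to its terminal edges. Stripping turns internal disjointness into plain
  disjointness.\<close>

definition linkage :: "('a \<times> 'a) set \<Rightarrow> 'a \<Rightarrow> 'a set \<Rightarrow> ('a \<Rightarrow> 'a list) \<Rightarrow> bool" where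
  "linkage H u S g \<longleftrightarrow> disjoint_paths (del H {r, u}) S g \<and> (\<forall>s\<in>S. hd (g s) \<in> N - {u} \<and> last (g s) = s)"

text \<open>Only finitely many paths may deviate from the reference linkage \<open>R u\<close>; this keeps counting
  arguments meaningful for infinite families.\<close>

definition near_linkable :: "('a \<times> 'a) set \<Rightarrow> 'a \<Rightarrow> 'a set \<Rightarrow> bool" where
  "near_linkable H u S \<longleftrightarrow> (\<exists>g. linkage H u S g \<and> finite {b \<in> tails F u. g b \<noteq> R u b})"

text \<open>Restricting to finite \<open>J\<close> lets the condition pass to unions of chains and
  leaves countably many requirements. It still suffices, since a full linkage at \<open>u\<close> is
  constructed only when \<open>u\<close> is treated.\<close>

definition quasi_flame :: "('a \<times> 'a) set \<Rightarrow> 'a \<Rightarrow> bool" where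
  "quasi_flame H u \<longleftrightarrow> (\<forall>J. finite J \<longrightarrow> J \<subseteq> tails H u \<longrightarrow> near_linkable H u (tails F u \<union> J))"

definition trim :: "('a \<times> 'a) set \<Rightarrow> 'a \<Rightarrow> 'a set \<Rightarrow> ('a \<times> 'a) set" where
  "trim H v B = {e \<in> H. snd e = v \<longrightarrow> fst e = r \<or> fst e \<in> B}"

lemma trim_mem [simp]: "(x, y) \<in> trim H v B \<longleftrightarrow> (x, y) \<in> H \<and> (y = v \<longrightarrow> x = r \<or> x \<in> B)"
  by (auto simp: trim_def)

lemma trim_mono: "B \<subseteq> B' \<Longrightarrow> trim H v B \<subseteq> trim H v B'"
  by (auto simp: trim_def)

lemma trim_subset: "trim H v B \<subseteq> H"
  by (auto simp: trim_def)

lemma rN: "r \<notin> N"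
  using irr by (simp add: N_def)

lemma NV: "N \<subseteq> V"
  using EV by (auto simp: N_def)

lemma linkageD:
  assumes "linkage H u S g" "s \<in> S"
  shows "dipath H (g s)" "hd (g s) \<in> N" "hd (g s) \<noteq> u" "last (g s) = s" "set (g s) \<inter> {r, u} = {}" "g s \<noteq> []"
    "dipath (del H {r, u}) (g s)" "s \<in> set (g s)" "hd (g s) \<in> set (g s)"
proof -
  have *: "dipath (del H {r, u}) (g s)" using assms by (auto simp: linkage_def disjoint_paths_def)
  then show "dipath (del H {r, u}) (g s)" .
  show "dipath H (g s)" using * by (rule dipath_delD)
  show 1: "hd (g s) \<in> N" "hd (g s) \<noteq> u" and l: "last (g s) = s" using assms by (auto simp: linkage_def)
  show "set (g s) \<inter> {r, u} = {}" using dipath_del_avoid[OF *] 1 rN by auto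
  show ne: "g s \<noteq> []" using * by (rule dipath_ne)
  show "s \<in> set (g s)" using ne l last_in_set by metis
  show "hd (g s) \<in> set (g s)" using ne by simp
qed

lemma linkage_eq: "linkage H u S g \<Longrightarrow> s \<in> S \<Longrightarrow> t \<in> S \<Longrightarrow> x \<in> set (g s) \<Longrightarrow> x \<in> set (g t) \<Longrightarrow> s = t"
  unfolding linkage_def using disjoint_paths_eq by metis

lemma linkageI:
  assumes "\<And>s. s \<in> S \<Longrightarrow> dipath H (g s) \<and> hd (g s) \<in> N \<and> last (g s) = s \<and> r \<notin> set (g s) \<and> u \<notin> set (g s)"
    and "\<And>s t x. s \<in> S \<Longrightarrow> t \<in> S \<Longrightarrow> x \<in> set (g s) \<Longrightarrow> x \<in> set (g t) \<Longrightarrow> s = t"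
  shows "linkage H u S g"
  unfolding linkage_def
proof (intro conjI disjoint_pathsI ballI)
  show "dipath (del H {r, u}) (g s)" if "s \<in> S" for s using assms(1)[OF that] by (intro dipath_delI) auto
  show "hd (g s) \<in> N - {u}" if "s \<in> S" for s
    using assms(1)[OF that] hd_in_set[of "g s"] dipath_ne[of H "g s"] by auto
qed (use assms in blast)+

lemma linkage_mono: "linkage H u S g \<Longrightarrow> H \<subseteq> H' \<Longrightarrow> linkage H' u S g"
  using disjoint_paths_mono[of "del H {r, u}" S g "del H' {r, u}"] del_mono[of H H' "{r, u}" "{r, u}"]
  unfolding linkage_def by auto

lemma linkage_sub: "linkage H u S g \<Longrightarrow> S' \<subseteq> S \<Longrightarrow> linkage H u S' g"
  using disjoint_paths_subset[of "del H {r, u}" S g S'] unfolding linkage_def by auto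

lemma near_linkable_mono: "near_linkable H u S \<Longrightarrow> H \<subseteq> H' \<Longrightarrow> near_linkable H' u S"
  unfolding near_linkable_def using linkage_mono by blast

lemma near_linkable_sub: "near_linkable H u S \<Longrightarrow> S' \<subseteq> S \<Longrightarrow> near_linkable H u S'"
  unfolding near_linkable_def using linkage_sub by blast

lemma tails_trim: "u \<noteq> v \<Longrightarrow> tails (trim H v B) u = tails H u"
  by (auto simp: tails_def)

text \<open>Disjoint paths visit \<open>v\<close> at most once altogether, so a whole linkage
  depends on at most one of the edges into \<open>v\<close> coming from \<open>B\<close>.\<close>

lemma trim_split:
  assumes g: "linkage (trim H v B) u S g"
  shows "linkage (trim H v {}) u S g \<or> (\<exists>x\<in>B. \<exists>s\<in>S. \<exists>q p. g s = q @ x # v # p \<and> linkage (trim H v {x}) u S g)"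
proof (cases "\<exists>s\<in>S. \<exists>q x p. g s = q @ x # v # p")
  case True
  then obtain s q x p where s: "s \<in> S" "g s = q @ x # v # p" by blast
  have xB: "x \<in> B" using dipath_edge[of "del (trim H v B) {r, u}" q x v p] linkageD(7)[OF g s(1)] s(2) by auto
  have "linkage (trim H v {x}) u S g"
  proof (rule linkageI)
    fix t assume t: "t \<in> S"
    have "dipath (trim H v {x}) (g t)"
    proof (rule dipath_steps[OF linkageD(1)[OF g t]])
      fix q' a b w assume ab: "g t = q' @ a # b # w" "(a, b) \<in> trim H v B"
      have "a = x" if "b = v"
      proof -
        have "t = s" using linkage_eq[OF g t s(1), of v] ab(1) s(2) that by simp
        then have e: "(q' @ [a]) @ v # w = (q @ [x]) @ v # p" using ab(1) s(2) that by simp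
        have "distinct (g s)" using linkageD(1)[OF g s(1)] by (simp add: dipath_def)
        then have "v \<notin> set (q @ [x])" "v \<notin> set p" using s(2) by auto
        then have "q @ [x] = q' @ [a]" using e append_Cons_eq_iff[of v "q @ [x]" p "q' @ [a]" w] by auto
        then show ?thesis by simp
      qed
      then show "(a, b) \<in> trim H v {x}" using ab(2) by auto
    qed
    then show "dipath (trim H v {x}) (g t) \<and> hd (g t) \<in> N \<and> last (g t) = t \<and> r \<notin> set (g t) \<and> u \<notin> set (g t)"
      using linkageD[OF g t] by auto
  qed (rule linkage_eq[OF g])
  then show ?thesis using xB s by blast
next
  case False
  have "linkage (trim H v {}) u S g"
  proof (rule linkageI)
    fix t assume t: "t \<in> S"
    have "dipath (trim H v {}) (g t)"
    proof (rule dipath_steps[OF linkageD(1)[OF g t]])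
      fix q' a b w assume ab: "g t = q' @ a # b # w" "(a, b) \<in> trim H v B"
      then have "b \<noteq> v" using False t by blast
      then show "(a, b) \<in> trim H v {}" using ab(2) by auto
    qed
    then show "dipath (trim H v {}) (g t) \<and> hd (g t) \<in> N \<and> last (g t) = t \<and> r \<notin> set (g t) \<and> u \<notin> set (g t)"
      using linkageD[OF g t] by auto
  qed (rule linkage_eq[OF g])
  then show ?thesis by blast
qed

text \<open>The paths to be kept (ending in \<open>Z\<close>) occupy finitely many vertices, and more candidates than that
  cannot all be blocked.\<close>

lemma one_more:
  assumes q: "quasi_flame Q v" and K: "finite K" "K \<subseteq> tails Q v" and S: "S = tails F v \<union> K"
    and g: "linkage Q v S g" "finite {b \<in> tails F v. g b \<noteq> R v b}" and Z: "finite Z" "Z \<subseteq> S"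
    and X: "infinite D" "D \<subseteq> tails Q v"
  shows "\<exists>x\<in>D. \<exists>g'. linkage Q v (insert x S) g' \<and> (\<forall>z\<in>Z. g' z = g z) \<and> finite {b \<in> tails F v. g' b \<noteq> R v b}"
proof (cases "D \<inter> S = {}")
  case False
  then obtain x where "x \<in> D" "insert x S = S" by blast
  then show ?thesis using g by metis
next
  case DS: True
  let ?U = "\<Union>z\<in>Z. set (g z)"
  have fU: "finite ?U" using Z(1) by simp
  have "infinite (D - ?U)" using X(1) fU by simp
  then obtain C where C: "finite C" "card C = card ?U + 1" "C \<subseteq> D - ?U"
    using infinite_arbitrarily_large[OF \<open>infinite (D - ?U)\<close>, of "card ?U + 1"] by (elim exE conjE) (rule that)
  let ?H = "del Q ({r, v} \<union> ?U)" and ?B = "S - Z"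
  have gU: "set (g s) \<inter> ?U = {}" if "s \<in> ?B" for s
    using linkage_eq[OF g(1), of s] that Z(2) by blast
  have gB: "disjoint_paths ?H ?B g"
  proof (rule disjoint_pathsI)
    show "dipath ?H (g s)" if "s \<in> ?B" for s
      using dipath_delI[OF linkageD(1)[OF g(1)], of s "{r, v} \<union> ?U"] linkageD(5)[OF g(1), of s] gU[OF that] that by blast
    show "s = t" if "s \<in> ?B" "t \<in> ?B" "x \<in> set (g s)" "x \<in> set (g t)" for s t x
      using linkage_eq[OF g(1)] that by blast
  qed
  have lB: "last (g s) = s" if "s \<in> ?B" for s using linkageD(4)[OF g(1)] that by blast
  have vB: "v \<notin> set (g s)" if "s \<in> ?B" for s using linkageD(5)[OF g(1), of s] that by blast
  have vF: "v \<notin> Field ?H" by (auto simp: Field_def)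
  obtain X where
    X: "v \<in> X" "X \<inter> hd ` g ` ?B = {}"
    "\<And>x y. x \<in> X \<Longrightarrow> (y, x) \<in> ?H \<or> x = v \<and> y \<in> C \<Longrightarrow> y \<notin> X \<Longrightarrow> \<exists>s\<in>?B. \<exists>p q. g s = p @ y # q \<and> set q \<subseteq> X"
    "\<And>z. z \<in> X \<Longrightarrow> z \<noteq> v \<Longrightarrow> \<exists>c\<in>C. \<exists>k. disjoint_paths ?H (insert c ?B) k \<and> (\<forall>s\<in>insert c ?B. last (k s) = s) \<and>
       hd ` k ` insert c ?B = insert z (hd ` g ` ?B) \<and> finite {s\<in>?B. k s \<noteq> g s}"
    by (rule augment_rev[OF gB lB vF vB, of C]) (assumption | rule that)+
  show ?thesis
  proof (cases "\<exists>z\<in>X. z \<in> N - {v} - ?U")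
    case True
    then obtain z where z: "z \<in> X" "z \<in> N" "z \<noteq> v" "z \<notin> ?U" by blast
    obtain c k where c: "c \<in> C" and k: "disjoint_paths ?H (insert c ?B) k" "\<forall>s\<in>insert c ?B. last (k s) = s"
       "hd ` k ` insert c ?B = insert z (hd ` g ` ?B)" "finite {s\<in>?B. k s \<noteq> g s}" using X(4)[OF z(1,3)] by blast
    define g' where "g' s = (if s \<in> Z then g s else k s)" for s
    have cS: "c \<notin> S" using c C(3) DS by blast
    have kp: "dipath Q (k s) \<and> hd (k s) \<in> N \<and> set (k s) \<inter> ({r, v} \<union> ?U) = {}" if "s \<in> insert c ?B" for s
    proof -
      have "hd (k s) \<in> insert z (hd ` g ` ?B)" using k(3) that by blast
      then have h: "hd (k s) \<in> N \<and> hd (k s) \<notin> {r, v} \<union> ?U"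
      proof
        assume "hd (k s) \<in> hd ` g ` ?B"
        then obtain t where t: "t \<in> ?B" "hd (k s) = hd (g t)" by blast
        then show ?thesis using linkageD(2,5,9)[OF g(1), of t] gU[OF t(1)] by auto
      qed (use z rN in auto)
      then have "set (k s) \<inter> ({r, v} \<union> ?U) = {}" using dipath_del_avoid[OF disjoint_pathsD[OF k(1) that]] by blast
      then show ?thesis using h dipath_delD[OF disjoint_pathsD[OF k(1) that]] by blast
    qed
    have mem: "s \<in> Z \<and> s \<in> S \<or> s \<notin> Z \<and> s \<in> insert c ?B" if "s \<in> insert c S" for s using that Z(2) cS by blast
    have "linkage Q v (insert c S) g'"
    proof (rule linkageI)
      fix s assume "s \<in> insert c S"
      from mem[OF this] show "dipath Q (g' s) \<and> hd (g' s) \<in> N \<and> last (g' s) = s \<and> r \<notin> set (g' s) \<and> v \<notin> set (g' s)"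
      proof
        assume "s \<in> Z \<and> s \<in> S"
        then show ?thesis using linkageD[OF g(1), of s] by (auto simp: g'_def)
      next
        assume s: "s \<notin> Z \<and> s \<in> insert c ?B"
        then show ?thesis using kp[of s] k(2) by (auto simp: g'_def)
      qed
    next
      fix s t x assume "s \<in> insert c S" "t \<in> insert c S" and x: "x \<in> set (g' s)" "x \<in> set (g' t)"
      from mem[OF this(1)] mem[OF this(2)] show "s = t"
      proof (elim disjE conjE)
        assume "s \<in> Z" "t \<in> Z" "s \<in> S" "t \<in> S"
        then show ?thesis using linkage_eq[OF g(1), of s t x] x by (simp add: g'_def)
      next
        assume "s \<in> Z" "t \<notin> Z" "t \<in> insert c ?B"
        then show ?thesis using kp[of t] x by (auto simp: g'_def)
      next
        assume "t \<in> Z" "s \<notin> Z" "s \<in> insert c ?B"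
        then show ?thesis using kp[of s] x by (auto simp: g'_def)
      next
        assume "s \<notin> Z" "t \<notin> Z" "s \<in> insert c ?B" "t \<in> insert c ?B"
        then show ?thesis using disjoint_paths_eq[OF k(1), of s t x] x by (simp add: g'_def)
      qed
    qed
    moreover have "finite {b \<in> tails F v. g' b \<noteq> R v b}"
    proof (rule finite_subset)
      show "{b \<in> tails F v. g' b \<noteq> R v b} \<subseteq> {b \<in> tails F v. g b \<noteq> R v b} \<union> {s\<in>?B. k s \<noteq> g s}"
        using S by (auto simp: g'_def)
    qed (use g(2) k(4) in simp)
    moreover have "\<forall>z\<in>Z. g' z = g z" by (simp add: g'_def)
    ultimately show ?thesis using c C(3) by blast
  next
    case False
    \<comment> \<open>If the search is stuck, compare with a linkage \<open>k\<close> of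
      \<open>S \<union> C\<close>. Of its paths that are new or differ from \<open>g\<close>,
      \<open>card Bd + card ?U + 1\<close> in number, at most \<open>card ?U\<close> meet
      \<open>?U\<close>. Each of the others passes through the last vertex outside \<open>X\<close>
      of some path of \<open>g\<close>, and only the \<open>card Bd\<close> altered paths can
      provide one.\<close>
    have "finite (K \<union> C)" "K \<union> C \<subseteq> tails Q v" using K C(1,3) X assms(10) by auto
    then have "near_linkable Q v (tails F v \<union> (K \<union> C))" using q unfolding quasi_flame_def by blast
    then obtain k where k: "linkage Q v (S \<union> C) k" "finite {b \<in> tails F v. k b \<noteq> R v b}"
      unfolding near_linkable_def S by (auto simp: Un_assoc)
    define ext where "ext y s \<longleftrightarrow> s \<in> ?B \<and> (\<exists>p q. g s = p @ y # q \<and> set q \<subseteq> X \<and> y \<notin> X)" for y s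
    have ext_uniq: "y = y'" if "ext y s" "ext y' s" for y y' s
    proof -
      obtain p q p' q' where "g s = p @ y # q" "set q \<subseteq> X" "y \<notin> X" "g s = p' @ y' # q'" "set q' \<subseteq> X" "y' \<notin> X"
        using \<open>ext y s\<close> \<open>ext y' s\<close> unfolding ext_def by blast
      then show ?thesis using split_entry_unique[of p y q p' y' q' X] by simp
    qed
    have XN: "n \<notin> X" if "n \<in> N" "n \<noteq> v" "n \<notin> ?U" for n using False that by blast
    have hit: "\<exists>s y. ext y s \<and> y \<in> set (k c)" if c: "c \<in> ?B \<union> C" and cU: "set (k c) \<inter> ?U = {}" for c
    proof -
      have cS: "c \<in> S \<union> C" using c by blast
      note L = linkageD[OF k(1) cS]
      have "set (k c) \<inter> ({r, v} \<union> ?U) = {}" using L(5) cU by (simp only: Int_Un_distrib Un_empty)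
      then have kH: "dipath ?H (k c)" by (rule dipath_delI[OF L(1)])
      show ?thesis
      proof (cases "c \<in> X")
        case True
        have "hd (k c) \<notin> X" using XN L(2,3,9) cU by blast
        then obtain p a b w where w: "k c = p @ a # b # w" "a \<notin> X" "b \<in> X" using path_enter[of "k c" X] L(4,6) True by metis
        have "(a, b) \<in> ?H" using dipath_edge[of ?H p a b w] kH w(1) by simp
        then have "\<exists>s. ext a s" using X(3)[OF w(3), of a] w(2) unfolding ext_def by blast
        then show ?thesis using w(1) by auto
      next
        case cX: False
        show ?thesis
        proof (cases "c \<in> C")
          case True
          then have "\<exists>s. ext c s" using X(3)[OF X(1), of c] cX unfolding ext_def by blast
          then show ?thesis using L(8) by blast
        next
          case False
          then have cB: "c \<in> ?B" using c by blast
          have "g c = butlast (g c) @ c # []" using lB[OF cB] linkageD(6)[OF g(1), of c] cB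
            by (metis DiffD1 append_butlast_last_id)
          then have "ext c c" unfolding ext_def using cB cX by (metis empty_subsetI list.set(1))
          then show ?thesis using L(8) by blast
        qed
      qed
    qed
    define Bd where "Bd = {s\<in>?B. k s \<noteq> g s}"
    have "Bd \<subseteq> {b \<in> tails F v. g b \<noteq> R v b} \<union> {b \<in> tails F v. k b \<noteq> R v b} \<union> K"
      unfolding Bd_def S by auto
    then have fBd: "finite Bd" using g(2) k(2) K(1) finite_subset by blast
    let ?CC = "Bd \<union> C" and ?Bad = "{c \<in> Bd \<union> C. set (k c) \<inter> ?U \<noteq> {}}"
    have CS: "C \<inter> S = {}" using C(3) DS by blast
    have cCC: "card ?CC = card Bd + card ?U + 1"
    proof -
      have "Bd \<inter> C = {}" using CS unfolding Bd_def by blast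
      then show ?thesis using card_Un_disjoint[OF fBd C(1)] C(2) by simp
    qed
    have cBad: "card ?Bad \<le> card ?U"
    proof -
      have "\<forall>c\<in>?Bad. \<exists>x. x \<in> set (k c) \<and> x \<in> ?U" by blast
      then obtain h where h: "\<forall>c\<in>?Bad. h c \<in> set (k c) \<and> h c \<in> ?U" by (rule bchoice[THEN exE])
      have "inj_on h ?Bad"
      proof (rule inj_onI)
        fix a b assume ab: "a \<in> ?Bad" "b \<in> ?Bad" "h a = h b"
        have "h a \<in> set (k a)" using bspec[OF h ab(1)] by (rule conjunct1)
        moreover have "h b \<in> set (k b)" using bspec[OF h ab(2)] by (rule conjunct1)
        then have "h a \<in> set (k b)" by (simp only: ab(3))
        moreover have "a \<in> S \<union> C" "b \<in> S \<union> C" using ab unfolding Bd_def by auto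
        ultimately show "a = b" using linkage_eq[OF k(1)] by blast
      qed
      moreover have "h ` ?Bad \<subseteq> ?U" using h by blast
      ultimately show ?thesis using card_inj_on_le fU by blast
    qed
    have "\<forall>c\<in>?CC - ?Bad. \<exists>s. \<exists>y. ext y s \<and> y \<in> set (k c)"
    proof
      fix c assume "c \<in> ?CC - ?Bad"
      then have "c \<in> ?B \<union> C" "set (k c) \<inter> ?U = {}" unfolding Bd_def by blast+
      from hit[OF this] show "\<exists>s. \<exists>y. ext y s \<and> y \<in> set (k c)" .
    qed
    then obtain \<phi> where \<phi>: "\<forall>c\<in>?CC - ?Bad. \<exists>y. ext y (\<phi> c) \<and> y \<in> set (k c)" by (rule bchoice[THEN exE])
    have "inj_on \<phi> (?CC - ?Bad)"
    proof (rule inj_onI)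
      fix a b assume ab: "a \<in> ?CC - ?Bad" "b \<in> ?CC - ?Bad" "\<phi> a = \<phi> b"
      obtain y where y: "ext y (\<phi> a)" "y \<in> set (k a)" using \<phi> ab(1) by blast
      obtain y' where y': "ext y' (\<phi> b)" "y' \<in> set (k b)" using \<phi> ab(2) by blast
      have "y = y'" using ext_uniq y(1) y'(1) ab(3) by simp
      moreover have "a \<in> S \<union> C" "b \<in> S \<union> C" using ab unfolding Bd_def by auto
      ultimately show "a = b" using linkage_eq[OF k(1)] y(2) y'(2) by blast
    qed
    moreover have "\<phi> ` (?CC - ?Bad) \<subseteq> Bd"
    proof
      fix s assume "s \<in> \<phi> ` (?CC - ?Bad)"
      then obtain c where c: "c \<in> ?CC - ?Bad" "s = \<phi> c" by blast
      obtain y where y: "ext y s" "y \<in> set (k c)" using \<phi> c by blast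
      have sB: "s \<in> ?B" and ys: "y \<in> set (g s)" using y(1) unfolding ext_def by auto
      show "s \<in> Bd"
      proof (rule ccontr)
        \<comment> \<open>An unaltered path belongs to \<open>k\<close> too, so no other path of
          \<open>k\<close> can meet it.\<close>
        assume "s \<notin> Bd"
        then have e: "k s = g s" using sB unfolding Bd_def by blast
        have "c \<in> S \<union> C" "s \<in> S \<union> C" using c(1) sB unfolding Bd_def by auto
        then have "s = c" using linkage_eq[OF k(1)] y(2) ys e by metis
        then show False using c(1) \<open>s \<notin> Bd\<close> sB CS by blast
      qed
    qed
    ultimately have "card (?CC - ?Bad) \<le> card Bd" using card_inj_on_le fBd by blast
    moreover have "card ?CC - card ?Bad \<le> card (?CC - ?Bad)"
    proof -
      have "?Bad \<subseteq> ?CC" "finite ?Bad" using fBd C(1) by auto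
      then show ?thesis using card_Diff_subset by fastforce
    qed
    ultimately have False using cCC cBad by linarith
    then show ?thesis ..
  qed
qed

text \<open>The paths ending in \<open>Z\<close> are frozen, and every vertex of
  \<open>tails F v\<close> enters \<open>Z\<close> at some stage, which yields the limit. Infinitely
  many paths may have been altered by then, so only a linkage is claimed, without closeness to
  \<open>R v\<close>.\<close>

lemma link_hitting_infinite:
  fixes d :: "nat \<Rightarrow> 'a set"
  assumes FQ: "F \<subseteq> Q" and q: "quasi_flame Q v" and J: "finite J" "J \<subseteq> tails Q v"
    and d: "\<And>n. d n \<subseteq> tails Q v"
  shows "\<exists>A g. tails F v \<union> J \<subseteq> A \<and> A \<subseteq> tails Q v \<and> linkage Q v A g \<and> (\<forall>n. infinite (d n) \<longrightarrow> d n \<inter> A \<noteq> {})"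
proof -
  let ?T = "tails F v"
  have FT: "?T \<subseteq> tails Q v" using FQ by (auto simp: tails_def)
  have cT: "countable (insert r ?T)"
  proof (rule countable_subset[OF _ cV])
    show "insert r ?T \<subseteq> V" using FE EV rV by (auto simp: tails_def)
  qed
  \<comment> \<open>The root merely makes the enumerated set nonempty; it is not in
    \<open>?T\<close>.\<close>
  define a where "a = from_nat_into (insert r ?T)"
  define inv where "inv = (\<lambda>(K, g, Z). finite K \<and> J \<subseteq> K \<and> K \<subseteq> tails Q v \<and> linkage Q v (?T \<union> K) g \<and>
    finite {b \<in> ?T. g b \<noteq> R v b} \<and> finite Z \<and> K \<subseteq> Z \<and> Z \<subseteq> ?T \<union> K)"
  let ?P = "\<lambda>(n::nat). inv"
  let ?Q = "\<lambda>n (K, g, Z) (K', g', Z'). K \<subseteq> K' \<and> Z \<subseteq> Z' \<and> (\<forall>z\<in>Z. g' z = g z) \<and> (a n \<in> ?T \<longrightarrow> a n \<in> Z') \<and>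
    (infinite (d n) \<longrightarrow> d n \<inter> (?T \<union> K') \<noteq> {})"
  have "\<exists>S. \<forall>n. ?P n (S n) \<and> ?Q n (S n) (S (Suc n))"
  proof (rule dependent_nat_choice)
    have "near_linkable Q v (?T \<union> J)" using q J unfolding quasi_flame_def by blast
    then obtain g where "linkage Q v (?T \<union> J) g" "finite {b \<in> ?T. g b \<noteq> R v b}" unfolding near_linkable_def by blast
    then have "inv (J, g, J)" using J unfolding inv_def by auto
    then show "\<exists>s. ?P 0 s" by blast
    show "\<exists>s'. ?P (Suc n) s' \<and> ?Q n s s'" if sn: "?P n s" for s n
    proof -
      obtain K g Z where s: "s = (K, g, Z)" by (metis prod_cases3)
      have I: "finite K" "J \<subseteq> K" "K \<subseteq> tails Q v" "linkage Q v (?T \<union> K) g" "finite {b \<in> ?T. g b \<noteq> R v b}" "finite Z"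
        "K \<subseteq> Z" "Z \<subseteq> ?T \<union> K"
        using sn unfolding s inv_def prod.case by simp_all
      have "\<exists>K' g'. finite K' \<and> K \<subseteq> K' \<and> K' \<subseteq> tails Q v \<and> linkage Q v (?T \<union> K') g' \<and> finite {b \<in> ?T. g' b \<noteq> R v b} \<and>
        (\<forall>z\<in>Z. g' z = g z) \<and> (infinite (d n) \<longrightarrow> d n \<inter> (?T \<union> K') \<noteq> {})"
      proof (cases "infinite (d n)")
        case True
        obtain x g' where x: "x \<in> d n" "linkage Q v (insert x (?T \<union> K)) g'" "\<forall>z\<in>Z. g' z = g z"
          "finite {b \<in> ?T. g' b \<noteq> R v b}"
          using one_more[OF q I(1,3) refl I(4-6,8) True d] by blast
        have "insert x (?T \<union> K) = ?T \<union> insert x K" by blast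
        then show ?thesis using x I(1,3) d[of n] by (intro exI[of _ "insert x K"] exI[of _ g']) auto
      next
        case False
        then show ?thesis using I by (intro exI[of _ K] exI[of _ g]) auto
      qed
      then obtain K' g' where K': "finite K'" "K \<subseteq> K'" "K' \<subseteq> tails Q v" "linkage Q v (?T \<union> K') g'"
        "finite {b \<in> ?T. g' b \<noteq> R v b}" "\<forall>z\<in>Z. g' z = g z" "infinite (d n) \<longrightarrow> d n \<inter> (?T \<union> K') \<noteq> {}"
        by (elim exE conjE) (rule that)
      define Z' where "Z' = Z \<union> K' \<union> ({a n} \<inter> ?T)"
      have "inv (K', g', Z')" unfolding inv_def prod.case using K' I by (auto simp: Z'_def)
      then show ?thesis using K' unfolding s by (intro exI[of _ "(K', g', Z')"]) (auto simp: Z'_def)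
    qed
  qed
  then obtain S where S': "\<forall>n. ?P n (S n) \<and> ?Q n (S n) (S (Suc n))" by (elim exE) (rule that)
  have S: "inv (S n)" "?Q n (S n) (S (Suc n))" for n
    using S'[rule_format, of n] by (rule conjunct1, rule conjunct2)
  define K g Z where "K n = fst (S n)" and "g n = fst (snd (S n))" and "Z n = snd (snd (S n))" for n
  have SS: "S n = (K n, g n, Z n)" for n by (simp add: K_def g_def Z_def)
  have I: "J \<subseteq> K n" "K n \<subseteq> tails Q v" "linkage Q v (?T \<union> K n) (g n)" "K n \<subseteq> Z n" "Z n \<subseteq> ?T \<union> K n" for n
    using S(1)[of n] unfolding SS inv_def prod.case by simp_all
  have Q: "Z n \<subseteq> Z (Suc n)" "\<forall>z\<in>Z n. g (Suc n) z = g n z" "a n \<in> ?T \<longrightarrow> a n \<in> Z (Suc n)"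
     "infinite (d n) \<longrightarrow> d n \<inter> (?T \<union> K (Suc n)) \<noteq> {}" for n
    using S(2)[of n] unfolding SS prod.case by simp_all
  have "\<exists>h. disjoint_paths (del Q {r, v}) (\<Union>n. Z n) h \<and> (\<forall>n. \<forall>z\<in>Z n. h z = g n z)"
  proof (rule disjoint_paths_limit)
    show "disjoint_paths (del Q {r, v}) (Z n) (g n)" for n using linkage_sub[OF I(3) I(5)] unfolding linkage_def by blast
  qed (use Q in auto)
  then obtain h where h: "disjoint_paths (del Q {r, v}) (\<Union>n. Z n) h" "\<And>n z. z \<in> Z n \<Longrightarrow> h z = g n z" by blast
  let ?A = "\<Union>n. Z n"
  have TA: "?T \<subseteq> ?A"
  proof
    fix t assume t: "t \<in> ?T"
    then obtain n where "a n = t" using from_nat_into_surj[OF cT, of t] unfolding a_def by blast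
    then show "t \<in> ?A" using Q(3) t by blast
  qed
  have KA: "K n \<subseteq> ?A" for n using I(4) by blast
  have "linkage Q v ?A h"
    unfolding linkage_def
  proof (intro conjI ballI)
    fix z assume "z \<in> ?A"
    then obtain n where n: "z \<in> Z n" by blast
    then have "z \<in> ?T \<union> K n" using I(5) by blast
    from linkageD[OF I(3) this] show "hd (h z) \<in> N - {v}" "last (h z) = z" using h(2)[OF n] by auto
  qed (rule h(1))
  moreover have "?A \<subseteq> tails Q v" using I(2,5) FT by blast
  moreover have "?T \<union> J \<subseteq> ?A" using TA KA[of 0] I(1)[of 0] by blast
  moreover have "d n \<inter> ?A \<noteq> {}" if "infinite (d n)" for n using Q(4)[of n] that TA KA[of "Suc n"] by blast
  ultimately show ?thesis by (intro exI[of _ ?A] exI[of _ h]) simp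
qed

section \<open>In-neighbours that repair a failing requirement\<close>

definition repairs :: "('a \<times> 'a) set \<Rightarrow> 'a \<Rightarrow> 'a set \<Rightarrow> 'a \<Rightarrow> 'a set \<Rightarrow> 'a set" where
  "repairs Q v A u J = {x \<in> tails Q v. near_linkable (trim Q v (insert x A)) u (tails F u \<union> J)}"

lemma fan_add:
  assumes K: "disjoint_paths H K G" and hK: "\<And>c. c \<in> K \<Longrightarrow> hd (G c) \<in> A"
    and S: "\<And>t. t \<in> S \<Longrightarrow> t \<notin> X \<and> (t \<in> A \<or> (\<exists>c\<in>K. \<exists>p q. G c = p @ t # q \<and> set p \<subseteq> X))"
    and \<pi>: "dipath H \<pi>" "hd \<pi> \<in> A" "last \<pi> = x" "set \<pi> \<subseteq> X" and dj: "\<And>c. c \<in> K \<Longrightarrow> set \<pi> \<inter> set (G c) = {}"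
  shows "\<exists>f. fan H A X (S \<union> {x}) f"
proof -
  have "\<exists>g. fan H A X S g \<and> (\<forall>t\<in>S. set (g t) \<subseteq> insert t (\<Union>b\<in>K. set (G b)))"
    by (rule exit_fan[OF K]) (use S hK in blast)
  then obtain g where g: "fan H A X S g" "\<forall>t\<in>S. set (g t) \<subseteq> insert t (\<Union>b\<in>K. set (G b))" by blast
  have dg: "set \<pi> \<inter> set (g t) = {}" if "t \<in> S" for t
    using g(2) S[OF that] dj \<pi>(4) that by blast
  have xX: "x \<in> X" using \<pi>(3,4) dipath_ne[OF \<pi>(1)] last_in_set by blast
  then have xS: "x \<notin> S" using S by blast
  have "fan H A X (S \<union> {x}) (g(x := \<pi>))"
    unfolding fan_def
  proof (intro conjI disjoint_pathsI ballI)
    show "dipath H ((g(x := \<pi>)) i)" if "i \<in> S \<union> {x}" for i using that \<pi>(1) fanD(1)[OF g(1)] by auto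
    show "hd ((g(x := \<pi>)) i) \<in> A" if "i \<in> S \<union> {x}" for i using that \<pi>(2) fanD(2)[OF g(1)] by auto
    show "last ((g(x := \<pi>)) i) = i" if "i \<in> S \<union> {x}" for i using that \<pi>(3) fanD(3)[OF g(1)] by auto
    show "set (butlast ((g(x := \<pi>)) i)) \<subseteq> X" if "i \<in> S \<union> {x}" for i
      using that \<pi>(4) set_butlast_sub[of \<pi>] fanD(4)[OF g(1)] by (cases "i = x") auto
    show "i = j" if ij: "i \<in> S \<union> {x}" "j \<in> S \<union> {x}" "y \<in> set ((g(x := \<pi>)) i)" "y \<in> set ((g(x := \<pi>)) j)" for i j y
    proof (cases "i = x"; cases "j = x")
      assume "i \<noteq> x" "j \<noteq> x" then show ?thesis using disjoint_paths_eq[OF fan_dpf[OF g(1)], of i j y] ij by simp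
    next
      assume a: "i = x" "j \<noteq> x" then have "j \<in> S" using ij by blast
      then show ?thesis using dg[of j] a ij(3,4) by auto
    next
      assume a: "i \<noteq> x" "j = x" then have "i \<in> S" using ij by blast
      then show ?thesis using dg[of i] a ij(3,4) by auto
    qed simp
  qed
  then show ?thesis by blast
qed

text \<open>The part of the web that can be reached from unused sources once the path through the edge
  \<open>(x, v)\<close> is dropped. If its boundary contains \<open>u\<close> itself, stability supplies a larger linkage, and
  counting shows that this one also crosses the rest of the boundary exactly once per path.\<close>

lemma demand_wave:
  assumes v: "v \<noteq> r" and u: "u \<noteq> r" "u \<noteq> v" and A: "A \<subseteq> tails Q v" and J: "finite J" "J \<subseteq> tails Q u"
    and bad: "\<not> near_linkable (trim Q v A) u (tails F u \<union> J)" and x: "x \<in> repairs Q v A u J"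
    and stable: "\<And>y. y \<in> tails Q u \<Longrightarrow> repairs Q v A u J \<subseteq> repairs Q v A u (insert y J)"
  shows "\<exists>X f. fan (del Q {r, v}) (N - {v}) X (boundary (del Q {r, v}) (N - {v}) X \<union> {x}) f \<and> x \<in> X \<and>
    X \<inter> tails Q v \<subseteq> repairs Q v A u J"
proof -
  let ?T = "tails F u"
  define I where "I = ?T \<union> J"
  have xv: "(x, v) \<in> Q" "x \<noteq> r" using x by (auto simp: repairs_def tails_def)
  obtain g0 where g0: "linkage (trim Q v (insert x A)) u I g0" "finite {b \<in> ?T. g0 b \<noteq> R u b}"
    using x unfolding repairs_def near_linkable_def I_def by blast
  have nobad: "\<not> linkage (trim Q v A) u I g0" using bad g0(2) unfolding near_linkable_def I_def by blast
  have "\<exists>z\<in>I. \<exists>q0 p0. g0 z = q0 @ x # v # p0 \<and> linkage (trim Q v {x}) u I g0"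
    using trim_split[OF g0(1)]
  proof
    assume "linkage (trim Q v {}) u I g0"
    then show ?thesis using nobad linkage_mono trim_mono[of "{}" A Q v] by blast
  next
    assume "\<exists>x'\<in>insert x A. \<exists>s\<in>I. \<exists>q p. g0 s = q @ x' # v # p \<and> linkage (trim Q v {x'}) u I g0"
    then obtain x' s q p where x': "x' \<in> insert x A" "s \<in> I" "g0 s = q @ x' # v # p" "linkage (trim Q v {x'}) u I g0" by blast
    have "x' \<notin> A"
    proof
      assume "x' \<in> A"
      then have "trim Q v {x'} \<subseteq> trim Q v A" by (intro trim_mono) simp
      then show False using nobad linkage_mono[OF x'(4)] by blast
    qed
    then show ?thesis using x' by blast
  qed
  then obtain z q0 p0 where z: "z \<in> I" "g0 z = q0 @ x # v # p0" by blast
  define g where "g = g0"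
  note g = g0(1)[folded g_def] g0(2)[folded g_def]
  have gz: "g z = q0 @ x # v # p0" using z(2) by (simp add: g_def)
  define I' where "I' = I - {z}"
  have II: "I = insert z I'" "z \<notin> I'" using z(1) by (auto simp: I'_def)
  have I'I: "i \<in> I" if "i \<in> I'" for i using that by (simp add: I'_def)
  have offz: "y \<notin> set (g i)" if "i \<in> I'" "y \<in> set (g z)" for i y
    using linkage_eq[OF g(1) I'I[OF that(1)] z(1), of y] that I'_def by blast
  have vz: "v \<in> set (g z)" using gz by simp
  have vI: "v \<notin> set (g i)" if "i \<in> I'" for i using offz[OF that vz] .
  define H where "H B = del (trim Q v B) {r, u}" for B
  have gH: "dipath (H {}) p" if p: "dipath (trim Q v (insert x A)) p" "set p \<inter> {r, u} = {}" and nv: "v \<notin> set (tl p)" for p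
  proof -
    have "dipath (trim Q v {}) p"
    proof (rule dipath_steps[OF p(1)])
      fix q a b w assume ab: "p = q @ a # b # w" "(a, b) \<in> trim Q v (insert x A)"
      have "b \<in> set (tl p)" using ab(1) by (cases q) auto
      then show "(a, b) \<in> trim Q v {}" using nv ab(2) by auto
    qed
    then show ?thesis unfolding H_def using p(2) by (rule dipath_delI)
  qed
  have Hm: "H B \<subseteq> H B'" if "B \<subseteq> B'" for B B' unfolding H_def using trim_mono[OF that] del_mono by blast
  have gI0: "disjoint_paths (H {}) I' g"
  proof (rule disjoint_pathsI)
    fix i assume i: "i \<in> I'"
    note L = linkageD[OF g(1) I'I[OF i]]
    have "v \<notin> set (tl (g i))" using vI[OF i] by (metis list.set_sel(2) list.sel(2))
    then show "dipath (H {}) (g i)" using gH[OF L(1,5)] by blast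
  qed (use linkage_eq[OF g(1)] I'I in blast)
  have gI: "disjoint_paths (H B) I' g" for B using disjoint_paths_mono[OF gI0 Hm] by blast
  have lI: "\<forall>i\<in>I'. last (g i) = i" using linkageD(4)[OF g(1)] I'I by blast
  have uI: "\<forall>i\<in>I'. u \<notin> set (g i)" using linkageD(5)[OF g(1)] I'I by blast
  have uF: "u \<notin> Field (H B)" for B by (auto simp: H_def Field_def)
  define C where "C = N - {u} - hd ` g ` I'"
  define W where "W B = H B \<union> {u} \<times> C" for B
  have WI: "disjoint_paths (W B) I' g" for B unfolding W_def by (rule disjoint_paths_mono[OF gI]) auto
  define X where "X B = exposed (W B) I' g u" for B
  have uX: "u \<in> X B" for B unfolding X_def by (rule exposed_source[OF WI lI uI])
  have XI: "X B \<inter> I' = {}" for B unfolding X_def by (rule exposed_targets[OF WI lI uI])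
  have exX: "\<exists>i\<in>I'. \<exists>p q. g i = p @ y # q \<and> set p \<subseteq> X B" if "a \<in> X B" "(a, y) \<in> W B" "y \<notin> X B" for a y B
    using exposed_boundary[OF WI lI uI, of a B y] that unfolding X_def by blast
  have Xm: "X B \<subseteq> X B'" if "B \<subseteq> B'" for B B'
    unfolding X_def W_def by (rule exposed_mono) (use Hm[OF that] in blast)
  have zu: "z \<noteq> u" using linkageD(5,8)[OF g(1) z(1)] by blast
  have aug: "near_linkable (trim Q v B) u (?T \<union> J)" if zB: "z \<in> X B" for B
  proof -
    obtain k where k: "disjoint_paths (H B) (insert z I') k" "\<forall>b\<in>insert z I'. last (k b) = b"
      "\<exists>c\<in>C. hd ` k ` insert z I' = insert c (hd ` g ` I')" "finite {b\<in>I'. k b \<noteq> g b}"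
      using augment[OF gI lI uF uI, of z B C, OF zB[unfolded X_def W_def] zu] by blast
    have "hd ` g ` I' \<subseteq> N - {u}" using linkageD(2,3)[OF g(1)] I'I by blast
    moreover obtain c where c: "c \<in> C" "hd ` k ` insert z I' = insert c (hd ` g ` I')" using k(3) by blast
    ultimately have "hd ` k ` insert z I' \<subseteq> N - {u}" unfolding c(2) using c(1) unfolding C_def by blast
    then have "linkage (trim Q v B) u (insert z I') k" unfolding linkage_def using k(1,2) unfolding H_def by blast
    moreover have "finite {b \<in> ?T. k b \<noteq> R u b}"
    proof (rule finite_subset)
      show "{b \<in> ?T. k b \<noteq> R u b} \<subseteq> {b \<in> ?T. g b \<noteq> R u b} \<union> {b\<in>I'. k b \<noteq> g b} \<union> {z}"
        by (auto simp: I'_def I_def)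
    qed (use g(2) k(4) in simp)
    ultimately show ?thesis using II unfolding near_linkable_def I_def by auto
  qed
  have followz: "set w \<subseteq> X B" if w: "dipath (H {}) w" "set w \<subseteq> set (g z)" "hd w \<in> X B" for w B
  proof (rule dipath_closed[OF w(1,3)])
    fix a y assume a: "a \<in> X B" "(a, y) \<in> H {}" "y \<in> set w"
    then have "(a, y) \<in> W B" using Hm[of "{}" B] unfolding W_def by blast
    then show "y \<in> X B" using exX[OF a(1)] offz a(3) w(2) by fastforce
  qed
  note Lz = linkageD[OF g(1) z(1)]
  have dz: "distinct (g z)" using Lz(1) by (simp add: dipath_def)
  \<comment> \<open>Behind \<open>v\<close>, the dropped path of \<open>z\<close> avoids all
    remaining paths, so the walk can follow it to its end.\<close>
  have vzX: "z \<in> X B" if "v \<in> X B" for B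
  proof -
    have p: "dipath (trim Q v (insert x A)) (v # p0)" using Lz(1) gz dipath_appendD2[of _ "q0 @ [x]" "v # p0"] by simp
    have "dipath (H {}) (v # p0)" by (rule gH[OF p]) (use Lz(5) gz dz in auto)
    then have "set (v # p0) \<subseteq> X B" using followz[of "v # p0" B] that gz by auto
    moreover have "z \<in> set (v # p0)" using Lz(4) gz last_in_set[of "v # p0"] by simp
    ultimately show ?thesis by blast
  qed
  define \<pi> where "\<pi> = q0 @ [x]"
  have hpi: "hd \<pi> = hd (g z)" using gz by (cases q0) (auto simp: \<pi>_def)
  have pi1: "dipath (H {}) \<pi>"
  proof -
    have p: "dipath (trim Q v (insert x A)) \<pi>" using Lz(1) gz dipath_appendD1[of _ \<pi> "v # p0"] by (simp add: \<pi>_def)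
    show ?thesis by (rule gH[OF p]) (use Lz(5) gz dz in \<open>cases q0; auto simp: \<pi>_def\<close>)+
  qed
  have pisub: "set \<pi> \<subseteq> set (g z)" "v \<notin> set \<pi>" using gz dz by (auto simp: \<pi>_def)
  have piX: "set \<pi> \<subseteq> X B" for B
  proof (rule followz[OF pi1 pisub(1)])
    have "hd (g z) \<in> C"
    proof -
      have "hd (g z) \<notin> hd ` g ` I'"
      proof
        assume "hd (g z) \<in> hd ` g ` I'"
        then obtain i where i: "i \<in> I'" "hd (g z) = hd (g i)" by blast
        then show False using offz[OF i(1) Lz(9)] linkageD(9)[OF g(1) I'I[OF i(1)]] by simp
      qed
      then show ?thesis using Lz(2,3) unfolding C_def by blast
    qed
    then have "(u, hd (g z)) \<in> W B" unfolding W_def by blast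
    then show "hd \<pi> \<in> X B" using exX[OF uX] offz[OF _ Lz(9)] hpi by fastforce
  qed
  have xX: "x \<in> X B" for B using piX by (auto simp: \<pi>_def)
  have AA: "\<not> near_linkable (trim Q v A) u (?T \<union> J)" using bad .
  have zX: "z \<notin> X A" using aug AA by blast
  define X0 where "X0 = X A - {u}"
  let ?Z = "del Q {r, v}" and ?N = "N - {v}"
  let ?S = "boundary ?Z ?N X0"
  \<comment> \<open>With the edge from \<open>y\<close> to \<open>v\<close> restored, the walk
    continues through \<open>v\<close> to \<open>z\<close>, and augmenting yields the missing
    linkage.\<close>
  have tails_feas: "X0 \<inter> tails Q v \<subseteq> repairs Q v A u J"
  proof
    fix y assume y: "y \<in> X0 \<inter> tails Q v"
    let ?B = "insert y A"
    have "y \<in> X ?B" using Xm[of A ?B] y by (auto simp: X0_def)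
    moreover have "(y, v) \<in> W ?B" using y v u unfolding W_def H_def X0_def tails_def by auto
    ultimately have "v \<in> X ?B" using exX[of y ?B v] vI by fastforce
    then have "near_linkable (trim Q v ?B) u (?T \<union> J)" using vzX aug by blast
    then show "y \<in> repairs Q v A u J" using y by (simp add: repairs_def)
  qed
  have pi2: "dipath ?Z \<pi>" "hd \<pi> \<in> ?N" "last \<pi> = x" "set \<pi> \<subseteq> X0"
  proof -
    have "set \<pi> \<inter> {r, u} = {}" using Lz(5) pisub by blast
    then show "dipath ?Z \<pi>" "set \<pi> \<subseteq> X0"
      using dipath_mono[OF dipath_delD[OF pi1[unfolded H_def]] trim_subset] pisub(2) piX[of A]
      by (auto simp: X0_def intro!: dipath_delI)
    have "hd \<pi> \<in> set \<pi>" by (rule hd_in_set) (simp add: \<pi>_def)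
    then show "hd \<pi> \<in> ?N" using hpi Lz(2) pisub(2) by auto
    show "last \<pi> = x" by (simp add: \<pi>_def)
  qed
  have exB: "\<exists>i\<in>I'. \<exists>p q. g i = p @ t # q \<and> set p \<subseteq> X A" if t: "t \<in> ?S" "t \<noteq> u" for t
  proof -
    have tX: "t \<notin> X A" using t by (auto simp: boundary_def X0_def)
    from t(1) consider "t \<in> ?N" "t \<notin> hd ` g ` I'" | "t \<in> hd ` g ` I'" | y where "y \<in> X0" "(y, t) \<in> ?Z"
      unfolding boundary_def by blast
    then show ?thesis
    proof cases
      case 1
      then have "(u, t) \<in> W A" using t(2) unfolding W_def C_def by blast
      then show ?thesis using exX[OF uX _ tX] by blast
    next
      case 2
      then obtain i where i: "i \<in> I'" "t = hd (g i)" by blast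
      then have "g i = [] @ t # tl (g i)" using linkageD(6)[OF g(1) I'I[OF i(1)]] by simp
      then show ?thesis using i(1) by (intro bexI[of _ i] exI[of _ "[]"] exI[of _ "tl (g i)"]) auto
    next
      case 3
      then have "(y, t) \<in> W A" using t(2) unfolding W_def H_def X0_def by auto
      then show ?thesis using exX[of y A t] tX 3 by (auto simp: X0_def)
    qed
  qed
  have done_: "\<exists>X f. fan ?Z ?N X (boundary ?Z ?N X \<union> {x}) f \<and> x \<in> X \<and> X \<inter> tails Q v \<subseteq> repairs Q v A u J"
    if "\<exists>f. fan ?Z ?N X0 (?S \<union> {x}) f"
    using that tails_feas pi2(3,4) last_in_set[of \<pi>] dipath_ne[OF pi2(1)] by (metis subsetD)
  \<comment> \<open>The virtual source was taken out of the region. If it lies on the boundary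
    without being a source of the web, it needs a path of its own, which \<open>g\<close> does not
    supply.\<close>
  show ?thesis
  proof (cases "u \<in> ?S \<and> u \<notin> ?N")
    case False
    have "\<exists>f. fan ?Z ?N X0 (?S \<union> {x}) f"
    proof (rule fan_add[OF _ _ _ pi2])
      show "disjoint_paths ?Z I' g"
      proof (rule disjoint_pathsI)
        fix i assume i: "i \<in> I'"
        have "dipath Q (g i)" using dipath_mono[OF linkageD(1)[OF g(1) I'I[OF i]] trim_subset] .
        then show "dipath ?Z (g i)" using linkageD(5)[OF g(1) I'I[OF i]] vI[OF i] by (intro dipath_delI) auto
      qed (use linkage_eq[OF g(1)] I'I in blast)
      show "hd (g i) \<in> ?N" if "i \<in> I'" for i
        using linkageD(2,9)[OF g(1) I'I[OF that]] vI[OF that] by auto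
      show "set \<pi> \<inter> set (g i) = {}" if "i \<in> I'" for i using offz[OF that] pisub by blast
      fix t assume t: "t \<in> ?S"
      then have tX: "t \<notin> X0" by (auto simp: boundary_def)
      show "t \<notin> X0 \<and> (t \<in> ?N \<or> (\<exists>i\<in>I'. \<exists>p q. g i = p @ t # q \<and> set p \<subseteq> X0))"
      proof (cases "t = u")
        case True then show ?thesis using False t tX by blast
      next
        case ne: False
        then obtain i p q where i: "i \<in> I'" "g i = p @ t # q" "set p \<subseteq> X A" using exB[OF t] by blast
        then have "set p \<subseteq> X0" using uI unfolding X0_def by auto
        then show ?thesis using i tX by blast
      qed
    qed
    then show ?thesis by (rule done_)
  next
    case True
    then obtain y where y: "y \<in> X0" "(y, u) \<in> ?Z" unfolding boundary_def by blast
    have yt: "y \<in> tails Q u" using y(2) by (simp add: tails_def)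
    have yI: "y \<notin> I" using y(1) XI[of A] zX II unfolding X0_def by blast
    \<comment> \<open>Stability gives a linkage \<open>k\<close> with the additional end vertex
      \<open>y\<close>; its path to \<open>y\<close>, prolonged by the edge to \<open>u\<close>,
      will be the path required for \<open>u\<close>.\<close>
    have "x \<in> repairs Q v A u (insert y J)" using stable[OF yt] x by blast
    then obtain k where k: "linkage (trim Q v (insert x A)) u (insert y I) k" "finite {b \<in> ?T. k b \<noteq> R u b}"
      unfolding repairs_def near_linkable_def I_def by auto
    have kI: "i \<in> insert y I" if "i \<in> I" for i using that by blast
    \<comment> \<open>Both linkages deviate finitely from \<open>R u\<close>, so they agree outside
      a finite set of indices; the counting takes place on that set.\<close>
    define Bf where "Bf = {i\<in>I'. g i = k i}"
    have fin: "finite (I' - Bf)"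
    proof (rule finite_subset)
      show "I' - Bf \<subseteq> {b \<in> ?T. g b \<noteq> R u b} \<union> {b \<in> ?T. k b \<noteq> R u b} \<union> J"
        unfolding Bf_def I'_def I_def by auto
    qed (use g(2) k(2) J(1) in simp)
    define ext where "ext t i \<longleftrightarrow> i \<in> I' \<and> (\<exists>p q. g i = p @ t # q \<and> set p \<subseteq> X A \<and> t \<notin> X A)" for t i
    have ext_uniq: "t = t'" if "ext t i" "ext t' i" for t t' i
    proof -
      obtain p q p' q' where "g i = p @ t # q" "set p \<subseteq> X A" "t \<notin> X A" "g i = p' @ t' # q'" "set p' \<subseteq> X A" "t' \<notin> X A"
        using \<open>ext t i\<close> \<open>ext t' i\<close> unfolding ext_def by blast
      then show ?thesis using split_exit_unique[of p t q p' t' q' "X A"] by simp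
    qed
    have ext_in: "t \<in> set (g i)" "i \<in> I'" if "ext t i" for t i using that unfolding ext_def by auto
    have exX': "\<exists>i. ext t i" if "a \<in> X A" "(a, t) \<in> W A" "t \<notin> X A" for a t
      using exX[OF that] that(3) unfolding ext_def by blast
    have startX: "hd (k i) \<in> X A \<or> (\<exists>j. ext (hd (k i)) j)" if i: "i \<in> insert y I" for i
    proof (rule disjCI)
      assume nex: "\<not> (\<exists>j. ext (hd (k i)) j)"
      show "hd (k i) \<in> X A"
      proof (rule ccontr)
        assume nX: "hd (k i) \<notin> X A"
        show False
        proof (cases "hd (k i) \<in> hd ` g ` I'")
          case True
          then obtain j where j: "j \<in> I'" "hd (k i) = hd (g j)" by blast
          then have "g j = [] @ hd (k i) # tl (g j)" using linkageD(6)[OF g(1) I'I[OF j(1)]] by simp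
          then have "ext (hd (k i)) j" unfolding ext_def using j(1) nX by (metis empty_subsetI list.set(1))
          then show False using nex by blast
        next
          case False
          then have "(u, hd (k i)) \<in> W A" using linkageD(2,3)[OF k(1) i] unfolding W_def C_def by blast
          then show False using exX'[OF uX _ nX] nex by blast
        qed
      qed
    qed
    have stepH: "(a, b) \<in> W A \<or> (a = x \<and> b = v)" if i: "i \<in> insert y I" and ab: "k i = q @ a # b # w" for i a b q w
    proof -
      have "(a, b) \<in> H (insert x A)"
        using dipath_edge[of "H (insert x A)" q a b w] linkageD(7)[OF k(1) i] ab unfolding H_def by metis
      then show ?thesis unfolding W_def H_def by auto
    qed
    have firstext: "(\<exists>p t q j. k i = p @ t # q \<and> set p \<subseteq> X A \<and> ext t j) \<or> (\<exists>q p. k i = q @ x # v # p \<and> set (q @ [x]) \<subseteq> X A)"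
      if i: "i \<in> insert y I" and l: "i \<notin> X A" for i
      using startX[OF i]
    proof
      assume "hd (k i) \<in> X A"
      then obtain q a b w where w: "k i = q @ a # b # w" "set (q @ [a]) \<subseteq> X A" "b \<notin> X A"
        using path_leave[of "k i" "X A"] linkageD(4,6)[OF k(1) i] l by metis
      from stepH[OF i w(1)] show ?thesis
      proof
        assume "(a, b) \<in> W A"
        then obtain j where "ext b j" using exX'[of a b] w by auto
        moreover have "k i = (q @ [a]) @ b # w" using w(1) by simp
        ultimately show ?thesis using w(2) by blast
      next
        assume "a = x \<and> b = v"
        then show ?thesis using w by blast
      qed
    next
      assume "\<exists>j. ext (hd (k i)) j"
      moreover have "k i = [] @ hd (k i) # tl (k i)" using linkageD(6)[OF k(1) i] by simp
      moreover have "set [] \<subseteq> X A" by simp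
      ultimately show ?thesis by blast
    qed
    have IX: "i \<notin> X A" if "i \<in> I" for i using that XI[of A] zX II by blast
    define hasext where "hasext i \<longleftrightarrow> (\<exists>t j. ext t j \<and> t \<in> set (k i))" for i
    \<comment> \<open>A path of \<open>k\<close> that avoids all exits can leave the region only
      along the edge from \<open>x\<close> to \<open>v\<close>; by disjointness there is at most one
      such path.\<close>
    define E1 where "E1 = {i\<in>I. \<not> hasext i}"
    have E1x: "\<exists>q p. k i = q @ x # v # p \<and> set (q @ [x]) \<subseteq> X A" if "i \<in> E1" for i
    proof -
      have i: "i \<in> I" "\<not> hasext i" using that by (auto simp: E1_def)
      have "\<not> (\<exists>p t q j. k i = p @ t # q \<and> set p \<subseteq> X A \<and> ext t j)"
        using i(2) unfolding hasext_def by (metis in_set_conv_decomp)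
      then show ?thesis using firstext[OF kI[OF i(1)] IX[OF i(1)]] by blast
    qed
    have E1v: "v \<in> set (k i)" if "i \<in> E1" for i using E1x[OF that] by auto
    have E1one: "i = j" if "i \<in> E1" "j \<in> E1" for i j
      using linkage_eq[OF k(1), of i j v] E1v that by (auto simp: E1_def)
    have BfE: "i \<notin> E1" if "i \<in> Bf" for i
    proof
      assume "i \<in> E1"
      then have "v \<in> set (g i)" using E1v that unfolding Bf_def by auto
      then show False using vI that unfolding Bf_def by blast
    qed
    let ?D = "I - Bf - E1"
    have "\<forall>i\<in>?D. \<exists>j. \<exists>t. ext t j \<and> t \<in> set (k i)" unfolding E1_def hasext_def by blast
    then obtain \<phi> where \<phi>: "\<forall>i\<in>?D. \<exists>t. ext t (\<phi> i) \<and> t \<in> set (k i)" by (rule bchoice[THEN exE])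
    have Bfk: "i = j" if "i \<in> insert y I" "j \<in> Bf" "t \<in> set (k i)" "t \<in> set (g j)" for i j t
    proof -
      have "j \<in> insert y I" "g j = k j" using that(2) I'I unfolding Bf_def by auto
      then show ?thesis using linkage_eq[OF k(1) that(1), of j t] that(3,4) by simp
    qed
    have phiD: "\<phi> ` ?D \<subseteq> I' - Bf"
    proof
      fix j assume "j \<in> \<phi> ` ?D"
      then obtain i where i: "i \<in> ?D" "j = \<phi> i" by blast
      obtain t where t: "ext t j" "t \<in> set (k i)" using \<phi> i by blast
      have "j \<notin> Bf"
      proof
        assume j: "j \<in> Bf"
        have "i = j" by (rule Bfk[OF _ j t(2) ext_in(1)[OF t(1)]]) (use i in blast)
        then show False using i(1) j by blast
      qed
      then show "j \<in> I' - Bf" using ext_in(2)[OF t(1)] by blast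
    qed
    have phii: "inj_on \<phi> ?D"
    proof (rule inj_onI)
      fix a b assume ab: "a \<in> ?D" "b \<in> ?D" "\<phi> a = \<phi> b"
      obtain t where t: "ext t (\<phi> a)" "t \<in> set (k a)" using \<phi> ab(1) by blast
      obtain t' where t': "ext t' (\<phi> b)" "t' \<in> set (k b)" using \<phi> ab(2) by blast
      have "t = t'" using ext_uniq t(1) t'(1) ab(3) by simp
      then show "a = b" using linkage_eq[OF k(1), of a b t] t(2) t'(2) ab by blast
    qed
    have zBf: "z \<notin> Bf" unfolding Bf_def I'_def by blast
    have IB: "I - Bf = insert z (I' - Bf)" using II zBf by blast
    have cIB: "card (I - Bf) = card (I' - Bf) + 1" "finite (I - Bf)" using IB fin II(2) by auto
    have E1sub: "E1 \<subseteq> I - Bf" using BfE unfolding E1_def by blast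
    have fE1: "finite E1" using E1sub cIB(2) finite_subset by blast
    have le: "card ?D \<le> card (I' - Bf)" using card_inj_on_le[OF phii phiD fin] .
    have cD: "card ?D = card (I - Bf) - card E1" using card_Diff_subset[OF fE1 E1sub] .
    \<comment> \<open>\<open>I - Bf\<close> has one element more than \<open>I' - Bf\<close>, while
      \<open>\<phi>\<close> is injective. So exactly one path misses the exits, and
      \<open>\<phi>\<close> is a bijection for the others.\<close>
    have "E1 \<noteq> {}" using le cD cIB(1) by auto
    then obtain z' where z': "z' \<in> E1" by blast
    have E1eq: "E1 = {z'}" using z' E1one by blast
    have "card ?D = card (I' - Bf)" using cD cIB(1) E1eq by simp
    then have surj: "\<phi> ` ?D = I' - Bf"
      using card_image[OF phii] phiD fin by (metis card_subset_eq)
    have cover: "\<exists>i\<in>I. t \<in> set (k i)" if t: "ext t j" for t j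
    proof (cases "j \<in> Bf")
      case True
      then show ?thesis using ext_in[OF t] I'I unfolding Bf_def by auto
    next
      case False
      then have "j \<in> \<phi> ` ?D" using surj ext_in(2)[OF t] by blast
      then obtain i where i: "i \<in> ?D" "j = \<phi> i" by blast
      then obtain t' where "ext t' j" "t' \<in> set (k i)" using \<phi> by blast
      then show ?thesis using ext_uniq[OF t] i(1) by blast
    qed
    have uniq2: "j = j'" if i: "i \<in> I" and t: "ext t j" "t \<in> set (k i)" "ext t' j'" "t' \<in> set (k i)" for i t j t' j'
    proof -
      have ii: "i \<in> insert y I" using i by blast
      have one: "j = i" if "j \<in> Bf" "ext t j" "t \<in> set (k i)" for j t
        using Bfk[OF ii that(1,3) ext_in(1)[OF that(2)]] by simp
      have two: "j \<in> Bf" if "i \<in> Bf" "ext t j" "t \<in> set (k i)" for j t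
      proof -
        have "t \<in> set (g i)" "i \<in> I'" using that unfolding Bf_def by auto
        then have "i = j" using disjoint_paths_eq[OF gI0, of i j t] ext_in[OF that(2)] by blast
        then show ?thesis using that by blast
      qed
      have three: "j = \<phi> i" if "i \<notin> Bf" "ext t j" "t \<in> set (k i)" for j t
      proof -
        have "j \<notin> Bf" using one[OF _ that(2,3)] that(1) by blast
        then have "j \<in> \<phi> ` ?D" using surj ext_in(2)[OF that(2)] by blast
        then obtain i1 where i1: "i1 \<in> ?D" "j = \<phi> i1" by blast
        then obtain t1 where t1: "ext t1 j" "t1 \<in> set (k i1)" using \<phi> by blast
        then have "t1 = t" using ext_uniq that(2) by blast
        then have "i1 = i" using linkage_eq[OF k(1), of i1 i t] t1(2) that(3) ii i1(1) by blast
        then show ?thesis using i1(2) by blast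
      qed
      show ?thesis
      proof (cases "i \<in> Bf")
        case True
        then show ?thesis using one[OF two[OF True t(1,2)] t(1,2)] one[OF two[OF True t(3,4)] t(3,4)] by simp
      next
        case False
        then show ?thesis using three[OF False t(1,2)] three[OF False t(3,4)] by simp
      qed
    qed
    have zI: "z' \<in> I" "\<not> hasext z'" using z' by (auto simp: E1_def)
    have vonly: "v \<notin> set (k i)" if "i \<in> insert y I" "i \<noteq> z'" for i
      using linkage_eq[OF k(1) that(1), of z' v] E1v[OF z'] zI that(2) by blast
    have exitk: "\<exists>i\<in>I - {z'}. \<exists>p q. k i = p @ t # q \<and> set p \<subseteq> X A" if t: "ext t j" for t j
    proof -
      obtain i where i: "i \<in> I" "t \<in> set (k i)" using cover[OF t] by blast
      have ne: "i \<noteq> z'" using zI(2) t i(2) unfolding hasext_def by blast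
      have "v \<notin> set (k i)" using vonly ne i(1) by blast
      then have "\<not> (\<exists>q p. k i = q @ x # v # p \<and> set (q @ [x]) \<subseteq> X A)" by auto
      then obtain p t' q j' where p: "k i = p @ t' # q" "set p \<subseteq> X A" "ext t' j'"
        using firstext[OF kI[OF i(1)] IX[OF i(1)]] by blast
      have "j = j'" using uniq2[OF i(1) t i(2) p(3)] p(1) by simp
      then have "t' = t" using ext_uniq p(3) t by blast
      then show ?thesis using p i(1) ne by blast
    qed
    have yIk: "y \<in> insert y I" by simp
    have yz: "y \<noteq> z'" using yI zI(1) by blast
    have noy: "\<not> hasext y"
    proof
      assume "hasext y"
      then obtain t j where t: "ext t j" "t \<in> set (k y)" unfolding hasext_def by blast
      obtain i where "i \<in> I" "t \<in> set (k i)" using cover[OF t(1)] by blast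
      then have "i = y" using linkage_eq[OF k(1), of i y t] t(2) by blast
      then show False using yI \<open>i \<in> I\<close> by blast
    qed
    \<comment> \<open>All exits are occupied by paths ending in \<open>I\<close>, so the path to
      \<open>y\<close> has no way out of the region.\<close>
    have ky: "set (k y) \<subseteq> X A"
    proof (rule ccontr)
      assume "\<not> ?thesis"
      then have "\<exists>a\<in>set (k y). a \<notin> X A" by blast
      from split_list_first_prop[OF this] obtain p b w where b: "k y = p @ b # w" "b \<notin> X A" "\<forall>a\<in>set p. \<not> a \<notin> X A" by blast
      have noext: "\<not> ext b j" for j using noy b(1) unfolding hasext_def by auto
      show False
      proof (cases "p = []")
        case True
        then have "hd (k y) = b" using b(1) by simp
        then show False using startX[OF yIk] b(2) noext by blast
      next
        case False
        then obtain q a where qa: "p = q @ [a]" by (metis append_butlast_last_id)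
        then have "k y = q @ a # b # w" using b(1) by simp
        from stepH[OF yIk this] have "(a, b) \<in> W A" using vonly[OF yIk yz] b(1) by auto
        moreover have "a \<in> X A" using b(3) qa by simp
        ultimately show False using exX'[of a b] b(2) noext by blast
      qed
    qed
    obtain q' p' where zz: "k z' = q' @ x # v # p'" "set (q' @ [x]) \<subseteq> X A" using E1x[OF z'] by blast
    define \<rho> where "\<rho> = q' @ [x]"
    note Lz' = linkageD[OF k(1) kI[OF zI(1)]]
    have rsub: "set \<rho> \<subseteq> set (k z')" using zz(1) by (auto simp: \<rho>_def)
    have rv: "v \<notin> set \<rho>" using Lz'(1) zz(1) by (auto simp: \<rho>_def dipath_def)
    have rho: "dipath ?Z \<rho>" "hd \<rho> \<in> ?N" "last \<rho> = x" "set \<rho> \<subseteq> X0"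
    proof -
      have "dipath (trim Q v (insert x A)) \<rho>"
        using Lz'(1) zz(1) dipath_appendD1[of _ \<rho> "v # p'"] by (simp add: \<rho>_def)
      then have "dipath Q \<rho>" using dipath_mono trim_subset by blast
      then show "dipath ?Z \<rho>" using rv Lz'(5) rsub by (intro dipath_delI) auto
      have "hd \<rho> = hd (k z')" using zz(1) by (cases q') (auto simp: \<rho>_def)
      moreover have "hd \<rho> \<in> set \<rho>" by (rule hd_in_set) (simp add: \<rho>_def)
      ultimately show "hd \<rho> \<in> ?N" using Lz'(2) rv by auto
      show "last \<rho> = x" by (simp add: \<rho>_def)
      show "set \<rho> \<subseteq> X0" using zz(2) Lz'(5) rsub unfolding \<rho>_def X0_def by blast
    qed
    define G where "G i = (if i = y then k y @ [u] else k i)" for i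
    have Lu: "u \<notin> set (k i)" if "i \<in> insert y I" for i using linkageD(5)[OF k(1) that] by blast
    have kZ: "dipath ?Z (k i)" if "i \<in> insert y (I - {z'})" for i
    proof -
      have i: "i \<in> insert y I" "i \<noteq> z'" using that yz by auto
      have "dipath Q (k i)" using dipath_mono[OF linkageD(1)[OF k(1) i(1)] trim_subset] .
      then show ?thesis using vonly[OF i] linkageD(5)[OF k(1) i(1)] by (intro dipath_delI) auto
    qed
    have "\<exists>f. fan ?Z ?N X0 (?S \<union> {x}) f"
    proof (rule fan_add[OF _ _ _ rho])
      show "disjoint_paths ?Z (insert y (I - {z'})) G"
      proof (rule disjoint_pathsI)
        fix i assume i: "i \<in> insert y (I - {z'})"
        show "dipath ?Z (G i)"
        proof (cases "i = y")
          case True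
          have "dipath ?Z (k y @ [u])"
            using dipath_append[OF linkageD(6)[OF k(1) yIk], of "[u]" ?Z] kZ[of y] linkageD(4)[OF k(1) yIk] y(2) Lu[OF yIk] by simp
          then show ?thesis using True by (simp add: G_def)
        qed (use kZ[OF i] in \<open>simp add: G_def\<close>)
      next
        fix i j a assume ij: "i \<in> insert y (I - {z'})" "j \<in> insert y (I - {z'})" "a \<in> set (G i)" "a \<in> set (G j)"
        have 1: "a \<in> set (k i) \<or> a = u \<and> i = y" using ij(3) by (auto simp: G_def split: if_splits)
        have 2: "a \<in> set (k j) \<or> a = u \<and> j = y" using ij(4) by (auto simp: G_def split: if_splits)
        have ij': "i \<in> insert y I" "j \<in> insert y I" using ij by auto
        show "i = j" using 1 2 linkage_eq[OF k(1) ij', of a] Lu ij' by blast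
      qed
      show "hd (G i) \<in> ?N" if i: "i \<in> insert y (I - {z'})" for i
      proof -
        have i': "i \<in> insert y I" "i \<noteq> z'" using i yz by auto
        have "hd (G i) = hd (k i)" using linkageD(6)[OF k(1) yIk] by (simp add: G_def)
        then show ?thesis using linkageD(2,9)[OF k(1) i'(1)] vonly[OF i'] by auto
      qed
      show "set \<rho> \<inter> set (G i) = {}" if i: "i \<in> insert y (I - {z'})" for i
      proof -
        have i': "i \<in> insert y I" "i \<noteq> z'" using i yz by auto
        have "set (k z') \<inter> set (k i) = {}" using linkage_eq[OF k(1) kI[OF zI(1)] i'(1)] i'(2) by blast
        moreover have "u \<notin> set (k z')" using Lu kI[OF zI(1)] by blast
        ultimately show ?thesis using rsub by (auto simp: G_def)
      qed
      fix t assume t: "t \<in> ?S"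
      then have tX: "t \<notin> X0" by (auto simp: boundary_def)
      show "t \<notin> X0 \<and> (t \<in> ?N \<or> (\<exists>c\<in>insert y (I - {z'}). \<exists>p q. G c = p @ t # q \<and> set p \<subseteq> X0))"
      proof (cases "t = u")
        case True
        have "G y = k y @ t # []" using True by (simp add: G_def)
        moreover have "set (k y) \<subseteq> X0" using ky Lu[OF yIk] unfolding X0_def by blast
        ultimately show ?thesis using tX by blast
      next
        case False
        have tXA: "t \<notin> X A" using tX False by (auto simp: X0_def)
        obtain j where "ext t j" using exB[OF t False] tXA unfolding ext_def by blast
        then obtain i p q where i: "i \<in> I - {z'}" "k i = p @ t # q" "set p \<subseteq> X A" using exitk by blast
        have "G i = p @ t # q" using i(1,2) yI by (auto simp: G_def)
        moreover have "set p \<subseteq> X0" using i(2,3) Lu[of i] i(1) unfolding X0_def by auto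
        moreover have "i \<in> insert y (I - {z'})" using i(1) by blast
        ultimately show ?thesis using tX by blast
      qed
    qed
    then show ?thesis by (rule done_)
  qed
qed

end

section \<open>Processing one vertex\<close>

lemma del_conv: "(del Q U)\<inverse> = del (Q\<inverse>) U"
  by (auto simp: del_def)

lemma reindex_last:
  assumes "disjoint_paths E I G"
  shows "\<exists>h. disjoint_paths E (last ` G ` I) h \<and> (\<forall>t\<in>I. h (last (G t)) = G t)"
proof -
  have "disjoint_paths (E\<inverse>) I (\<lambda>t. rev (G t))" using assms by (simp add: disjoint_paths_def)
  from reindex_rev[OF this] obtain h where h: "disjoint_paths E (hd ` (\<lambda>t. rev (G t)) ` I) h" "\<forall>t\<in>I. h (hd (rev (G t))) = G t" by auto
  have "hd (rev (G t)) = last (G t)" if "t \<in> I" for t using dipath_ne[OF disjoint_pathsD[OF assms that]] by (simp add: hd_rev)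
  then show ?thesis using h by (intro exI[of _ h]) (simp add: image_image)
qed

context rooted
begin

lemma tails_V: "Q \<subseteq> E \<Longrightarrow> tails Q u \<subseteq> V"
  using EV by (auto simp: tails_def)

lemma linkage_V: "Q \<subseteq> E \<Longrightarrow> linkage Q u S g \<Longrightarrow> s \<in> S \<Longrightarrow> set (g s) \<subseteq> V"
  using path_sources[of Q "g s" N] linkageD(1,2)[of Q u S g s] NV EV by blast

lemma repairs_mono: "J \<subseteq> J' \<Longrightarrow> repairs Q v A u J' \<subseteq> repairs Q v A u J"
  unfolding repairs_def using near_linkable_sub[of _ u "tails F u \<union> J'" "tails F u \<union> J"] by blast

text \<open>\<open>A\<close> already satisfies every requirement with infinitely many repairs;
  \<open>H\<close> meets the repairs of the stable ones among the rest. That is enough: among the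
  finite enlargements of a failing requirement, one with fewest repairs is stable, and whatever
  repairs it repairs the original.\<close>

lemma trim_choice:
  assumes QE: "Q \<subseteq> E" and FQ: "F \<subseteq> Q" and v: "v \<in> V" "v \<noteq> r" and q: "quasi_flame Q v"
    and J: "finite J0" "J0 \<subseteq> tails Q v" and U: "U \<subseteq> V - {r, v}" and qU: "\<And>u. u \<in> U \<Longrightarrow> quasi_flame Q u"
  shows "\<exists>A g. tails F v \<union> J0 \<subseteq> A \<and> A \<subseteq> tails Q v \<and> linkage Q v A g \<and>
    (\<forall>B. A \<subseteq> B \<longrightarrow> (\<forall>u\<in>U. quasi_flame (trim Q v B) u))"
proof -
  let ?A0 = "tails F v \<union> J0"
  define tests where "tests = (SIGMA u : U. {J. finite J \<and> J \<subseteq> tails Q u})"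
  have "tests \<subseteq> V \<times> {J. finite J \<and> J \<subseteq> V}" using U tails_V[OF QE] unfolding tests_def by blast
  moreover have "countable (V \<times> {J. finite J \<and> J \<subseteq> V})"
    by (rule countable_SIGMA[OF cV countable_Collect_finite_subset[OF cV]])
  ultimately have ct: "countable tests" by (rule countable_subset)
  define \<tau> where "\<tau> = from_nat_into tests"
  define d where "d n = repairs Q v ?A0 (fst (\<tau> n)) (snd (\<tau> n))" for n
  have dsub: "d n \<subseteq> tails Q v" for n by (auto simp: d_def repairs_def)
  have "\<exists>A g. ?A0 \<subseteq> A \<and> A \<subseteq> tails Q v \<and> linkage Q v A g \<and> (\<forall>n. infinite (d n) \<longrightarrow> d n \<inter> A \<noteq> {})"
    by (rule link_hitting_infinite[OF FQ q J dsub])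
  then obtain A g where A: "?A0 \<subseteq> A" "A \<subseteq> tails Q v" "linkage Q v A g" "\<forall>n. infinite (d n) \<longrightarrow> d n \<inter> A \<noteq> {}"
    by (elim exE conjE) (rule that)
  define ok where "ok u J \<longleftrightarrow> near_linkable (trim Q v A) u (tails F u \<union> J)" for u J
  let ?X = "repairs Q v A"
  have XA: "?X u J \<inter> A = {}" if "\<not> ok u J" for u J
    using that unfolding repairs_def ok_def by (auto simp: insert_absorb)
  have Xfin: "finite (?X u J)" if t: "(u, J) \<in> tests" and nok: "\<not> ok u J" for u J
  proof (rule ccontr)
    assume inf: "infinite (?X u J)"
    \<comment> \<open>The sets \<open>d n\<close> had to be fixed before \<open>A\<close> was known.
      They suffice because a repairing linkage depends on the single edge from \<open>x\<close> to
      \<open>v\<close> and not on the other edges from \<open>A\<close>.\<close>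
    have "?X u J \<subseteq> repairs Q v ?A0 u J"
    proof
      fix x assume x: "x \<in> ?X u J"
      then obtain k where k: "linkage (trim Q v (insert x A)) u (tails F u \<union> J) k" "finite {b \<in> tails F u. k b \<noteq> R u b}"
        unfolding repairs_def near_linkable_def by blast
      have no: "\<not> linkage (trim Q v A) u (tails F u \<union> J) k" using nok k(2) unfolding ok_def near_linkable_def by blast
      from trim_split[OF k(1)] show "x \<in> repairs Q v ?A0 u J"
      proof
        assume "linkage (trim Q v {}) u (tails F u \<union> J) k"
        then show ?thesis using no linkage_mono trim_mono[of "{}" A Q v] by blast
      next
        assume "\<exists>x'\<in>insert x A. \<exists>s\<in>tails F u \<union> J. \<exists>q p. k s = q @ x' # v # p \<and> linkage (trim Q v {x'}) u (tails F u \<union> J) k"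
        then obtain x' where x': "x' \<in> insert x A" "linkage (trim Q v {x'}) u (tails F u \<union> J) k" by blast
        have "x' \<notin> A"
        proof
          assume "x' \<in> A"
          then have "trim Q v {x'} \<subseteq> trim Q v A" by (intro trim_mono) simp
          then show False using no linkage_mono[OF x'(2)] by blast
        qed
        then have "x' = x" using x'(1) by blast
        then have "linkage (trim Q v (insert x ?A0)) u (tails F u \<union> J) k"
          using linkage_mono[OF x'(2)] trim_mono[of "{x'}" "insert x ?A0" Q v] by blast
        then show ?thesis using x k(2) unfolding repairs_def near_linkable_def by blast
      qed
    qed
    then have i0: "infinite (repairs Q v ?A0 u J)" using inf finite_subset by blast
    obtain n where "\<tau> n = (u, J)" using from_nat_into_surj[OF ct t] unfolding \<tau>_def by blast
    then have "d n = repairs Q v ?A0 u J" by (simp add: d_def)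
    then have "d n \<inter> A \<noteq> {}" using A(4)[THEN spec, of n] i0 by simp
    then obtain a where a: "a \<in> A" "a \<in> repairs Q v ?A0 u J" using \<open>d n = repairs Q v ?A0 u J\<close> by blast
    have "trim Q v (insert a ?A0) \<subseteq> trim Q v A" using a(1) A(1) by (intro trim_mono) blast
    then have "ok u J" unfolding ok_def using a(2) near_linkable_mono unfolding repairs_def by blast
    then show False using nok by blast
  qed
  have Xne: "?X u J \<noteq> {}" if t: "(u, J) \<in> tests" and nok: "\<not> ok u J" for u J
  proof -
    have "quasi_flame Q u" using t qU unfolding tests_def by blast
    then have "near_linkable Q u (tails F u \<union> J)" using t unfolding quasi_flame_def tests_def by blast
    then obtain k where k: "linkage Q u (tails F u \<union> J) k" "finite {b \<in> tails F u. k b \<noteq> R u b}" unfolding near_linkable_def by blast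
    have "trim Q v (tails Q v) = Q" by (auto simp: trim_def tails_def)
    then have "linkage (trim Q v (tails Q v)) u (tails F u \<union> J) k" using k(1) by simp
    from trim_split[OF this] show ?thesis
    proof
      assume "linkage (trim Q v {}) u (tails F u \<union> J) k"
      then have "ok u J" using k(2) linkage_mono trim_mono[of "{}" A Q v] unfolding ok_def near_linkable_def by blast
      then show ?thesis using nok by blast
    next
      assume "\<exists>x\<in>tails Q v. \<exists>s\<in>tails F u \<union> J. \<exists>q p. k s = q @ x # v # p \<and> linkage (trim Q v {x}) u (tails F u \<union> J) k"
      then obtain x where x: "x \<in> tails Q v" "linkage (trim Q v {x}) u (tails F u \<union> J) k" by blast
      have "linkage (trim Q v (insert x A)) u (tails F u \<union> J) k"
        using linkage_mono[OF x(2)] trim_mono[of "{x}" "insert x A" Q v] by blast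
      then show ?thesis using x(1) k(2) unfolding repairs_def near_linkable_def by blast
    qed
  qed
  define stable where "stable u J \<longleftrightarrow> (\<forall>y\<in>tails Q u. ?X u J \<subseteq> ?X u (insert y J))" for u J
  define \<D> where "\<D> = {?X u J |u J. (u, J) \<in> tests \<and> \<not> ok u J \<and> stable u J}"
  have cZ: "countable (tails Q v)" using countable_subset[OF tails_V[OF QE] cV] .
  have "\<exists>X H f. fan (del Q {r, v}) (N - {v}) X (boundary (del Q {r, v}) (N - {v}) X \<union> H) f \<and> H \<subseteq> X \<inter> tails Q v \<and>
    X \<inter> tails Q v \<subseteq> \<Union>\<D> \<and> (\<forall>D\<in>\<D>. D \<inter> H \<noteq> {})"
  proof (rule hitting[OF cZ])
    show "finite D \<and> D \<subseteq> tails Q v \<and> D \<noteq> {}" if "D \<in> \<D>" for D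
      using that Xfin Xne unfolding \<D>_def repairs_def by blast
    fix D x assume D: "D \<in> \<D>" and x: "x \<in> D"
    obtain u J where uJ: "D = ?X u J" "(u, J) \<in> tests" "\<not> ok u J" "stable u J" using D unfolding \<D>_def by blast
    have u: "u \<noteq> r" "u \<noteq> v" and J': "finite J" "J \<subseteq> tails Q u" using uJ(2) U unfolding tests_def by blast+
    have bad: "\<not> near_linkable (trim Q v A) u (tails F u \<union> J)" using uJ(3) by (simp add: ok_def)
    have xX: "x \<in> ?X u J" using x uJ(1) by simp
    have st: "?X u J \<subseteq> ?X u (insert y J)" if "y \<in> tails Q u" for y using uJ(4) that unfolding stable_def by blast
    show "\<exists>X f. fan (del Q {r, v}) (N - {v}) X (boundary (del Q {r, v}) (N - {v}) X \<union> {x}) f \<and> x \<in> X \<and> X \<inter> tails Q v \<subseteq> D"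
      unfolding uJ(1) by (rule demand_wave[OF v(2) u A(2) J' bad xX st])
  qed
  then obtain X H f where X: "fan (del Q {r, v}) (N - {v}) X (boundary (del Q {r, v}) (N - {v}) X \<union> H) f"
    "H \<subseteq> X \<inter> tails Q v" "X \<inter> tails Q v \<subseteq> \<Union>\<D>" "\<forall>D\<in>\<D>. D \<inter> H \<noteq> {}" by (elim exE conjE) (rule that)
  let ?W = "del Q {r, v}" and ?N = "N - {v}"
  let ?T = "boundary ?W ?N X"
  have "\<Union>\<D> \<inter> A = {}" using XA unfolding \<D>_def by blast
  \<comment> \<open>No vertex of \<open>A\<close> repairs a failing requirement, so the region
    swallows no end vertex of the linkage of \<open>A\<close>, which can therefore be attached
    behind the wave.\<close>
  then have XA': "X \<inter> A = {}" using X(3) A(2) by blast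
  have gA: "disjoint_paths ?W A g" using A(3) by (simp add: linkage_def)
  \<comment> \<open>Only a linkage is wanted, so \<open>UNIV\<close> leaves the continuations
    unconfined.\<close>
  have "\<exists>f'. fan ?W ?N (X \<union> UNIV) ((?T - UNIV) \<union> H \<union> (?T \<inter> A) \<union> (A - X - ?T)) f' \<and>
     (\<forall>t\<in>(?T - UNIV) \<union> H \<union> (?T \<inter> A). f' t = f t) \<and>
     (\<forall>t\<in>A - X - ?T. \<exists>u x w. g t = u @ x # w \<and> x \<in> ?T \<and> f' t = f x @ w)"
  proof (rule fan_compose[OF X(1) _ gA])
    show "H \<subseteq> X" using X(2) by blast
    fix t assume t: "t \<in> A"
    note L = linkageD[OF A(3) t]
    show "t \<in> set (g t)" by (rule L(8))
    assume tX: "t \<notin> X" "t \<notin> ?T"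
    have "hd (g t) \<in> X \<union> ?T" using L(2,3) by (auto simp: boundary_def)
    then have "set (g t) \<inter> (X \<union> ?T) \<noteq> {}" using L(9) by blast
    from last_exit[OF L(7) this] obtain u x w where w: "g t = u @ x # w" "x \<in> ?T" "set w \<inter> (X \<union> ?T) = {}" "dipath ?W (x # w)"
      using L(4) tX(1) by auto
    have "last (x # w) = t" using L(4) w(1) by simp
    then show "\<exists>u x w. g t = u @ x # w \<and> x \<in> ?T \<and> set w \<inter> (X \<union> ?T) = {} \<and> dipath ?W (x # w) \<and> last (x # w) = t \<and>
      set (butlast (x # w)) \<subseteq> UNIV" using w by blast
  qed
  then obtain f' where f': "fan ?W ?N (X \<union> UNIV) ((?T - UNIV) \<union> H \<union> (?T \<inter> A) \<union> (A - X - ?T)) f'" by blast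
  have "A \<union> H \<subseteq> (?T - UNIV) \<union> H \<union> (?T \<inter> A) \<union> (A - X - ?T)" using XA' by blast
  from fan_subset[OF f' this] have lkAH: "linkage Q v (A \<union> H) f'" unfolding linkage_def fan_def by blast
  have "quasi_flame (trim Q v B) u" if B: "A \<union> H \<subseteq> B" and u: "u \<in> U" for B u
    unfolding quasi_flame_def
  proof (intro allI impI)
    fix J assume J': "finite J" "J \<subseteq> tails (trim Q v B) u"
    have uv: "u \<noteq> v" using u U by blast
    have J2: "J \<subseteq> tails Q u" using J'(2) tails_trim[OF uv] by simp
    have AB: "trim Q v A \<subseteq> trim Q v B" using B by (intro trim_mono) blast
    show "near_linkable (trim Q v B) u (tails F u \<union> J)"
    proof (cases "ok u J")
      case True
      then show ?thesis unfolding ok_def using near_linkable_mono AB by blast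
    next
      case False
      let ?P = "\<lambda>K. finite K \<and> J \<subseteq> K \<and> K \<subseteq> tails Q u"
      have "?P J" using J' J2 by blast
      \<comment> \<open>Enlarging the requirement can only lose repairs; at the minimum none can be
        lost, which is stability.\<close>
      from ex_has_least_nat[of ?P, OF this, of "\<lambda>K. card (?X u K)"] obtain K where
        K: "?P K" "\<forall>K'. ?P K' \<longrightarrow> card (?X u K) \<le> card (?X u K')" by blast
      have tK: "(u, K') \<in> tests" if "?P K'" for K' using that u unfolding tests_def by blast
      have nok: "\<not> ok u K'" if "?P K'" for K'
        using False near_linkable_sub[of _ u "tails F u \<union> K'" "tails F u \<union> J"] that unfolding ok_def by blast
      have "stable u K"
        unfolding stable_def
      proof
        fix y assume y: "y \<in> tails Q u"
        then have P: "?P (insert y K)" using K(1) by blast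
        have "?X u (insert y K) = ?X u K"
        proof (rule card_seteq)
          show "finite (?X u K)" using Xfin[OF tK nok] K(1) by blast
          show "?X u (insert y K) \<subseteq> ?X u K" by (rule repairs_mono) blast
          show "card (?X u K) \<le> card (?X u (insert y K))" using K(2) P by blast
        qed
        then show "?X u K \<subseteq> ?X u (insert y K)" by simp
      qed
      then have "?X u K \<in> \<D>" unfolding \<D>_def using tK[OF K(1)] nok[OF K(1)] by blast
      then obtain h where h: "h \<in> H" "h \<in> ?X u K" using X(4) by blast
      have "h \<in> ?X u J" using repairs_mono[of J K] K(1) h(2) by blast
      then have "near_linkable (trim Q v (insert h A)) u (tails F u \<union> J)" by (simp add: repairs_def)
      moreover have "trim Q v (insert h A) \<subseteq> trim Q v B" using B h(1) by (intro trim_mono) blast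
      ultimately show ?thesis by (rule near_linkable_mono)
    qed
  qed
  then show ?thesis using A(1,2) X(2) lkAH by (intro exI[of _ "A \<union> H"] exI[of _ f']) blast
qed

text \<open>Always refers to \<open>E\<close>, never to the current subdigraph, since largeness is
  measured in the host digraph. The root is stripped as in \<open>linkage\<close>.\<close>

definition separates :: "'a \<Rightarrow> 'a set \<Rightarrow> bool" where
  "separates v S \<longleftrightarrow> S \<inter> {r, v} = {} \<and>
     (\<forall>p. dipath E p \<longrightarrow> hd p \<in> N - {v} \<longrightarrow> last p = v \<longrightarrow> r \<notin> set p \<longrightarrow> set p \<inter> S \<noteq> {})"

definition meets_once :: "'a set \<Rightarrow> ('a \<Rightarrow> 'a list) \<Rightarrow> 'a set \<Rightarrow> bool" where
  "meets_once I g S \<longleftrightarrow> (\<forall>i\<in>I. \<exists>!s. s \<in> set (g i) \<and> s \<in> S) \<and> S \<subseteq> (\<Union>i\<in>I. set (g i))"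

text \<open>If edges enter \<open>X2\<close> only from the wave, its boundary or the vertices
  \<open>S2\<close>, then the linked paths read backwards from
  \<open>Y \<union> T \<union> {v}\<close> reach \<open>S2\<close> through \<open>X2\<close> and
  extend the wave over \<open>X2\<close>. Maximality of \<open>Y\<close> gives the
  inclusion.\<close>

lemma wave_absorb:
  assumes Y: "wave ((del Q {r, v})\<inverse>) (tails Q v) (N - {v}) Y f" "Y \<subseteq> V - {r, v}"
    and mx: "\<forall>z\<in>V - {r, v}. (\<exists>X' f'. wave ((del Q {r, v})\<inverse>) (tails Q v) (N - {v}) X' f' \<and> z \<in> X') \<longrightarrow> z \<in> Y"
    and T: "T = boundary ((del Q {r, v})\<inverse>) (tails Q v) Y"
    and k: "linkage Q b B k" and B: "B \<subseteq> Y \<union> T \<union> {v}"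
    and X2: "X2 \<subseteq> V - {r, v}" "X2 \<inter> (N - {v}) = {}" and S2: "S2 \<inter> (X2 \<union> {v}) = {}"
    and suf: "\<And>t. t \<in> S2 \<Longrightarrow> \<exists>s\<in>B. \<exists>p q. k s = p @ t # q \<and> set q \<subseteq> X2 \<union> {v}"
    and bnd: "\<And>x t. x \<in> X2 \<Longrightarrow> (t, x) \<in> Q \<Longrightarrow> t \<notin> {r, v} \<Longrightarrow> t \<in> X2 \<union> Y \<union> T \<union> S2"
  shows "X2 \<subseteq> Y"
proof -
  let ?W = "(del Q {r, v})\<inverse>" and ?A = "tails Q v"
  have fY: "fan ?W ?A Y (T \<union> {}) f" using Y(1) T by (simp add: wave_def)
  have AT: "?A \<subseteq> Y \<union> T" using T by (auto simp: boundary_def)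
  have WT: "y \<in> Y \<union> T" if "x \<in> Y" "(x, y) \<in> ?W" for x y using that T by (auto simp: boundary_def)
  have "\<forall>t\<in>S2. \<exists>l. \<exists>s\<in>B. \<exists>p q. k s = p @ t # q \<and> set q \<subseteq> X2 \<union> {v} \<and> l = rev (t # q)" using suf by blast
  then obtain l where l: "\<forall>t\<in>S2. \<exists>s\<in>B. \<exists>p q. k s = p @ t # q \<and> set q \<subseteq> X2 \<union> {v} \<and> l t = rev (t # q)"
    by (rule bchoice[THEN exE])
  have dl: "disjoint_paths (Q\<inverse>) S2 l"
  proof (rule disjoint_pathsI)
    fix t assume "t \<in> S2"
    then obtain s p q where s: "s \<in> B" "k s = p @ t # q" "l t = rev (t # q)" using l by blast
    have "dipath Q (t # q)" using linkageD(1)[OF k s(1)] s(2) dipath_appendD2[of Q p "t # q"] by simp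
    then show "dipath (Q\<inverse>) (l t)" using s(3) by (simp del: rev.simps)
  next
    fix t t' x assume t: "t \<in> S2" "t' \<in> S2" and x: "x \<in> set (l t)" "x \<in> set (l t')"
    obtain s p q where s: "s \<in> B" "k s = p @ t # q" "l t = rev (t # q)" "set q \<subseteq> X2 \<union> {v}" using l t by blast
    obtain s' p' q' where s': "s' \<in> B" "k s' = p' @ t' # q'" "l t' = rev (t' # q')" "set q' \<subseteq> X2 \<union> {v}" using l t by blast
    have "s = s'" using linkage_eq[OF k s(1) s'(1), of x] x s s' by auto
    then show "t = t'" using split_entry_unique[of p t q p' t' q' "X2 \<union> {v}"] s s' S2 t by auto
  qed
  have "\<exists>f'. fan ?W ?A (Y \<union> X2) ((T - X2) \<union> {} \<union> (T \<inter> S2) \<union> (S2 - Y - T)) f' \<and>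
     (\<forall>t\<in>(T - X2) \<union> {} \<union> (T \<inter> S2). f' t = f t) \<and>
     (\<forall>t\<in>S2 - Y - T. \<exists>u x w. l t = u @ x # w \<and> x \<in> T \<and> f' t = f x @ w)"
    unfolding T
  proof (rule fan_compose[OF fY[unfolded T] _ dl])
    fix t assume t: "t \<in> S2"
    then obtain s p q where s: "s \<in> B" "k s = p @ t # q" "set q \<subseteq> X2 \<union> {v}" "l t = rev (t # q)" using l by blast
    show "t \<in> set (l t)" using s(4) by simp
    assume tY: "t \<notin> Y" "t \<notin> boundary ?W ?A Y"
    \<comment> \<open>A path may run through \<open>v\<close>. This is not its last visit when read
      backwards: the vertex before \<open>v\<close> is a source of the reversed web and thus lies in
      \<open>Y \<union> T\<close>.\<close>
    let ?Z = "Y \<union> T \<union> {v}"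
    have tv: "t \<noteq> v" using t S2 by blast
    have ll: "last (l t) = t" "l t \<noteq> []" using s(4) by simp_all
    have "hd (l t) = s" using s(2,4) linkageD(4)[OF k s(1)] by (simp add: hd_rev del: rev.simps)
    then have "set (l t) \<inter> ?Z \<noteq> {}" using B s(1) hd_in_set[OF ll(2)] by blast
    from split_last_in[OF this] obtain u z w where w: "l t = u @ z # w" "z \<in> ?Z" "set w \<inter> ?Z = {}" by blast
    have zw: "dipath (Q\<inverse>) (z # w)" using disjoint_pathsD[OF dl t] w(1) dipath_appendD2[of _ u "z # w"] by simp
    have "set (l t) \<subseteq> set (k s)" using s(2,4) by auto
    then have rl: "r \<notin> set (l t)" using linkageD(5)[OF k s(1)] by blast
    have lw: "last (z # w) = t" using ll(1) w(1) by simp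
    have step: "(y, z) \<in> Q \<and> y \<notin> ?Z \<and> y \<noteq> r" if "w = y # w'" for y w'
      using zw dipath_edge[of "Q\<inverse>" "[]" z y w'] that w(1,3) rl by auto
    have znv: "z \<noteq> v"
    proof
      assume z: "z = v"
      then obtain y w' where y: "w = y # w'" using lw tv by (cases w) auto
      then have "y \<in> ?A" using step[OF y] z by (simp add: tails_def)
      then show False using step[OF y] AT by blast
    qed
    have "z \<notin> Y"
    proof
      assume z: "z \<in> Y"
      then obtain y w' where y: "w = y # w'" using lw tY by (cases w) auto
      have "(z, y) \<in> ?W" using step[OF y] znv rl w(1) by auto
      then show False using WT[OF z] step[OF y] by blast
    qed
    then have zT: "z \<in> T" using w(2) znv by blast
    have "set (z # w) \<inter> {r, v} = {}" using znv w(1,3) rl by auto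
    then have pW: "dipath ?W (z # w)" unfolding del_conv using zw by (intro dipath_delI)
    have "set (butlast (z # w)) \<subseteq> set (butlast (l t))" using w(1) by (auto simp: butlast_append)
    moreover have "set (butlast (l t)) \<subseteq> X2 \<union> {v}" using s(3,4) by simp
    moreover have "v \<notin> set (butlast (z # w))" using znv w(3) set_butlast_sub[of "z # w"] by auto
    ultimately have "set (butlast (z # w)) \<subseteq> X2" by blast
    then show "\<exists>u x w. l t = u @ x # w \<and> x \<in> boundary ?W ?A Y \<and> set w \<inter> (Y \<union> boundary ?W ?A Y) = {} \<and> dipath ?W (x # w) \<and>
      last (x # w) = t \<and> set (butlast (x # w)) \<subseteq> X2" using w pW lw zT unfolding T by blast
  qed simp
  then obtain f' where f': "fan ?W ?A (Y \<union> X2) ((T - X2) \<union> {} \<union> (T \<inter> S2) \<union> (S2 - Y - T)) f'" by blast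
  have "boundary ?W ?A (Y \<union> X2) \<subseteq> (T - X2) \<union> {} \<union> (T \<inter> S2) \<union> (S2 - Y - T)"
  proof
    fix t assume t: "t \<in> boundary ?W ?A (Y \<union> X2)"
    then have nY: "t \<notin> Y" "t \<notin> X2" by (auto simp: boundary_def)
    from t consider "t \<in> ?A" | x where "x \<in> Y" "(x, t) \<in> ?W" | x where "x \<in> X2" "(x, t) \<in> ?W" unfolding boundary_def by blast
    then have "t \<in> T \<union> S2"
    proof cases
      case 1 then show ?thesis using AT nY by blast
    next
      case 2 then show ?thesis using WT nY by blast
    next
      case 3
      then show ?thesis using bnd[OF 3(1), of t] nY by auto
    qed
    then show "t \<in> (T - X2) \<union> {} \<union> (T \<inter> S2) \<union> (S2 - Y - T)" using nY by blast
  qed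
  then have "wave ?W ?A (N - {v}) (Y \<union> X2) f'"
    using fan_subset[OF f'] X2(2) Y(1) unfolding wave_def by blast
  then show ?thesis using mx X2(1) by blast
qed

text \<open>No edge of the host digraph can jump over the boundary of the greatest wave in the reversed
  web: otherwise the wave could be enlarged by the region behind a separator of a vertex already dealt
  with, or by a region on which an augmentation towards the missing edge gets stuck.\<close>

lemma separator:
  assumes QE: "Q \<subseteq> E" and FQ: "F \<subseteq> Q" and v: "v \<in> V" "v \<noteq> r" and vD: "v \<notin> D"
    and dn: "\<And>b. b \<in> D \<Longrightarrow> \<exists>g S. linkage Q b (tails Q b) g \<and> separates b S \<and> meets_once (tails Q b) g S"
    and qs: "\<And>b. b \<in> V - {r} - D \<Longrightarrow> quasi_flame Q b"
    and un: "\<And>a b. (a, b) \<in> E - Q \<Longrightarrow> b \<notin> D \<Longrightarrow> b \<noteq> r \<Longrightarrow>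
        \<exists>J. finite J \<and> J \<subseteq> tails Q b \<and> \<not> near_linkable Q b (insert a (tails F b \<union> J))"
  shows "\<exists>Y T f g. wave ((del Q {r, v})\<inverse>) (tails Q v) (N - {v}) Y f \<and> T = boundary ((del Q {r, v})\<inverse>) (tails Q v) Y \<and>
    separates v T \<and> disjoint_paths (del ((del Q {r, v})\<inverse>) Y) T g \<and> (\<forall>t\<in>T. hd (g t) = t \<and> last (g t) \<in> N - {v})"
proof -
  let ?W = "(del Q {r, v})\<inverse>" and ?A = "tails Q v" and ?C = "V - {r, v}"
  have cE: "countable ?W"
  proof (rule countable_subset)
    show "?W \<subseteq> V \<times> V" using QE EV by auto
    show "countable (V \<times> V)" using cV by simp
  qed
  have "v \<notin> ?A" using QE irr by (auto simp: tails_def)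
  then have "?A \<union> Range ?W \<subseteq> ?C" using tails_V[OF QE] QE EV by (auto simp: tails_def)
  from menger_wave[OF cE _ this, of "N - {v}"] cV obtain Y f g where Y: "wave ?W ?A (N - {v}) Y f" "Y \<subseteq> ?C"
    "\<forall>z\<in>?C. (\<exists>X' f'. wave ?W ?A (N - {v}) X' f' \<and> z \<in> X') \<longrightarrow> z \<in> Y" and
    g: "disjoint_paths (del ?W Y) (boundary ?W ?A Y) g" "\<forall>t\<in>boundary ?W ?A Y. hd (g t) = t \<and> last (g t) \<in> N - {v}" by auto
  define T where "T = boundary ?W ?A Y"
  have AT: "?A \<subseteq> Y \<union> T" unfolding T_def by (auto simp: boundary_def)
  have WT: "a \<in> Y \<union> T" if "(a, b) \<in> Q" "b \<in> Y" "a \<noteq> r" "a \<noteq> v" for a b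
  proof -
    have "(b, a) \<in> ?W" using that Y(2) by auto
    then show ?thesis using that(2) unfolding T_def boundary_def by blast
  qed
  have YN: "Y \<inter> (N - {v}) = {}" using Y(1) by (simp add: wave_def)
  have Trv: "T \<inter> {r, v} = {}" unfolding T_def using \<open>v \<notin> ?A\<close> by (auto simp: boundary_def tails_def)
  have tY: "tails Q b \<subseteq> Y \<union> T \<union> {v}" if "b \<in> Y \<union> {v}" for b
    using that AT WT by (auto simp: tails_def)
  note absorb = wave_absorb[OF Y T_def]
  have claim: False if ab: "(a, b) \<in> E" "a \<notin> Y \<union> T" "a \<noteq> r" "a \<noteq> v" "b \<in> Y \<union> {v}" for a b
  proof -
    have aV: "a \<in> V" using ab(1) EV by blast
    have abne: "a \<noteq> b" using ab(1) irr by blast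
    have br: "b \<noteq> r" using ab(5) Y(2) v(2) by blast
    have bV: "b \<in> V" using ab(5) Y(2) v(1) by blast
    have nQ: "(a, b) \<notin> Q"
    proof
      assume "(a, b) \<in> Q"
      then show False using WT[of a b] AT ab by (auto simp: tails_def)
    qed
    \<comment> \<open>Common endgame of both cases: an edge of \<open>Q\<close> from
      \<open>a\<close> into the wave or into \<open>v\<close> would place \<open>a\<close> in
      \<open>Y \<union> T\<close>.\<close>
    have final: False if y: "(a, y) \<in> Q" "y \<in> X2 \<union> {v}" "X2 \<subseteq> Y" for y X2
      using y WT[of a y] AT ab by (auto simp: tails_def)
    show False
    proof (cases "b \<in> D")
      case True
      then have bY: "b \<in> Y" using ab(5) vD by blast
      obtain P S where P: "linkage Q b (tails Q b) P" and S: "separates b S" "meets_once (tails Q b) P S" using dn[OF True] by blast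
      \<comment> \<open>The part that the root reaches in \<open>E\<close> before crossing
        \<open>S\<close>. What lies neither here nor in \<open>S\<close> is behind the separator of
        \<open>b\<close>, and that region is to be absorbed.\<close>
      define Rb where "Rb = {x. \<exists>p. dipath E p \<and> hd p \<in> N - {b} \<and> last p = x \<and> r \<notin> set p \<and> set p \<inter> S = {}}"
      have bRb: "b \<notin> Rb" using S(1) unfolding separates_def Rb_def by blast
      have ext: "y \<in> Rb" if x: "x \<in> Rb" "(x, y) \<in> E" "y \<noteq> r" "y \<notin> S" for x y
      proof -
        obtain p where p: "dipath E p" "hd p \<in> N - {b}" "last p = x" "r \<notin> set p" "set p \<inter> S = {}"
          using x(1) unfolding Rb_def by blast
        show ?thesis
        proof (cases "y \<in> set p")
          case True
          then obtain p1 p2 where pp: "p = p1 @ y # p2" by (metis split_list)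
          have "dipath E (p1 @ [y])" using p(1) pp dipath_prefix by metis
          moreover have "hd (p1 @ [y]) = hd p" unfolding pp by (cases p1) auto
          ultimately show ?thesis unfolding Rb_def using p pp by (intro CollectI exI[of _ "p1 @ [y]"]) auto
        next
          case False
          have "dipath E (p @ [y])" using dipath_append[OF dipath_ne[OF p(1)], of "[y]" E] p False x(2) by auto
          then show ?thesis unfolding Rb_def using p x dipath_ne[OF p(1)] by (intro CollectI exI[of _ "p @ [y]"]) auto
        qed
      qed
      have bS: "b \<notin> S" "r \<notin> S" using S(1) unfolding separates_def by auto
      define X2 where "X2 = ?C - Rb - S"
      define S2 where "S2 = S - {v}"
      have suf: "\<exists>s\<in>tails Q b. \<exists>p q. P s = p @ t # q \<and> set q \<subseteq> X2 \<union> {v}" if t: "t \<in> S2" for t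
      proof -
        obtain i where i: "i \<in> tails Q b" "t \<in> set (P i)" using S(2) t unfolding meets_once_def S2_def by blast
        obtain p q where pq: "P i = p @ t # q" using i(2) by (metis split_list)
        have uni: "s = t" if "s \<in> set (P i)" "s \<in> S" for s
          using S(2) i that t unfolding meets_once_def S2_def by blast
        note L = linkageD[OF P i(1)]
        have dP: "distinct (P i)" using L(1) by (simp add: dipath_def)
        have qS: "set q \<inter> S = {}" using uni pq dP by auto
        have "y \<in> X2 \<union> {v}" if y: "y \<in> set q" for y
        proof -
          have yV: "y \<in> V" "y \<noteq> r" using linkage_V[OF QE P i(1)] L(5) pq y by auto
          have "y \<notin> Rb"
          proof
            assume yR: "y \<in> Rb"
            obtain q1 q2 where q12: "q = q1 @ y # q2" using y by (metis split_list)
            have "dipath Q (y # q2)" using L(1) pq q12 dipath_appendD2[of Q "p @ t # q1" "y # q2"] by simp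
            then have "set (y # q2) \<subseteq> Rb"
            proof (rule dipath_closed)
              show "hd (y # q2) \<in> Rb" using yR by simp
              fix a c assume ac: "a \<in> Rb" "(a, c) \<in> Q" "c \<in> set (y # q2)"
              have "c \<in> set q" using ac(3) q12 by auto
              then have "c \<noteq> r" "c \<notin> S" using qS L(5) pq by auto
              then show "c \<in> Rb" using ext[OF ac(1)] ac(2) QE by blast
            qed
            moreover have "i \<in> set (y # q2)" using L(4) pq q12 last_in_set[of "y # q2"] by simp
            ultimately have "i \<in> Rb" by blast
            moreover have "(i, b) \<in> E" using i(1) QE by (auto simp: tails_def)
            ultimately show False using ext br bS bRb by blast
          qed
          then show ?thesis using yV qS y unfolding X2_def by blast
        qed
        then show ?thesis using i(1) pq by blast
      qed
      have "X2 \<subseteq> Y"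
      proof (rule absorb[OF P])
        show "tails Q b \<subseteq> Y \<union> T \<union> {v}" by (rule tY[OF ab(5)])
        show "X2 \<subseteq> ?C" unfolding X2_def by blast
        show "X2 \<inter> (N - {v}) = {}"
        proof (rule ccontr)
          assume "\<not> ?thesis"
          then obtain n where n: "n \<in> X2" "n \<in> N" "n \<noteq> v" by blast
          then have "n \<noteq> b" using bY YN by blast
          then have "n \<in> Rb" unfolding Rb_def using n rN by (intro CollectI exI[of _ "[n]"]) (auto simp: X2_def)
          then show False using n(1) unfolding X2_def by blast
        qed
        show "S2 \<inter> (X2 \<union> {v}) = {}" unfolding S2_def X2_def by blast
        show "\<exists>s\<in>tails Q b. \<exists>p q. P s = p @ t # q \<and> set q \<subseteq> X2 \<union> {v}" if "t \<in> S2" for t by (rule suf[OF that])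
        fix x t assume x: "x \<in> X2" "(t, x) \<in> Q" "t \<notin> {r, v}"
        have "t \<notin> Rb" using ext[of t x] x QE unfolding X2_def by blast
        moreover have "t \<in> V" using x(2) QE EV by blast
        ultimately show "t \<in> X2 \<union> Y \<union> T \<union> S2" using x(3) unfolding X2_def S2_def by blast
      qed
      moreover have "a \<notin> Rb" using ext[OF _ ab(1) br bS(1)] bRb by blast
      ultimately have "a \<in> S2" using ab aV unfolding X2_def S2_def by blast
      from suf[OF this] obtain i p q where i: "i \<in> tails Q b" "P i = p @ a # q" "set q \<subseteq> X2 \<union> {v}" by blast
      show False
      proof (cases q)
        case Nil
        then have "i = a" using linkageD(4)[OF P i(1)] i(2) by simp
        then show False using i(1) nQ by (simp add: tails_def)
      next
        case (Cons y q')
        then have "(a, y) \<in> Q" using dipath_edge[of Q p a y q'] linkageD(1)[OF P i(1)] i(2) by simp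
        then show False using final[of y X2] i(3) Cons \<open>X2 \<subseteq> Y\<close> by auto
      qed
    next
      case False
      \<comment> \<open>Since \<open>a\<close> cannot be added here, the backward search from
        \<open>b\<close> with \<open>a\<close> as sole candidate reaches no out-neighbour of the
        root; its region can be absorbed.\<close>
      obtain J where J: "finite J" "J \<subseteq> tails Q b" "\<not> near_linkable Q b (insert a (tails F b \<union> J))"
        using un[of a b] ab(1) nQ False br by blast
      define B where "B = tails F b \<union> J"
      have Bt: "B \<subseteq> tails Q b" using J(2) FQ unfolding B_def tails_def by blast
      have aB: "a \<notin> B" using Bt nQ by (auto simp: tails_def)
      have "quasi_flame Q b" using qs bV br False by blast
      then obtain k where k: "linkage Q b B k" "finite {c \<in> tails F b. k c \<noteq> R b c}"
        using J(1,2) unfolding quasi_flame_def near_linkable_def B_def by blast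
      let ?H = "del Q {r, b}"
      have kd: "disjoint_paths ?H B k" using k(1) by (simp add: linkage_def)
      have lk': "last (k s) = s" if "s \<in> B" for s using linkageD(4)[OF k(1) that] .
      have bk: "b \<notin> set (k s)" if "s \<in> B" for s using linkageD(5)[OF k(1) that] by blast
      have bF: "b \<notin> Field ?H" by (auto simp: Field_def)
      obtain X where X: "b \<in> X" "X \<inter> hd ` k ` B = {}"
        "\<And>x y. x \<in> X \<Longrightarrow> (y, x) \<in> ?H \<or> x = b \<and> y \<in> {a} \<Longrightarrow> y \<notin> X \<Longrightarrow> \<exists>s\<in>B. \<exists>p q. k s = p @ y # q \<and> set q \<subseteq> X"
        "\<And>z. z \<in> X \<Longrightarrow> z \<noteq> b \<Longrightarrow> \<exists>c\<in>{a}. \<exists>g. disjoint_paths ?H (insert c B) g \<and> (\<forall>s\<in>insert c B. last (g s) = s) \<and>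
          hd ` g ` insert c B = insert z (hd ` k ` B) \<and> finite {s\<in>B. g s \<noteq> k s}"
        by (rule augment_rev[OF kd lk' bF bk, of "{a}"]) (assumption | rule that)+
      have XN: "z \<notin> N" if z: "z \<in> X" "z \<noteq> b" for z
      proof
        assume zN: "z \<in> N"
        obtain g where g: "disjoint_paths ?H (insert a B) g" "\<forall>s\<in>insert a B. last (g s) = s"
          "hd ` g ` insert a B = insert z (hd ` k ` B)" "finite {s\<in>B. g s \<noteq> k s}" using X(4)[OF z] by blast
        have "hd ` k ` B \<subseteq> N - {b}" using linkageD(2,3)[OF k(1)] by blast
        then have "hd ` g ` insert a B \<subseteq> N - {b}" unfolding g(3) using zN z(2) by blast
        then have "linkage Q b (insert a B) g" unfolding linkage_def using g(1,2) by blast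
        moreover have "finite {c \<in> tails F b. g c \<noteq> R b c}"
        proof (rule finite_subset)
          show "{c \<in> tails F b. g c \<noteq> R b c} \<subseteq> {c \<in> tails F b. k c \<noteq> R b c} \<union> {s\<in>B. g s \<noteq> k s}"
            by (auto simp: B_def)
        qed (use k(2) g(4) in simp)
        ultimately show False using J(3) unfolding near_linkable_def B_def by blast
      qed
      define X2 where "X2 = X \<inter> ?C - {b}"
      define S2 where "S2 = {t. t \<notin> X \<and> t \<noteq> v \<and> (\<exists>s\<in>B. \<exists>p q. k s = p @ t # q \<and> set q \<subseteq> X)}"
      have qX: "set q \<subseteq> X2 \<union> {v}" if s: "s \<in> B" "k s = p @ t # q" "set q \<subseteq> X" for s p t q
      proof -
        have "set q \<subseteq> V - {r, b}" using linkage_V[OF QE k(1) s(1)] linkageD(5)[OF k(1) s(1)] s(2) by auto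
        then show ?thesis using s(3) unfolding X2_def by blast
      qed
      have "X2 \<subseteq> Y"
      proof (rule absorb[OF k(1)])
        show "B \<subseteq> Y \<union> T \<union> {v}" using Bt tY[OF ab(5)] by blast
        show "X2 \<subseteq> ?C" unfolding X2_def by blast
        show "X2 \<inter> (N - {v}) = {}" using XN unfolding X2_def by blast
        show "S2 \<inter> (X2 \<union> {v}) = {}" unfolding S2_def X2_def by blast
        show "\<exists>s\<in>B. \<exists>p q. k s = p @ t # q \<and> set q \<subseteq> X2 \<union> {v}" if "t \<in> S2" for t
          using that qX unfolding S2_def by blast
        fix x t assume x: "x \<in> X2" "(t, x) \<in> Q" "t \<notin> {r, v}"
        have tV: "t \<in> V" using x(2) QE EV by blast
        show "t \<in> X2 \<union> Y \<union> T \<union> S2"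
        proof (cases "t = b")
          case True
          then show ?thesis using ab(5) x(3) by blast
        next
          case tb: False
          then have "(t, x) \<in> ?H" using x unfolding X2_def by auto
          then show ?thesis using X(3)[of x t] x tV tb unfolding X2_def S2_def by blast
        qed
      qed
      show False
      proof (cases "a \<in> X")
        case True
        then have "a \<in> X2" using ab aV abne unfolding X2_def by blast
        then show False using \<open>X2 \<subseteq> Y\<close> ab(2) by blast
      next
        case aX: False
        obtain s p q where s: "s \<in> B" "k s = p @ a # q" "set q \<subseteq> X" using X(3)[OF X(1), of a] aX by blast
        show False
        proof (cases q)
          case Nil
          then have "s = a" using lk'[OF s(1)] s(2) by simp
          then show False using s(1) aB by blast
        next
          case (Cons y q')
          then have "(a, y) \<in> Q" using dipath_edge[of Q p a y q'] linkageD(1)[OF k(1) s(1)] s(2) by simp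
          then show False using final[of y X2] qX[OF s] Cons \<open>X2 \<subseteq> Y\<close> by auto
        qed
      qed
    qed
  qed
  have "separates v T"
    unfolding separates_def
  proof (intro conjI allI impI Trv notI)
    fix p assume p: "dipath E p" "hd p \<in> N - {v}" "last p = v" "r \<notin> set p" "set p \<inter> T = {}"
    have "hd p \<notin> Y \<union> {v}" using p(2) YN by blast
    then obtain q a b w where w: "p = q @ a # b # w" "a \<notin> Y \<union> {v}" "b \<in> Y \<union> {v}"
      using path_enter[of p "Y \<union> {v}"] p(3) dipath_ne[OF p(1)] by blast
    have "(a, b) \<in> E" using dipath_edge[of E q a b w] p(1) w(1) by simp
    then show False using claim[of a b] w p(4,5) by auto
  qed
  then show ?thesis using Y(1) g unfolding T_def by blast
qed

text \<open>Outside the wave, reversed paths lead from the out-neighbours of the root to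
  \<open>T\<close>. Inside, Pym's theorem merges the reversed wave with the ends of a linkage of
  \<open>A\<close>: every vertex of \<open>T\<close> starts a path and all of \<open>A\<close> is
  reached. Joined at \<open>T\<close>, the paths cross it once each.\<close>

lemma next_vertex:
  assumes QE: "Q \<subseteq> E" and FQ: "F \<subseteq> Q" and v: "v \<in> V" "v \<noteq> r" and vD: "v \<notin> D"
    and dn: "\<And>b. b \<in> D \<Longrightarrow> \<exists>g S. linkage Q b (tails Q b) g \<and> separates b S \<and> meets_once (tails Q b) g S"
    and qs: "\<And>b. b \<in> V - {r} - D \<Longrightarrow> quasi_flame Q b"
    and un: "\<And>a b. (a, b) \<in> E - Q \<Longrightarrow> b \<notin> D \<Longrightarrow> b \<noteq> r \<Longrightarrow>
        \<exists>J. finite J \<and> J \<subseteq> tails Q b \<and> \<not> near_linkable Q b (insert a (tails F b \<union> J))"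
    and J: "finite J0" "J0 \<subseteq> tails Q v"
  shows "\<exists>I g S. tails F v \<union> J0 \<subseteq> I \<and> I \<subseteq> tails Q v \<and> linkage Q v I g \<and> separates v S \<and> meets_once I g S \<and>
    (\<forall>u\<in>V - {r} - insert v D. quasi_flame (trim Q v I) u)"
proof -
  let ?W = "(del Q {r, v})\<inverse>" and ?A = "tails Q v" and ?Q = "del Q {r, v}"
  obtain Y T f g where Y: "wave ?W ?A (N - {v}) Y f" and T: "T = boundary ?W ?A Y" and sep: "separates v T"
    and g: "disjoint_paths (del ?W Y) T g" "\<forall>t\<in>T. hd (g t) = t \<and> last (g t) \<in> N - {v}"
    using separator[OF QE FQ v vD dn qs un] by blast
  have fY: "fan ?W ?A Y T f" using Y T by (simp add: wave_def)
  have qv: "quasi_flame Q v" using qs v vD by blast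
  have U: "V - {r} - insert v D \<subseteq> V - {r, v}" by blast
  have qU: "quasi_flame Q u" if "u \<in> V - {r} - insert v D" for u using qs that by blast
  obtain A h where A: "tails F v \<union> J0 \<subseteq> A" "A \<subseteq> ?A" "linkage Q v A h"
    "\<forall>B. A \<subseteq> B \<longrightarrow> (\<forall>u\<in>V - {r} - insert v D. quasi_flame (trim Q v B) u)"
    using trim_choice[OF QE FQ v qv J U qU] by blast
  have AT: "?A \<subseteq> Y \<union> T" using T by (auto simp: boundary_def)
  have YT: "Y \<inter> T = {}" using T by (auto simp: boundary_def)
  have WT: "y \<in> Y \<union> T" if "x \<in> Y" "(x, y) \<in> ?W" for x y using that T by (auto simp: boundary_def)
  \<comment> \<open>\<open>T\<close> separates in \<open>E\<close>, so each path of \<open>h\<close>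
    crosses it; behind the last crossing the path, read backwards from an in-neighbour of
    \<open>v\<close>, cannot leave \<open>Y\<close>.\<close>
  have "\<forall>i\<in>A. \<exists>l. \<exists>u t w. h i = u @ t # w \<and> t \<in> T \<and> set w \<subseteq> Y \<and> l = t # w"
  proof
    fix i assume i: "i \<in> A"
    note L = linkageD[OF A(3) i]
    have iv: "(i, v) \<in> Q" "i \<noteq> r" using i A(2) by (auto simp: tails_def)
    have "dipath E (h i @ [v])"
      using dipath_append[OF L(6), of "[v]" E] dipath_mono[OF L(1) QE] iv QE L(4,5) by auto
    moreover have "hd (h i @ [v]) \<in> N - {v}" "last (h i @ [v]) = v" "r \<notin> set (h i @ [v])" using L v by auto
    ultimately have "set (h i @ [v]) \<inter> T \<noteq> {}" using sep unfolding separates_def by blast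
    moreover have "v \<notin> T" using sep unfolding separates_def by blast
    ultimately have "set (h i) \<inter> T \<noteq> {}" by auto
    from split_last_in[OF this] obtain u t w where w: "h i = u @ t # w" "t \<in> T" "set w \<inter> T = {}" by blast
    have "set w \<subseteq> Y"
    proof (cases "w = []")
      case False
      have "dipath ?Q w" using L(7) w(1) dipath_appendD2[of ?Q "u @ [t]" w] False by simp
      then have pw: "dipath ?W (rev w)" by simp
      have "hd (rev w) = i" using False L(4) w(1) by (simp add: hd_rev)
      then have "hd (rev w) \<in> Y" using AT A(2) i w(3) False hd_in_set[of "rev w"] by auto
      from dipath_closed[OF pw this] have "set (rev w) \<subseteq> Y" using WT w(3) by auto
      then show ?thesis by simp
    qed simp
    then show "\<exists>l. \<exists>u t w. h i = u @ t # w \<and> t \<in> T \<and> set w \<subseteq> Y \<and> l = t # w" using w by blast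
  qed
  then obtain q where q: "\<forall>i\<in>A. \<exists>u t w. h i = u @ t # w \<and> t \<in> T \<and> set w \<subseteq> Y \<and> q i = t # w"
    by (rule bchoice[THEN exE])
  have qsub: "set (q i) \<subseteq> set (h i)" "set (q i) \<subseteq> T \<union> Y" "hd (q i) \<in> T" "last (q i) = i" "dipath ?Q (q i)" if i: "i \<in> A" for i
  proof -
    obtain u t w where w: "h i = u @ t # w" "t \<in> T" "set w \<subseteq> Y" "q i = t # w" using q i by blast
    note L = linkageD[OF A(3) i]
    show "set (q i) \<subseteq> set (h i)" "set (q i) \<subseteq> T \<union> Y" "hd (q i) \<in> T" using w by auto
    show "last (q i) = i" using w L(4) by simp
    show "dipath ?Q (q i)" using w L(7) dipath_appendD2[of ?Q u "t # w"] by simp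
  qed
  have dq: "disjoint_paths ?Q A q"
  proof (rule disjoint_pathsI)
    show "dipath ?Q (q i)" if "i \<in> A" for i by (rule qsub(5)[OF that])
    show "i = j" if "i \<in> A" "j \<in> A" "x \<in> set (q i)" "x \<in> set (q j)" for i j x
      using linkage_eq[OF A(3) that(1,2), of x] qsub(1) that by blast
  qed
  define P where "P t = rev (f t)" for t
  have dP: "disjoint_paths ?Q T P"
  proof (rule disjoint_pathsI)
    show "dipath ?Q (P t)" if "t \<in> T" for t unfolding P_def using dipath_revI[OF fanD(1)[OF fY that]] .
    show "s = t" if "s \<in> T" "t \<in> T" "x \<in> set (P s)" "x \<in> set (P t)" for s t x
      using disjoint_paths_eq[OF fan_dpf[OF fY] that(1,2), of x] that(3,4) by (simp add: P_def)
  qed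
  have P: "hd (P t) = t" "last (P t) \<in> ?A" "set (P t) \<subseteq> T \<union> Y" if "t \<in> T" for t
    using fanD[OF fY that] that by (auto simp: P_def hd_rev last_rev)
  have "\<exists>R. disjoint_paths ?Q T R \<and> (\<forall>t\<in>T. hd (R t) = t) \<and> A \<subseteq> last ` R ` T \<and> last ` R ` T \<subseteq> A \<union> last ` P ` T \<and>
    (\<forall>t\<in>T. set (R t) \<subseteq> (\<Union>t\<in>T. set (P t)) \<union> (\<Union>s\<in>A. set (q s)))"
    by (rule pym[OF dP P(1) dq]) (use qsub in auto)
  then obtain R' where R': "disjoint_paths ?Q T R'" "\<forall>t\<in>T. hd (R' t) = t" "A \<subseteq> last ` R' ` T" "last ` R' ` T \<subseteq> A \<union> last ` P ` T"
    "\<forall>t\<in>T. set (R' t) \<subseteq> (\<Union>t\<in>T. set (P t)) \<union> (\<Union>s\<in>A. set (q s))" by (elim exE conjE) (rule that)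
  have RYT: "set (R' t) \<subseteq> T \<union> Y" if "t \<in> T" for t using R'(5) that P(3) qsub(2) by blast
  define L where "L t = rev (g t)" for t
  have gW: "dipath ?W (g t)" "set (g t) \<inter> Y = {}" if t: "t \<in> T" for t
  proof -
    show "dipath ?W (g t)" using disjoint_pathsD[OF g(1) t] by (rule dipath_delD)
    have "hd (g t) \<notin> Y" using g(2) t YT by auto
    then show "set (g t) \<inter> Y = {}" using dipath_del_avoid[OF disjoint_pathsD[OF g(1) t]] by blast
  qed
  have dL: "disjoint_paths ?Q T L"
  proof (rule disjoint_pathsI)
    show "dipath ?Q (L t)" if "t \<in> T" for t unfolding L_def using dipath_revI[OF gW(1)[OF that]] .
    show "s = t" if "s \<in> T" "t \<in> T" "x \<in> set (L s)" "x \<in> set (L t)" for s t x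
      using disjoint_paths_eq[OF g(1) that(1,2), of x] that(3,4) by (simp add: L_def)
  qed
  have Lne: "L t \<noteq> []" if "t \<in> T" for t using dipath_ne[OF disjoint_pathsD[OF dL that]] .
  have L: "last (L t) = t" "hd (L t) \<in> N - {v}" if "t \<in> T" for t
    using g(2) that dipath_ne[OF gW(1)[OF that]] by (auto simp: L_def hd_rev last_rev)
  have Rne: "R' t \<noteq> []" if "t \<in> T" for t using dipath_ne[OF disjoint_pathsD[OF R'(1) that]] .
  \<comment> \<open>Every vertex of \<open>T\<close> heads its own path of \<open>R'\<close>, so
    none occurs later on a path.\<close>
  have noT: "y \<in> Y" if t: "t \<in> T" and y: "y \<in> set (tl (R' t))" for t y
  proof -
    have yR: "y \<in> set (R' t)" using y Rne[OF t] by (metis list.set_sel(2))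
    have "y \<notin> T"
    proof
      assume yT: "y \<in> T"
      have "y \<in> set (R' y)" using R'(2) yT hd_in_set[OF Rne[OF yT]] by simp
      then have "y = t" using disjoint_paths_eq[OF R'(1) yT t _ yR] by blast
      then have "hd (R' t) \<in> set (tl (R' t))" using R'(2) t y by simp
      then show False using disjoint_pathsD[OF R'(1) t] Rne[OF t] by (cases "R' t") (auto simp: dipath_def)
    qed
    then show ?thesis using RYT[OF t] yR by blast
  qed
  let ?G = "\<lambda>t. if t \<in> T then L t @ tl (R' t) else L t"
  have G: "disjoint_paths ?Q T ?G" "\<And>t. t \<in> T \<Longrightarrow> hd (?G t) = hd (L t)" "\<And>t. t \<in> T \<Longrightarrow> last (?G t) = last (R' t)"
  proof -
    have hl: "hd (R' t) = last (L t)" if "t \<in> T" for t using R'(2) L(1) that by simp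
    have dj: "set (tl (R' s)) \<inter> set (L t) = {}" if "s \<in> T" "t \<in> T" for s t
      using noT[OF that(1)] gW(2)[OF that(2)] by (auto simp: L_def)
    show "disjoint_paths ?Q T ?G" "\<And>t. t \<in> T \<Longrightarrow> hd (?G t) = hd (L t)" "\<And>t. t \<in> T \<Longrightarrow> last (?G t) = last (R' t)"
      using disjoint_paths_extend[OF dL order_refl R'(1)] hl dj by blast+
  qed
  obtain k where k: "disjoint_paths ?Q (last ` ?G ` T) k" "\<forall>t\<in>T. k (last (?G t)) = ?G t" using reindex_last[OF G(1)] by blast
  define I where "I = last ` ?G ` T"
  have IR: "I = last ` R' ` T" unfolding I_def image_image using G(3) by (rule image_cong[OF refl])
  have kI: "\<exists>t\<in>T. i = last (?G t) \<and> k i = ?G t" if "i \<in> I" for i using that k(2) unfolding I_def by blast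
  have n1: "linkage Q v I k"
    unfolding linkage_def
  proof (intro conjI ballI)
    show "disjoint_paths ?Q I k" using k(1) unfolding I_def .
    fix i assume "i \<in> I"
    then obtain t where t: "t \<in> T" "i = last (?G t)" "k i = ?G t" using kI by blast
    show "hd (k i) \<in> N - {v}" unfolding t(3) G(2)[OF t(1)] by (rule L(2)[OF t(1)])
    show "last (k i) = i" unfolding t(3) by (rule t(2)[symmetric])
  qed
  have n2: "meets_once I k T"
    unfolding meets_once_def
  proof (intro conjI ballI subsetI)
    fix i assume "i \<in> I"
    then obtain t where t: "t \<in> T" "k i = ?G t" using kI by blast
    have tin: "t \<in> set (L t)" if "t \<in> T" for t using L(1)[OF that] last_in_set[OF Lne[OF that]] by simp
    have "s = t" if s: "s \<in> set (?G t)" "s \<in> T" for s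
    proof -
      have "s \<in> set (L t)" using s t(1) noT[OF t(1), of s] YT by auto
      then show ?thesis using disjoint_paths_eq[OF dL s(2) t(1), of s] tin[OF s(2)] by blast
    qed
    moreover have "t \<in> set (?G t)" using tin[OF t(1)] t(1) by simp
    ultimately show "\<exists>!s. s \<in> set (k i) \<and> s \<in> T" unfolding t(2) using t(1) by blast
  next
    fix t assume t: "t \<in> T"
    have tG: "t \<in> set (?G t)" using L(1)[OF t] last_in_set[OF Lne[OF t]] t by simp
    have e: "k (last (?G t)) = ?G t" using k(2) t by (rule bspec)
    have "last (?G t) \<in> I" unfolding I_def using t by (intro imageI)
    moreover have "t \<in> set (k (last (?G t)))" unfolding e by (rule tG)
    ultimately show "t \<in> (\<Union>i\<in>I. set (k i))" by (rule UN_I)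
  qed
  have "last ` P ` T \<subseteq> ?A" using P(2) by (auto simp only: image_subset_iff)
  then have n3: "I \<subseteq> ?A" using R'(4) A(2) unfolding IR by (meson Un_least subset_trans)
  have AI: "A \<subseteq> I" using R'(3) unfolding IR .
  have n4: "tails F v \<union> J0 \<subseteq> I" using A(1) AI by blast
  have n5: "\<forall>u\<in>V - {r} - insert v D. quasi_flame (trim Q v I) u" by (rule A(4)[THEN spec, THEN mp, OF AI])
  show ?thesis by (rule exI[of _ I], rule exI[of _ k], rule exI[of _ T], intro conjI n1 n2 n3 n4 n5 sep)
qed

end

section \<open>Construction of the large flame\<close>

lemma is_path_pth: "is_path V E p \<longleftrightarrow> dipath E p \<and> set p \<subseteq> V"
  unfolding is_path_def dipath_def successively_conv_nth by auto

context rooted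
begin

text \<open>Zorn's lemma applies because a finite \<open>J\<close> in the union of a chain already
  lies in one member. Adding an edge can violate the condition only at its head, and the violating
  finite set is the witness.\<close>

lemma maximal_quasi:
  assumes FR: "\<forall>u\<in>V - {r}. linkage F u (tails F u) (R u)"
  shows "\<exists>Q. F \<subseteq> Q \<and> Q \<subseteq> E \<and> (\<forall>u\<in>V - {r}. quasi_flame Q u) \<and>
    (\<forall>a b. (a, b) \<in> E - Q \<longrightarrow> (\<exists>J. finite J \<and> J \<subseteq> tails Q b \<and> \<not> near_linkable Q b (insert a (tails F b \<union> J))))"
proof -
  define \<A> where "\<A> = {H. F \<subseteq> H \<and> H \<subseteq> E \<and> (\<forall>u\<in>V - {r}. quasi_flame H u)}"
  have "quasi_flame F u" if "u \<in> V - {r}" for u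
    unfolding quasi_flame_def
  proof (intro allI impI)
    fix J assume J: "finite J" "J \<subseteq> tails F u"
    have "near_linkable F u (tails F u)" unfolding near_linkable_def using FR that by (intro exI[of _ "R u"]) simp
    then show "near_linkable F u (tails F u \<union> J)" by (rule near_linkable_sub) (use J in blast)
  qed
  then have ne: "\<A> \<noteq> {}" using FE unfolding \<A>_def by blast
  have un: "\<Union>C \<in> \<A>" if C: "C \<noteq> {}" "subset.chain \<A> C" for C
  proof -
    have CA: "C \<subseteq> \<A>" using C(2) by (simp add: subset.chain_def)
    have "quasi_flame (\<Union>C) u" if u: "u \<in> V - {r}" for u
      unfolding quasi_flame_def
    proof (intro allI impI)
      fix J assume J: "finite J" "J \<subseteq> tails (\<Union>C) u"
      have "J \<times> {u} \<subseteq> \<Union>C" using J(2) by (auto simp: tails_def)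
      moreover have "finite (J \<times> {u})" using J(1) by simp
      ultimately obtain H where H: "H \<in> C" "J \<times> {u} \<subseteq> H" using finite_subset_Union_chain C by metis
      have "J \<subseteq> tails H u" using H(2) J(2) by (auto simp: tails_def)
      moreover have "quasi_flame H u" using H(1) CA u unfolding \<A>_def by blast
      ultimately have "near_linkable H u (tails F u \<union> J)" using J(1) unfolding quasi_flame_def by blast
      then show "near_linkable (\<Union>C) u (tails F u \<union> J)" by (rule near_linkable_mono) (use H(1) in blast)
    qed
    then show ?thesis using CA C(1) unfolding \<A>_def by blast
  qed
  from subset_Zorn_nonempty[OF ne un] obtain Q where Q: "Q \<in> \<A>" "\<forall>X\<in>\<A>. Q \<subseteq> X \<longrightarrow> X = Q" by blast
  have Q': "F \<subseteq> Q" "Q \<subseteq> E" "\<And>u. u \<in> V - {r} \<Longrightarrow> quasi_flame Q u" using Q(1) unfolding \<A>_def by blast+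
  have mx: "\<exists>J. finite J \<and> J \<subseteq> tails Q b \<and> \<not> near_linkable Q b (insert a (tails F b \<union> J))" if ab: "(a, b) \<in> E - Q" for a b
  proof -
    let ?H = "insert (a, b) Q"
    have "?H \<notin> \<A>" using Q(2) ab by blast
    then obtain u where u: "u \<in> V - {r}" "\<not> quasi_flame ?H u" using Q' ab unfolding \<A>_def by blast
    obtain J where J: "finite J" "J \<subseteq> tails ?H u" "\<not> near_linkable ?H u (tails F u \<union> J)" using u(2) unfolding quasi_flame_def by blast
    have QH: "Q \<subseteq> ?H" by blast
    have "u = b"
    proof (rule ccontr)
      assume "u \<noteq> b"
      then have "J \<subseteq> tails Q u" using J(2) by (auto simp: tails_def)
      then have "near_linkable Q u (tails F u \<union> J)" using Q'(3)[OF u(1)] J(1) unfolding quasi_flame_def by blast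
      then show False using J(3) near_linkable_mono QH by blast
    qed
    have "\<not> near_linkable Q b (insert a (tails F b \<union> (J - {a})))"
    proof
      assume "near_linkable Q b (insert a (tails F b \<union> (J - {a})))"
      then have "near_linkable Q b (tails F b \<union> J)" by (rule near_linkable_sub) blast
      then show False using J(3) near_linkable_mono QH \<open>u = b\<close> by blast
    qed
    moreover have "J - {a} \<subseteq> tails Q b" using J(2) \<open>u = b\<close> by (auto simp: tails_def)
    ultimately show ?thesis using J(1) by blast
  qed
  show ?thesis by (rule exI[of _ Q], intro conjI ballI allI impI Q' mx)
qed

text \<open>Trimming at \<open>v\<close> harms an earlier linkage only if the predecessor of
  \<open>v\<close> on it is dropped. There is at most one per treated vertex, so these predecessors
  form a finite set \<open>J0\<close>, which is retained; thus finished linkages stay valid in the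
  intersection.\<close>

lemma large_flame:
  assumes FR: "\<forall>u\<in>V - {r}. linkage F u (tails F u) (R u)"
  shows "\<exists>L. F \<subseteq> L \<and> L \<subseteq> E \<and>
    (\<forall>v\<in>V - {r}. \<exists>g S. linkage L v (tails L v) g \<and> separates v S \<and> meets_once (tails L v) g S)"
proof (cases "V - {r} = {}")
  case True then show ?thesis using FE by blast
next
  case ne: False
  obtain Q0 where Q0: "F \<subseteq> Q0" "Q0 \<subseteq> E" "\<forall>u\<in>V - {r}. quasi_flame Q0 u"
    "\<forall>a b. (a, b) \<in> E - Q0 \<longrightarrow> (\<exists>J. finite J \<and> J \<subseteq> tails Q0 b \<and> \<not> near_linkable Q0 b (insert a (tails F b \<union> J)))"
    using maximal_quasi[OF FR] by (elim exE conjE) (rule that)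
  define c where "c = from_nat_into (V - {r})"
  have c: "c n \<in> V - {r}" for n unfolding c_def by (rule from_nat_into[OF ne])
  define inv where "inv = (\<lambda>(Q, D, G). F \<subseteq> Q \<and> Q \<subseteq> Q0 \<and> finite D \<and> D \<subseteq> V - {r} \<and>
    (\<forall>x u. u \<notin> D \<longrightarrow> (x, u) \<in> Q0 \<longrightarrow> (x, u) \<in> Q) \<and> (\<forall>u\<in>V - {r} - D. quasi_flame Q u) \<and>
    (\<forall>b\<in>D. linkage Q b (tails Q b) (G b) \<and> (\<exists>S. separates b S \<and> meets_once (tails Q b) (G b) S)))"
  let ?P = "\<lambda>(n::nat). inv"
  let ?Q = "\<lambda>n (Q, D, G) (Q', D', G'). Q' \<subseteq> Q \<and> D \<subseteq> D' \<and> c n \<in> D' \<and> (\<forall>b\<in>D. G' b = G b \<and> tails Q' b = tails Q b)"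
  have "\<exists>s. \<forall>n. ?P n (s n) \<and> ?Q n (s n) (s (Suc n))"
  proof (rule dependent_nat_choice)
    have "inv (Q0, {}, \<lambda>b i. [])" unfolding inv_def using Q0(1,3) by auto
    then show "\<exists>s. ?P 0 s" by blast
    show "\<exists>s'. ?P (Suc n) s' \<and> ?Q n s s'" if sn: "?P n s" for s n
    proof -
      obtain Q D G where s: "s = (Q, D, G)" by (metis prod_cases3)
      have I: "F \<subseteq> Q" "Q \<subseteq> Q0" "finite D" "D \<subseteq> V - {r}" "\<forall>x u. u \<notin> D \<longrightarrow> (x, u) \<in> Q0 \<longrightarrow> (x, u) \<in> Q"
        "\<forall>u\<in>V - {r} - D. quasi_flame Q u"
        "\<forall>b\<in>D. linkage Q b (tails Q b) (G b) \<and> (\<exists>S. separates b S \<and> meets_once (tails Q b) (G b) S)"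
        using sn unfolding s inv_def prod.case by simp_all
      let ?v = "c n"
      show ?thesis
      proof (cases "?v \<in> D")
        case True
        then show ?thesis using sn s by (intro exI[of _ s]) auto
      next
        case vD: False
        have QE: "Q \<subseteq> E" using I(2) Q0(2) by blast
        define pre where "pre b = {x. x \<noteq> r \<and> (\<exists>i\<in>tails Q b. \<exists>p q. G b i = p @ x # ?v # q)}" for b
        define J0 where "J0 = (\<Union>b\<in>D. pre b)"
        have one: "x = y" if "b \<in> D" "x \<in> pre b" "y \<in> pre b" for b x y
        proof -
          have l: "linkage Q b (tails Q b) (G b)" using I(7) that(1) by blast
          obtain i p q where i: "i \<in> tails Q b" "G b i = p @ x # ?v # q"
            using \<open>x \<in> pre b\<close> unfolding pre_def by blast
          obtain j p' q' where j: "j \<in> tails Q b" "G b j = p' @ y # ?v # q'"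
            using \<open>y \<in> pre b\<close> unfolding pre_def by blast
          have "i = j" using linkage_eq[OF l i(1) j(1), of ?v] i(2) j(2) by simp
          then have e: "(p @ [x]) @ ?v # q = (p' @ [y]) @ ?v # q'" using i(2) j(2) by simp
          have "distinct (G b i)" using linkageD(1)[OF l i(1)] by (simp add: dipath_def)
          then have "?v \<notin> set (p @ [x])" "?v \<notin> set q" using i(2) by auto
          then have "p @ [x] = p' @ [y]" using e append_Cons_eq_iff[of ?v "p @ [x]" q "p' @ [y]" q'] by auto
          then show ?thesis by simp
        qed
        have "finite (pre b)" if "b \<in> D" for b
        proof (cases "pre b = {}")
          case False
          then obtain x where "x \<in> pre b" by blast
          then have "pre b \<subseteq> {x}" using one that by blast
          then show ?thesis using finite_subset by blast
        qed simp
        then have fJ: "finite J0" using I(3) unfolding J0_def by blast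
        have pre_edge: "(x, ?v) \<in> Q" if "b \<in> D" "x \<in> pre b" for b x
        proof -
          have l: "linkage Q b (tails Q b) (G b)" using I(7) that(1) by blast
          obtain i p q where i: "i \<in> tails Q b" "G b i = p @ x # ?v # q"
            using \<open>x \<in> pre b\<close> unfolding pre_def by blast
          show ?thesis using dipath_edge[of Q p x ?v q] linkageD(1)[OF l i(1)] i(2) by simp
        qed
        have Jt: "J0 \<subseteq> tails Q ?v" using pre_edge unfolding J0_def tails_def pre_def by blast
        have v: "?v \<in> V" "?v \<noteq> r" using c[of n] by blast+
        have dn: "\<exists>g S. linkage Q b (tails Q b) g \<and> separates b S \<and> meets_once (tails Q b) g S" if "b \<in> D" for b
          using I(7) that by blast
        have qs: "quasi_flame Q b" if "b \<in> V - {r} - D" for b using I(6) that by blast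
        \<comment> \<open>Edges into an untreated vertex are still those of \<open>Q0\<close>, and
          shrinking the digraph cannot restore linkability, so the witnesses of maximality
          persist.\<close>
        have un: "\<exists>J. finite J \<and> J \<subseteq> tails Q b \<and> \<not> near_linkable Q b (insert a (tails F b \<union> J))"
          if ab: "(a, b) \<in> E - Q" "b \<notin> D" "b \<noteq> r" for a b
        proof -
          have "(a, b) \<in> E - Q0" using ab(1,2) I(5) by blast
          then obtain J where J: "finite J" "J \<subseteq> tails Q0 b" "\<not> near_linkable Q0 b (insert a (tails F b \<union> J))" using Q0(4) by blast
          have "tails Q0 b \<subseteq> tails Q b" using ab(2) I(5) by (auto simp: tails_def)
          moreover have "\<not> near_linkable Q b (insert a (tails F b \<union> J))" using J(3) near_linkable_mono I(2) by blast
          ultimately show ?thesis using J(1,2) by blast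
        qed
        have "\<exists>A g S. tails F ?v \<union> J0 \<subseteq> A \<and> A \<subseteq> tails Q ?v \<and> linkage Q ?v A g \<and> separates ?v S \<and> meets_once A g S \<and>
          (\<forall>u\<in>V - {r} - insert ?v D. quasi_flame (trim Q ?v A) u)"
          by (rule next_vertex[OF QE I(1) v vD dn qs un fJ Jt])
        then obtain A g S where A: "tails F ?v \<union> J0 \<subseteq> A" "A \<subseteq> tails Q ?v" "linkage Q ?v A g" "separates ?v S" "meets_once A g S"
          "\<forall>u\<in>V - {r} - insert ?v D. quasi_flame (trim Q ?v A) u"
          by (elim exE conjE) (rule that)
        let ?Q' = "trim Q ?v A" and ?G = "G(?v := g)"
        have tv: "tails ?Q' ?v = A" using A(2) by (auto simp: tails_def)
        have tb: "tails ?Q' b = tails Q b" if "b \<in> D" for b using that vD by (intro tails_trim) blast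
        have lb: "linkage ?Q' b (tails Q b) (G b)" if b: "b \<in> D" for b
        proof (rule linkageI)
          have l: "linkage Q b (tails Q b) (G b)" using I(7) b by blast
          fix i assume i: "i \<in> tails Q b"
          have "dipath ?Q' (G b i)"
          proof (rule dipath_steps[OF linkageD(1)[OF l i]])
            fix q x y w assume xy: "G b i = q @ x # y # w" "(x, y) \<in> Q"
            have "x = r \<or> x \<in> A" if "y = ?v"
            proof (cases "x = r")
              case False
              then have "x \<in> pre b" using xy(1) i that unfolding pre_def by blast
              then show ?thesis using b A(1) unfolding J0_def by blast
            qed simp
            then show "(x, y) \<in> ?Q'" using xy(2) by simp
          qed
          then show "dipath ?Q' (G b i) \<and> hd (G b i) \<in> N \<and> last (G b i) = i \<and> r \<notin> set (G b i) \<and> b \<notin> set (G b i)"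
            using linkageD[OF l i] by auto
        next
          have l: "linkage Q b (tails Q b) (G b)" using I(7) b by blast
          show "s = t" if "s \<in> tails Q b" "t \<in> tails Q b" "x \<in> set (G b s)" "x \<in> set (G b t)" for s t x
            using linkage_eq[OF l] that by blast
        qed
        have lv: "linkage ?Q' ?v A g"
        proof (rule linkageI)
          fix i assume i: "i \<in> A"
          note L = linkageD[OF A(3) i]
          have "dipath ?Q' (g i)"
          proof (rule dipath_steps[OF L(1)])
            fix q x y w assume xy: "g i = q @ x # y # w" "(x, y) \<in> Q"
            then have "y \<noteq> ?v" using L(5) by auto
            then show "(x, y) \<in> ?Q'" using xy(2) by simp
          qed
          then show "dipath ?Q' (g i) \<and> hd (g i) \<in> N \<and> last (g i) = i \<and> r \<notin> set (g i) \<and> ?v \<notin> set (g i)"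
            using L by auto
        qed (rule linkage_eq[OF A(3)])
        have i1: "F \<subseteq> ?Q'" using I(1) A(1) by (auto simp: trim_def tails_def)
        have i2: "?Q' \<subseteq> Q0" using trim_subset[of Q ?v A] I(2) by blast
        have i3: "\<forall>x u. u \<notin> insert ?v D \<longrightarrow> (x, u) \<in> Q0 \<longrightarrow> (x, u) \<in> ?Q'" using I(5) by simp
        have i4: "\<forall>b\<in>insert ?v D. linkage ?Q' b (tails ?Q' b) (?G b) \<and> (\<exists>S. separates b S \<and> meets_once (tails ?Q' b) (?G b) S)"
        proof
          fix b assume "b \<in> insert ?v D"
          then show "linkage ?Q' b (tails ?Q' b) (?G b) \<and> (\<exists>S. separates b S \<and> meets_once (tails ?Q' b) (?G b) S)"
          proof (cases "b = ?v")
            case True then show ?thesis using lv tv A(4,5) by auto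
          next
            case False
            then have b: "b \<in> D" using \<open>b \<in> insert ?v D\<close> by blast
            have "?G b = G b" using False by simp
            then show ?thesis using lb[OF b] I(7) b tb[OF b] by metis
          qed
        qed
        have i5: "insert ?v D \<subseteq> V - {r}" using I(4) v by blast
        have "inv (?Q', insert ?v D, ?G)"
          unfolding inv_def prod.case using I(3) by (intro conjI i1 i2 i3 i4 i5 A(6)) simp
        moreover have "?Q n (Q, D, G) (?Q', insert ?v D, ?G)"
          using trim_subset[of Q ?v A] tb vD by auto
        ultimately show ?thesis unfolding s by blast
      qed
    qed
  qed
  then obtain s where s': "\<forall>n. ?P n (s n) \<and> ?Q n (s n) (s (Suc n))" by (elim exE) (rule that)
  have s: "inv (s n)" "?Q n (s n) (s (Suc n))" for n
    using s'[rule_format, of n] by (rule conjunct1, rule conjunct2)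
  define Q D G where "Q n = fst (s n)" and "D n = fst (snd (s n))" and "G n = snd (snd (s n))" for n
  have ss: "s n = (Q n, D n, G n)" for n by (simp add: Q_def D_def G_def)
  have I: "F \<subseteq> Q n" "Q n \<subseteq> Q0" "\<forall>b\<in>D n. linkage (Q n) b (tails (Q n) b) (G n b) \<and> (\<exists>S. separates b S \<and> meets_once (tails (Q n) b) (G n b) S)" for n
    using s(1)[of n] unfolding ss inv_def prod.case by simp_all
  have st: "Q (Suc n) \<subseteq> Q n" "D n \<subseteq> D (Suc n)" "c n \<in> D (Suc n)"
    "\<forall>b\<in>D n. G (Suc n) b = G n b \<and> tails (Q (Suc n)) b = tails (Q n) b" for n
    using s(2)[of n] unfolding ss prod.case by simp_all
  have Qm: "Q m \<subseteq> Q n" if "n \<le> m" for n m by (rule lift_Suc_antimono_le[of Q, OF st(1) that])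
  have Dm: "D n \<subseteq> D m" if "n \<le> m" for n m by (rule lift_Suc_mono_le[of D, OF st(2) that])
  have const: "G m b = G n b \<and> tails (Q m) b = tails (Q n) b" if "b \<in> D n" "n \<le> m" for n m b
    using that(2)
  proof (induction m rule: dec_induct)
    case (step k)
    have "b \<in> D k" using Dm[OF step(1)] that(1) by blast
    then show ?case using st(4)[of k] step.IH by simp
  qed simp
  define L where "L = (\<Inter>n. Q n)"
  have "\<exists>g S. linkage L v (tails L v) g \<and> separates v S \<and> meets_once (tails L v) g S" if v: "v \<in> V - {r}" for v
  proof -
    have "countable (V - {r})" using cV by blast
    from from_nat_into_surj[OF this v] obtain n where "c n = v" unfolding c_def by blast
    then have vD: "v \<in> D (Suc n)" using st(3) by blast
    let ?n = "Suc n"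
    \<comment> \<open>The in-edges of \<open>v\<close> are frozen once \<open>v\<close> has been
      treated, and the digraphs decrease.\<close>
    have tL: "tails L v = tails (Q ?n) v"
    proof
      show "tails L v \<subseteq> tails (Q ?n) v" by (auto simp: L_def tails_def)
      show "tails (Q ?n) v \<subseteq> tails L v"
      proof
        fix x assume x: "x \<in> tails (Q ?n) v"
        have "(x, v) \<in> Q m" for m
        proof (cases "?n \<le> m")
          case True
          then have "x \<in> tails (Q m) v" using const[OF vD True] x by simp
          then show ?thesis by (simp add: tails_def)
        next
          case False
          then have "Q ?n \<subseteq> Q m" by (intro Qm) simp
          then show ?thesis using x by (auto simp: tails_def)
        qed
        then show "x \<in> tails L v" using x by (simp add: L_def tails_def)
      qed
    qed
    have lm: "linkage (Q m) v (tails L v) (G ?n v)" if "?n \<le> m" for m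
    proof -
      have "v \<in> D m" using Dm[OF that] vD by blast
      then have "linkage (Q m) v (tails (Q m) v) (G m v)" using I(3) by blast
      then show ?thesis using const[OF vD that] tL by simp
    qed
    have l0: "linkage (Q ?n) v (tails L v) (G ?n v)" by (rule lm) simp
    have "linkage L v (tails L v) (G ?n v)"
    proof (rule linkageI)
      fix i assume i: "i \<in> tails L v"
      note K = linkageD[OF l0 i]
      have "dipath L (G ?n v i)"
      proof (rule dipath_steps[OF K(1)])
        fix q a b w assume ab: "G ?n v i = q @ a # b # w"
        have "(a, b) \<in> Q m" for m
        proof -
          let ?m = "max ?n m"
          have "(a, b) \<in> Q ?m" using dipath_edge[of "Q ?m" q a b w] linkageD(1)[OF lm[of ?m] i] ab by simp
          then show ?thesis using Qm[of m ?m] by auto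
        qed
        then show "(a, b) \<in> L" by (simp add: L_def)
      qed
      then show "dipath L (G ?n v i) \<and> hd (G ?n v i) \<in> N \<and> last (G ?n v i) = i \<and> r \<notin> set (G ?n v i) \<and> v \<notin> set (G ?n v i)"
        using K by auto
    qed (rule linkage_eq[OF l0])
    moreover obtain S where "separates v S" "meets_once (tails (Q ?n) v) (G ?n v) S" using I(3) vD by blast
    ultimately show ?thesis using tL by metis
  qed
  moreover have "F \<subseteq> L" using I(1) by (auto simp: L_def)
  moreover have "L \<subseteq> E" using I(2)[of 0] Q0(2) by (auto simp: L_def)
  ultimately show ?thesis by blast
qed

section \<open>Translation between linkages and path systems\<close>

lemma flame_link:
  assumes flame: "vertex_flame VF EF r" and EF: "EF \<subseteq> VF \<times> VF" "EF \<subseteq> F" "F - EF \<subseteq> {r} \<times> UNIV" and u: "u \<noteq> r"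
  shows "\<exists>g. linkage F u (tails F u) g"
proof (cases "u \<in> VF")
  case False
  then have "tails F u = {}" using EF by (auto simp: tails_def)
  then show ?thesis by (auto simp: linkage_def disjoint_paths_def)
next
  case True
  then have "in_edges EF u \<in> G_set VF EF r u" using flame u unfolding vertex_flame_def by blast
  then obtain P where P: "path_system VF EF r u P" "terminal_edges P = in_edges EF u" unfolding G_set_def by blast
  have tF: "(x, u) \<in> EF \<and> x \<noteq> r" if "x \<in> tails F u" for x using that EF by (auto simp: tails_def)
  have "\<forall>x\<in>tails F u. \<exists>m. r # m @ [u] \<in> P \<and> m \<noteq> [] \<and> last m = x"
  proof
    fix x assume "x \<in> tails F u"
    then have x: "(x, u) \<in> EF" "x \<noteq> r" using tF by blast+
    then have "(x, u) \<in> terminal_edges P" unfolding P(2) in_edges_def by simp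
    then obtain p where p: "p \<in> P" "last_edge p = (x, u)" unfolding terminal_edges_def by force
    have pp: "dipath EF p" "hd p = r" "last p = u" using P(1) p(1) unfolding path_system_def xy_path_def is_path_pth by auto
    obtain p' where p': "p = r # p'" using pp(2) dipath_ne[OF pp(1)] by (cases p) auto
    then have "p' \<noteq> []" using pp(3) u by auto
    then obtain m where m: "p' = m @ [u]" using pp(3) p' by (metis append_butlast_last_id last_ConsR)
    have lm: "last (r # m) = x" using p(2) p' m by (simp add: last_edge_def butlast_append)
    then have "m \<noteq> []" using x(2) by auto
    then show "\<exists>m. r # m @ [u] \<in> P \<and> m \<noteq> [] \<and> last m = x" using p(1) p' m lm by (intro exI[of _ m]) simp
  qed
  then obtain g where g: "\<forall>x\<in>tails F u. r # g x @ [u] \<in> P \<and> g x \<noteq> [] \<and> last (g x) = x" by (rule bchoice[THEN exE])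
  have gp: "dipath EF (r # g x @ [u])" if "x \<in> tails F u" for x
    using g that P(1) unfolding path_system_def xy_path_def is_path_pth by blast
  have "linkage F u (tails F u) g"
  proof (rule linkageI)
    fix x assume x: "x \<in> tails F u"
    have ne: "g x \<noteq> []" "last (g x) = x" using g x by blast+
    have 1: "dipath EF (g x @ [u])" "(r, hd (g x)) \<in> EF" "r \<notin> set (g x)"
      using gp[OF x] dipath_append[of "[r]" "g x @ [u]" EF] ne(1) by auto
    have 2: "dipath EF (g x)" "u \<notin> set (g x)" using 1(1) dipath_append[OF ne(1), of "[u]" EF] by auto
    have "hd (g x) \<in> N" using 1(2) EF(2) FE unfolding N_def by blast
    then show "dipath F (g x) \<and> hd (g x) \<in> N \<and> last (g x) = x \<and> r \<notin> set (g x) \<and> u \<notin> set (g x)"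
      using dipath_mono[OF 2(1) EF(2)] ne(2) 1(3) 2(2) by blast
  next
    fix x y z assume xy: "x \<in> tails F u" "y \<in> tails F u" "z \<in> set (g x)" "z \<in> set (g y)"
    \<comment> \<open>A common vertex of the stripped paths is an inner vertex of the full paths, so
      these must be the same member of \<open>P\<close>.\<close>
    have dx: "z \<noteq> r \<and> z \<noteq> u" using gp[OF xy(1)] xy(3) by (auto simp: dipath_def)
    have "r # g x @ [u] = r # g y @ [u]"
    proof (rule ccontr)
      assume "\<not> ?thesis"
      then have "set (r # g x @ [u]) \<inter> set (r # g y @ [u]) \<subseteq> {r, u}"
        using P(1) g xy(1,2) unfolding path_system_def by blast
      then show False using dx xy(3,4) by auto
    qed
    then have "g x = g y" by simp
    then show "x = y" using g xy(1,2) by metis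
  qed
  then show ?thesis by blast
qed

text \<open>The Erdos-Menger system lives without the edge from \<open>r\<close> to
  \<open>v\<close>. For the flame condition that edge is added as a path of its own, which is
  internally disjoint from all others.\<close>

lemma large_and_flame_at:
  assumes FL: "F \<subseteq> L" and LE: "L \<subseteq> E" and v: "v \<in> V" "v \<noteq> r"
    and g: "linkage L v (tails L v) g" and S: "separates v S" "meets_once (tails L v) g S"
  shows "v_large V E r L v" "in_edges L v \<in> G_set V L r v"
proof -
  define q where "q i = r # g i @ [v]" for i
  define P where "P = q ` tails L v"
  let ?L = "L - {(r, v)}"
  have rvL: "(r, n) \<in> L" if "n \<in> N" for n using that rF FL unfolding N_def by blast
  have qp: "dipath ?L (q i) \<and> set (q i) \<subseteq> V \<and> hd (q i) = r \<and> last (q i) = v \<and> last_edge (q i) = (i, v)" if i: "i \<in> tails L v" for i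
  proof -
    note K = linkageD[OF g i]
    have iv: "(i, v) \<in> L" "i \<noteq> r" using i by (auto simp: tails_def)
    have "dipath ?L (g i)"
    proof (rule dipath_steps[OF K(1)])
      fix q a b w assume "g i = q @ a # b # w" "(a, b) \<in> L"
      then show "(a, b) \<in> ?L" using K(5) by auto
    qed
    then have "dipath ?L (g i @ [v])" using dipath_append[OF K(6), of "[v]" ?L] K(4,5) iv by auto
    then have "dipath ?L ([r] @ g i @ [v])"
      using dipath_append[of "[r]" "g i @ [v]" ?L] K(2,3,5,6) rvL v(2) by auto
    moreover have "last_edge (q i) = (i, v)" using K(4,6) by (simp add: last_edge_def q_def butlast_append)
    ultimately show ?thesis using linkage_V[OF LE g i] rV v(1) by (simp add: q_def)
  qed
  have disj: "set (q i) \<inter> set (q j) \<subseteq> {r, v}" if "i \<in> tails L v" "j \<in> tails L v" "q i \<noteq> q j" for i j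
  proof -
    have "i \<noteq> j" using that(3) by blast
    then have "set (g i) \<inter> set (g j) = {}" using linkage_eq[OF g that(1,2)] by blast
    then show ?thesis by (auto simp: q_def)
  qed
  have ps: "path_system V H r v P" if LH: "?L \<subseteq> H" for H
    unfolding path_system_def
  proof (intro conjI ballI impI)
    fix p assume "p \<in> P"
    then obtain i where i: "i \<in> tails L v" "p = q i" unfolding P_def by blast
    show "xy_path V H r v p"
      unfolding xy_path_def is_path_pth i(2) using qp[OF i(1)] dipath_mono[OF _ LH] by blast
    fix p' assume "p' \<in> P" "p \<noteq> p'"
    then show "set p \<inter> set p' \<subseteq> {r, v}" using disj i unfolding P_def by blast
  qed
  have Srv: "r \<notin> S" "v \<notin> S" using S(1) unfolding separates_def by auto
  have SV: "S \<subseteq> V" using S(2) linkage_V[OF LE g] unfolding meets_once_def by blast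
  have sep: "separation V (E - {(r, v)}) r v S"
    unfolding separation_def
  proof (intro conjI allI impI)
    show "r \<noteq> v" "(r, v) \<notin> E - {(r, v)}" using v by auto
    show "S \<subseteq> V - {r, v}" using SV Srv by blast
    fix p assume "xy_path V (E - {(r, v)}) r v p"
    then have p: "dipath (E - {(r, v)}) p" "hd p = r" "last p = v" unfolding xy_path_def is_path_pth by auto
    obtain p' where p': "p = r # p'" using p(2) dipath_ne[OF p(1)] by (cases p) auto
    then have ne: "p' \<noteq> []" using p(3) v(2) by auto
    have 1: "dipath (E - {(r, v)}) p'" "(r, hd p') \<in> E - {(r, v)}" "r \<notin> set p'"
      using p(1) p' dipath_append[of "[r]" p' "E - {(r, v)}"] ne by auto
    have "dipath E p'" by (rule dipath_mono[OF 1(1)]) blast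
    moreover have "hd p' \<in> N - {v}" using 1(2) unfolding N_def by blast
    moreover have "last p' = v" using p(3) p' ne by simp
    ultimately have "set p' \<inter> S \<noteq> {}" using S(1) 1(3) unfolding separates_def by blast
    then show "set p \<inter> S \<noteq> {}" using p' by auto
  qed
  have eqS: "s \<in> set (q i) \<and> s \<in> S \<longleftrightarrow> s \<in> set (g i) \<and> s \<in> S" for i s using Srv by (auto simp: q_def)
  have orthog: "orthogonal P S"
    unfolding orthogonal_def
  proof
    show "\<forall>p\<in>P. \<exists>!s. s \<in> set p \<and> s \<in> S" using S(2) unfolding P_def meets_once_def by (simp add: eqS)
    show "S \<subseteq> (\<Union>p\<in>P. set p)" using S(2) unfolding P_def meets_once_def by (fastforce simp: q_def)
  qed
  have "?L \<subseteq> E - {(r, v)}" using LE by blast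
  from ps[OF this] have "P \<in> EM_systems V E r v" unfolding EM_systems_def erdos_menger_def using sep orthog by blast
  moreover have "\<forall>p\<in>P. is_path V L p"
  proof
    fix p assume "p \<in> P"
    then show "is_path V L p" using ps[of L] unfolding path_system_def xy_path_def by blast
  qed
  moreover have "(r, v) \<in> E \<longrightarrow> (r, v) \<in> L" using rF FL by blast
  ultimately show "v_large V E r L v" unfolding v_large_def using LE by blast
  define P' where "P' = P \<union> (if (r, v) \<in> L then {[r, v]} else {})"
  have psL: "path_system V L r v P" by (rule ps) blast
  have "path_system V L r v P'"
  proof -
    have "xy_path V L r v [r, v]" if "(r, v) \<in> L"
      using that v rV dipath_append[of "[r]" "[v]" L] unfolding xy_path_def is_path_pth by auto
    then show ?thesis using psL unfolding path_system_def P'_def by (auto split: if_splits)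
  qed
  moreover have "terminal_edges P' = in_edges L v"
  proof -
    have "last_edge ` q ` tails L v = (\<lambda>i. (i, v)) ` tails L v" unfolding image_image using qp by (intro image_cong) auto
    moreover have "last_edge [r, v] = (r, v)" by (simp add: last_edge_def)
    ultimately have "terminal_edges P' = (\<lambda>i. (i, v)) ` tails L v \<union> (if (r, v) \<in> L then {(r, v)} else {})"
      unfolding terminal_edges_def P'_def P_def by (simp add: image_Un)
    also have "\<dots> = in_edges L v" by (auto simp: in_edges_def tails_def)
    finally show ?thesis .
  qed
  ultimately show "in_edges L v \<in> G_set V L r v" unfolding G_set_def by blast
qed

end

theorem theorem1p4:
  fixes V :: "'a set" and E :: "('a \<times> 'a) set" and r :: 'a
    and VF :: "'a set" and EF :: "('a \<times> 'a) set"
  assumes "digraph V E" and "countable V" and "r \<in> V"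
    and "digraph VF EF" and "VF \<subseteq> V" and "EF \<subseteq> E" and "r \<in> VF"
    and "vertex_flame VF EF r"
  shows "\<exists>L. L \<subseteq> E \<and> EF \<subseteq> L \<and> D_large V E r L \<and> vertex_flame V L r"
proof -
  \<comment> \<open>Tails exclude \<open>r\<close> and linkages avoid it, so adding all edges that
    leave the root creates no new linkage condition; it secures the root edges demanded by
    largeness.\<close>
  define F where "F = EF \<union> {e \<in> E. fst e = r}"
  define N where "N = {n. (r, n) \<in> E}"
  have rooted: "rooted V E r F N"
    using assms(1-3,6) by unfold_locales (auto simp: digraph_def F_def N_def)
  \<comment> \<open>The reference linkages are a locale parameter but come from the flame itself; a
    dummy value gives access to the facts needed to obtain them.\<close>
  interpret A: rooted V E r F "\<lambda>_ _. []" N by (rule rooted)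
  have "\<exists>g. A.linkage F u (A.tails F u) g" if "u \<noteq> r" for u
    by (rule A.flame_link[OF assms(8)]) (use assms(4) that in \<open>auto simp: digraph_def F_def\<close>)
  then have "\<exists>R. \<forall>u\<in>- {r}. A.linkage F u (A.tails F u) (R u)" by (intro bchoice) blast
  then obtain R where R: "\<forall>u\<in>- {r}. A.linkage F u (A.tails F u) (R u)" ..
  interpret B: rooted V E r F R N by (rule rooted)
  obtain L where L: "F \<subseteq> L" "L \<subseteq> E"
    "\<forall>v\<in>V - {r}. \<exists>g S. B.linkage L v (B.tails L v) g \<and> B.separates v S \<and> B.meets_once (B.tails L v) g S"
    using B.large_flame R by blast
  have "v_large V E r L v \<and> in_edges L v \<in> G_set V L r v" if "v \<in> V - {r}" for v
    using L that B.large_and_flame_at[OF L(1,2)] by blast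
  then have "D_large V E r L" "vertex_flame V L r" unfolding D_large_def vertex_flame_def using L(2) by blast+
  moreover have "EF \<subseteq> L" using L(1) by (auto simp: F_def)
  ultimately show ?thesis using L(2) by blast
qed

end
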